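(* There are homeomorphisms \[ \mathrm{Hom}(\mathbb{Z}^{n},SO(3))/S^{1}_{n}(SO(3))\cong\begin{cases}\mathbb{R}P^{3}& \text{if } n=1,\\ (\mathbb{R}P^{2})^{n\lambda_{2}}\vee\Big(\bigvee_{C(n)}(\mathbb{S}^{3}/Q_{8})_{+}\Big)&\text{if } n\ge 2,\end{cases} \] \[ \mathrm{Hom}(\mathbb{Z}^{n},SU(2))/S^{1}_{n}(SU(2))\cong\begin{cases}\mathbb{S}^{3}&\text{if } n=1,\\ (\mathbb{R}P^{2})^{n\lambda_{2}}/s_{n}(\mathbb{R}P^{2})&\text{if } n\ge 2,\end{cases} \] \[ B_{n}(SU(2),\mathbb{Z}/2)/S^{1}_{n}(SU(2),\mathbb{Z}/2)\cong\begin{cases}\mathbb{S}^{3}&\text{if } n=1,\\ \Big(\bigvee_{K(n)}\mathbb{R}P^{3}_{+}\Big)\vee(\mathbb{R}P^{2})^{n\lambda_{2}}/s_{n}(\mathbb{R}P^{2})&\text{if } n\ge 2,\end{cases} \] where \[ C(n)=\tfrac12(3^{n-1}-1),\qquad K(n)=\frac{7^{n}}{24}-\frac{3^{n}}{8}+\frac{1}{12}. \]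
   Context: For a Lie group $G$ and a closed central subgroup $K$, $B_n(G,K)\subset G^n$ is the space of $n$-tuples with $[x_i,x_j]\in K$ for all $i,j$, and $S_n^1(G,K)$ is the subspace of tuples with at least one entry equal to $1_G$. For $K=\{1\}$ these are written $\mathrm{Hom}(\mathbb{Z}^n,G)$ (commuting $n$-tuples) and $S_n^1(G)$. Here $\mathbb{Z}/2=Z(SU(2))=\{\pm1\}$. $\lambda_2$ is the canonical (tautological) line bundle over $\mathbb{R}P^2$, $n\lambda_2$ the Whitney sum of $n$ copies, $(\mathbb{R}P^2)^{n\lambda_2}$ its Thom space, and $s_n$ the zero section of $n\lambda_2$, so that $s_n(\mathbb{R}P^2)$ is regarded as a subspace of the Thom space. $Q_8$ is the quaternion group of order $8$ in $SU(2)=\mathbb{S}^3$. $X_+$ is $X$ with a disjoint basepoint, and $\bigvee_{N}X$ is the wedge of $N$ copies of $X$. *)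

theory Defs
  imports "HOL-Analysis.Analysis" "HOL-Algebra.Coset"
begin

section \<open>Quotients, collapses, sums and wedges of spaces\<close>

definition identification_topology :: "'a topology \<Rightarrow> 'b set \<Rightarrow> ('a \<Rightarrow> 'b) \<Rightarrow> 'b topology" where
  "identification_topology X S f =
     topology (\<lambda>U. U \<subseteq> S \<and> openin X {x \<in> topspace X. f x \<in> U})"

lemma openin_identification_topology:
  "openin (identification_topology X S f) U \<longleftrightarrow> U \<subseteq> S \<and> openin X {x \<in> topspace X. f x \<in> U}"
proof -
  have "istopology (\<lambda>U. U \<subseteq> S \<and> openin X {x \<in> topspace X. f x \<in> U})"
    unfolding istopology_def
  proof (intro conjI allI impI)
    fix U V
    assume "U \<subseteq> S \<and> openin X {x \<in> topspace X. f x \<in> U}"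
      and "V \<subseteq> S \<and> openin X {x \<in> topspace X. f x \<in> V}"
    moreover have "{x \<in> topspace X. f x \<in> U \<inter> V}
        = {x \<in> topspace X. f x \<in> U} \<inter> {x \<in> topspace X. f x \<in> V}" by auto
    ultimately show "U \<inter> V \<subseteq> S" "openin X {x \<in> topspace X. f x \<in> U \<inter> V}" by auto
  next
    fix \<U>
    assume *: "\<forall>U\<in>\<U>. U \<subseteq> S \<and> openin X {x \<in> topspace X. f x \<in> U}"
    then show "\<Union>\<U> \<subseteq> S" by auto
    have "{x \<in> topspace X. f x \<in> \<Union>\<U>} = (\<Union>U\<in>\<U>. {x \<in> topspace X. f x \<in> U})" by auto
    with * show "openin X {x \<in> topspace X. f x \<in> \<Union>\<U>}" by auto
  qed
  then show ?thesis
    by (simp add: identification_topology_def)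
qed

lemma topspace_identification_topology:
  assumes "f ` topspace X \<subseteq> S"
  shows "topspace (identification_topology X S f) = S"
proof -
  have "{x \<in> topspace X. f x \<in> S} = topspace X" using assms by auto
  then have "openin (identification_topology X S f) S"
    by (simp add: openin_identification_topology)
  then show ?thesis
    by (meson openin_identification_topology openin_subset openin_topspace subset_antisym)
qed

lemma quotient_map_identification_topology:
  assumes "f ` topspace X = S"
  shows "quotient_map X (identification_topology X S f) f"
  using assms
  by (simp add: quotient_map_def topspace_identification_topology openin_identification_topology)

text \<open>The pointed space \<open>X/A\<close>. Its basepoint, the class of \<open>A\<close>, is \<open>None\<close>, and the point of
  \<open>X \<setminus> A\<close> given by \<open>x\<close> is \<open>Some x\<close>. For empty \<open>A\<close> this adds an isolated basepoint, following
  the convention that \<open>X/{} = X\<^sub>+\<close>.\<close>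

definition collapse_map :: "'a set \<Rightarrow> 'a \<Rightarrow> 'a option" where
  "collapse_map A x = (if x \<in> A then None else Some x)"

definition collapse :: "'a topology \<Rightarrow> 'a set \<Rightarrow> 'a option topology" where
  "collapse X A =
     identification_topology X (insert None (Some ` (topspace X - A))) (collapse_map A)"

lemma topspace_collapse: "topspace (collapse X A) = insert None (Some ` (topspace X - A))"
  unfolding collapse_def
  by (rule topspace_identification_topology) (auto simp: collapse_map_def)

lemma quotient_map_collapse:
  assumes "A \<subseteq> topspace X" "A \<noteq> {}"
  shows "quotient_map X (collapse X A) (collapse_map A)"
  unfolding collapse_def
  using assms by (intro quotient_map_identification_topology) (auto simp: collapse_map_def image_iff)

abbreviation add_basepoint :: "'a topology \<Rightarrow> 'a option topology" where
  "add_basepoint X \<equiv> collapse X {}"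

lemma openin_add_basepoint:
  "openin (add_basepoint X) U \<longleftrightarrow>
     U \<subseteq> insert None (Some ` topspace X) \<and> openin X {x \<in> topspace X. Some x \<in> U}"
  by (simp add: collapse_def openin_identification_topology collapse_map_def)

definition disjoint_sum :: "'a topology \<Rightarrow> 'b topology \<Rightarrow> ('a + 'b) topology" where
  "disjoint_sum X Y = topology (\<lambda>U. openin X (Inl -` U) \<and> openin Y (Inr -` U))"

lemma openin_disjoint_sum:
  "openin (disjoint_sum X Y) U \<longleftrightarrow> openin X (Inl -` U) \<and> openin Y (Inr -` U)"
proof -
  have "istopology (\<lambda>U. openin X (Inl -` U) \<and> openin Y (Inr -` U))"
    by (auto simp: istopology_def vimage_Union)
  then show ?thesis
    by (simp add: disjoint_sum_def)
qed

lemma topspace_disjoint_sum: "topspace (disjoint_sum X Y) = topspace X <+> topspace Y"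
proof
  show "topspace (disjoint_sum X Y) \<subseteq> topspace X <+> topspace Y"
  proof
    fix z assume z: "z \<in> topspace (disjoint_sum X Y)"
    have "openin X (Inl -` topspace (disjoint_sum X Y))"
      "openin Y (Inr -` topspace (disjoint_sum X Y))"
      using openin_disjoint_sum openin_topspace by blast+
    with z show "z \<in> topspace X <+> topspace Y"
      by (cases z) (auto dest!: openin_subset)
  qed
  have "Inl -` (topspace X <+> topspace Y) = topspace X"
    "Inr -` (topspace X <+> topspace Y) = topspace Y" by auto
  then have "openin (disjoint_sum X Y) (topspace X <+> topspace Y)"
    by (simp add: openin_disjoint_sum)
  then show "topspace X <+> topspace Y \<subseteq> topspace (disjoint_sum X Y)"
    by (rule openin_subset)
qed

definition wedge :: "'a topology \<Rightarrow> 'a \<Rightarrow> 'b topology \<Rightarrow> 'b \<Rightarrow> ('a + 'b) option topology" where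
  "wedge X x0 Y y0 = collapse (disjoint_sum X Y) {Inl x0, Inr y0}"

text \<open>The wedge of \<open>N\<close> copies of \<open>(X, x0)\<close>, with basepoint \<open>None\<close>; a single point for \<open>N = 0\<close>.\<close>

definition bouquet :: "nat \<Rightarrow> 'a topology \<Rightarrow> 'a \<Rightarrow> (nat \<times> 'a) option topology" where
  "bouquet N X x0 = collapse (sum_topology (\<lambda>_. X) {..<N}) ((\<lambda>i. (i, x0)) ` {..<N})"


section \<open>Projective spaces, the tautological bundle and Thom spaces\<close>

text \<open>Projective space on a Euclidean space \<open>V\<close>: the unit sphere modulo the antipodal map. The
  line represented by a point \<open>l = {x, -x}\<close> is \<open>span l\<close>. Thus \<open>V = \<real>\<^sup>3\<close> gives the projective plane
  and \<open>V = \<real>\<^sup>4\<close> gives projective 3-space.\<close>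

definition projective_space :: "'a::euclidean_space set topology" where
  "projective_space = identification_topology (top_of_set (sphere 0 1))
     ((\<lambda>x. {x, - x}) ` sphere 0 1) (\<lambda>x. {x, - x})"

abbreviation RP2 :: "(real^3) set topology" where "RP2 \<equiv> projective_space"
abbreviation RP3 :: "(real^4) set topology" where "RP3 \<equiv> projective_space"

lemma quotient_map_projective_space:
  "quotient_map (top_of_set (sphere 0 1)) projective_space (\<lambda>x::'a::euclidean_space. {x, - x})"
  unfolding projective_space_def by (rule quotient_map_identification_topology) simp

definition tautological_bundle :: "('a::euclidean_space set \<times> 'a) topology" where
  "tautological_bundle =
     subtopology (prod_topology projective_space euclidean) {(l, v). v \<in> span l}"

text \<open>The \<open>n\<close>-fold Whitney sum of the bundle \<open>p : E \<rightarrow> B\<close>: the pullback of its \<open>n\<close>-fold cartesian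
  power along the diagonal of \<open>B\<close>. The projection to \<open>B\<close> is \<open>fst\<close>.\<close>

definition whitney_power :: "nat \<Rightarrow> 'b topology \<Rightarrow> 'e topology \<Rightarrow> ('e \<Rightarrow> 'b)
    \<Rightarrow> ('b \<times> (nat \<Rightarrow> 'e)) topology" where
  "whitney_power n B E p =
     subtopology (prod_topology B (product_topology (\<lambda>_. E) {..<n})) {(b, e). \<forall>i<n. p (e i) = b}"

text \<open>The Thom space of a bundle with total space \<open>E\<close> and fibrewise Euclidean norm \<open>nrm\<close>: the disk
  bundle modulo the sphere bundle. The basepoint is \<open>None\<close>.\<close>

definition Thom_space :: "'e topology \<Rightarrow> ('e \<Rightarrow> real) \<Rightarrow> 'e option topology" where
  "Thom_space E nrm =
     collapse (subtopology E {e. nrm e \<le> 1}) {e \<in> topspace E. nrm e = 1}"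

type_synonym lambda2_sum = "(real^3) set \<times> (nat \<Rightarrow> (real^3) set \<times> (real^3))"

definition n_lambda2 :: "nat \<Rightarrow> lambda2_sum topology" where
  "n_lambda2 n = whitney_power n RP2 tautological_bundle fst"

definition n_lambda2_norm :: "nat \<Rightarrow> lambda2_sum \<Rightarrow> real" where
  "n_lambda2_norm n = (\<lambda>(l, e). L2_set (\<lambda>i. norm (snd (e i))) {..<n})"

definition zero_section :: "nat \<Rightarrow> (real^3) set \<Rightarrow> lambda2_sum" where
  "zero_section n l = (l, \<lambda>i\<in>{..<n}. (l, 0))"

definition Thom_n_lambda2 :: "nat \<Rightarrow> lambda2_sum option topology" where
  "Thom_n_lambda2 n = Thom_space (n_lambda2 n) (n_lambda2_norm n)"

text \<open>The quotient of the Thom space by the image of the zero section. Here \<open>Some None\<close> is the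
  basepoint of the Thom space (the point at infinity) and \<open>None\<close> is the collapsed zero section.\<close>

definition Thom_mod_zero :: "nat \<Rightarrow> lambda2_sum option option topology" where
  "Thom_mod_zero n = collapse (Thom_n_lambda2 n) (Some ` zero_section n ` topspace RP2)"


section \<open>The groups\<close>

definition conj_transpose :: "complex^'n^'m \<Rightarrow> complex^'m^'n" where
  "conj_transpose A = (\<chi> i j. cnj (A $ j $ i))"

definition unitary_matrix :: "complex^'n^'n \<Rightarrow> bool" where
  "unitary_matrix A \<longleftrightarrow> conj_transpose A ** A = mat 1 \<and> A ** conj_transpose A = mat 1"

definition SO3 :: "(real^3^3) monoid" where
  "SO3 = \<lparr>carrier = {A. rotation_matrix A}, mult = (**), one = mat 1\<rparr>"

definition SU2 :: "(complex^2^2) monoid" where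
  "SU2 = \<lparr>carrier = {A. unitary_matrix A \<and> det A = 1}, mult = (**), one = mat 1\<rparr>"

lemma conj_transpose_mult:
  "conj_transpose (A ** B) = conj_transpose B ** conj_transpose (A :: complex^'n^'n)"
  by (simp add: conj_transpose_def matrix_matrix_mult_def vec_eq_iff mult.commute)

lemma conj_transpose_conj_transpose: "conj_transpose (conj_transpose A) = A"
  by (simp add: conj_transpose_def vec_eq_iff)

lemma conj_transpose_one: "conj_transpose (mat 1 :: complex^'n^'n) = mat 1"
  by (auto simp: conj_transpose_def mat_def vec_eq_iff)

lemma group_SO3: "group SO3"
proof (rule groupI)
  fix x assume "x \<in> carrier SO3"
  then show "\<exists>y\<in>carrier SO3. y \<otimes>\<^bsub>SO3\<^esub> x = \<one>\<^bsub>SO3\<^esub>"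
    by (intro bexI[of _ "transpose x"])
       (auto simp: SO3_def rotation_matrix_def orthogonal_matrix_def)
qed (auto simp: SO3_def rotation_matrix_def orthogonal_matrix_mul orthogonal_matrix_id det_mul
      matrix_mul_assoc)

lemma group_SU2: "group SU2"
proof (rule groupI)
  fix x y assume xy: "x \<in> carrier SU2" "y \<in> carrier SU2"
  have "conj_transpose y ** conj_transpose x ** (x ** y)
      = conj_transpose y ** (conj_transpose x ** x) ** y"
    "x ** y ** (conj_transpose y ** conj_transpose x)
      = x ** (y ** conj_transpose y) ** conj_transpose x"
    by (simp_all add: matrix_mul_assoc)
  then show "x \<otimes>\<^bsub>SU2\<^esub> y \<in> carrier SU2"
    using xy by (simp add: SU2_def unitary_matrix_def conj_transpose_mult det_mul)
next
  fix x assume x: "x \<in> carrier SU2"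
  have "conj_transpose x ** x = mat 1" "det x = 1"
    using x by (auto simp: SU2_def unitary_matrix_def)
  then have "det (conj_transpose x) = 1"
    using det_mul[of "conj_transpose x" x] by simp
  then have "conj_transpose x \<in> carrier SU2"
    using x by (auto simp: SU2_def unitary_matrix_def conj_transpose_conj_transpose)
  then show "\<exists>y\<in>carrier SU2. y \<otimes>\<^bsub>SU2\<^esub> x = \<one>\<^bsub>SU2\<^esub>"
    using x by (intro bexI[of _ "conj_transpose x"]) (auto simp: SU2_def unitary_matrix_def)
qed (auto simp: SU2_def unitary_matrix_def conj_transpose_one matrix_mul_assoc)

definition quat_i :: "complex^2^2" where "quat_i = vector [vector [\<i>, 0], vector [0, - \<i>]]"
definition quat_j :: "complex^2^2" where "quat_j = vector [vector [0, 1], vector [- 1, 0]]"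
definition quat_k :: "complex^2^2" where "quat_k = vector [vector [0, \<i>], vector [\<i>, 0]]"

definition Q8 :: "(complex^2^2) set" where
  "Q8 = {mat 1, - mat 1, quat_i, - quat_i, quat_j, - quat_j, quat_k, - quat_k}"

definition pm_one :: "(complex^2^2) set" where
  "pm_one = {mat 1, - mat 1}"

lemma mat2_eq_iff: "(A :: 'a^2^2) = B \<longleftrightarrow>
    A $ 1 $ 1 = B $ 1 $ 1 \<and> A $ 1 $ 2 = B $ 1 $ 2 \<and> A $ 2 $ 1 = B $ 2 $ 1 \<and> A $ 2 $ 2 = B $ 2 $ 2"
  by (auto simp: vec_eq_iff forall_2)

lemma Q8_subset_SU2: "Q8 \<subseteq> carrier SU2"
  by (auto simp: Q8_def SU2_def unitary_matrix_def conj_transpose_def quat_i_def quat_j_def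
      quat_k_def mat2_eq_iff matrix_matrix_mult_def sum_2 det_2 mat_def)

lemma quat_mult:
  "quat_i ** quat_i = - mat 1" "quat_j ** quat_j = - mat 1" "quat_k ** quat_k = - mat 1"
  "quat_i ** quat_j = quat_k" "quat_j ** quat_k = quat_i" "quat_k ** quat_i = quat_j"
  "quat_j ** quat_i = - quat_k" "quat_k ** quat_j = - quat_i" "quat_i ** quat_k = - quat_j"
  by (simp_all add: quat_i_def quat_j_def quat_k_def mat2_eq_iff matrix_matrix_mult_def sum_2 mat_def)

lemma center_SU2: "pm_one = {z \<in> carrier SU2. \<forall>x\<in>carrier SU2. z \<otimes>\<^bsub>SU2\<^esub> x = x \<otimes>\<^bsub>SU2\<^esub> z}"
proof
  have "- mat 1 \<in> carrier SU2" "mat 1 \<in> carrier SU2"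
    using Q8_subset_SU2 by (auto simp: Q8_def)
  then show "pm_one \<subseteq> {z \<in> carrier SU2. \<forall>x\<in>carrier SU2. z \<otimes>\<^bsub>SU2\<^esub> x = x \<otimes>\<^bsub>SU2\<^esub> z}"
    by (auto simp: pm_one_def SU2_def mat2_eq_iff matrix_matrix_mult_def sum_2 mat_def)
  show "{z \<in> carrier SU2. \<forall>x\<in>carrier SU2. z \<otimes>\<^bsub>SU2\<^esub> x = x \<otimes>\<^bsub>SU2\<^esub> z} \<subseteq> pm_one"
  proof clarify
    fix z assume z: "z \<in> carrier SU2" "\<forall>x\<in>carrier SU2. z \<otimes>\<^bsub>SU2\<^esub> x = x \<otimes>\<^bsub>SU2\<^esub> z"
    have "z ** quat_i = quat_i ** z" "z ** quat_j = quat_j ** z"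
      using z Q8_subset_SU2 by (auto simp: SU2_def Q8_def)
    then have *: "z $ 1 $ 2 = 0" "z $ 2 $ 1 = 0" "z $ 2 $ 2 = z $ 1 $ 1"
      by (auto simp: quat_i_def quat_j_def mat2_eq_iff matrix_matrix_mult_def sum_2 eq_neg_iff_add_eq_0)
    have "det z = 1" using z by (simp add: SU2_def)
    then have "z $ 1 $ 1 = 1 \<or> z $ 1 $ 1 = - 1"
      using * by (simp add: det_2 square_eq_1_iff)
    then show "z \<in> pm_one"
      using * by (auto simp: pm_one_def mat2_eq_iff mat_def)
  qed
qed

definition S3 :: "(real^4) topology" where
  "S3 = top_of_set (sphere 0 1)"

text \<open>The quotient of the 3-sphere, viewed as \<open>SU(2)\<close>, by \<open>Q8\<close>: the space of left cosets.\<close>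

definition S3_mod_Q8 :: "(complex^2^2) set topology" where
  "S3_mod_Q8 = identification_topology (top_of_set (carrier SU2))
     ((\<lambda>g. g <#\<^bsub>SU2\<^esub> Q8) ` carrier SU2) (\<lambda>g. g <#\<^bsub>SU2\<^esub> Q8)"


section \<open>Spaces of almost commuting tuples\<close>

text \<open>The groups are matrix groups, topologised as subspaces of the matrix space. An \<open>n\<close>-tuple is
  a function on \<open>{..<n}\<close>.\<close>

definition commutator :: "('a, 'm) monoid_scheme \<Rightarrow> 'a \<Rightarrow> 'a \<Rightarrow> 'a" where
  "commutator G x y = x \<otimes>\<^bsub>G\<^esub> y \<otimes>\<^bsub>G\<^esub> inv\<^bsub>G\<^esub> x \<otimes>\<^bsub>G\<^esub> inv\<^bsub>G\<^esub> y"

definition B_space :: "nat \<Rightarrow> ('a::topological_space) monoid \<Rightarrow> 'a set \<Rightarrow> (nat \<Rightarrow> 'a) topology" where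
  "B_space n G K = subtopology (product_topology (\<lambda>_. top_of_set (carrier G)) {..<n})
     {x. \<forall>i<n. \<forall>j<n. commutator G (x i) (x j) \<in> K}"

definition S1_set :: "nat \<Rightarrow> ('a::topological_space) monoid \<Rightarrow> 'a set \<Rightarrow> (nat \<Rightarrow> 'a) set" where
  "S1_set n G K = {x \<in> topspace (B_space n G K). \<exists>i<n. x i = \<one>\<^bsub>G\<^esub>}"

abbreviation Hom_space :: "nat \<Rightarrow> ('a::topological_space) monoid \<Rightarrow> (nat \<Rightarrow> 'a) topology" where
  "Hom_space n G \<equiv> B_space n G {\<one>\<^bsub>G\<^esub>}"

abbreviation Hom_S1_set :: "nat \<Rightarrow> ('a::topological_space) monoid \<Rightarrow> (nat \<Rightarrow> 'a) set" where
  "Hom_S1_set n G \<equiv> S1_set n G {\<one>\<^bsub>G\<^esub>}"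


section \<open>The numbers of components\<close>

text \<open>For \<open>n \<ge> 1\<close> both formulas give natural numbers, so rounding down changes nothing; this is
  the content of the two lemmas below.\<close>

definition C_num :: "nat \<Rightarrow> nat" where
  "C_num n = nat \<lfloor>1 / 2 * (3 ^ (n - 1) - 1) :: real\<rfloor>"

definition K_num :: "nat \<Rightarrow> nat" where
  "K_num n = nat \<lfloor>7 ^ n / 24 - 3 ^ n / 8 + 1 / 12 :: real\<rfloor>"

lemma real_C_num: "real (C_num n) = 1 / 2 * (3 ^ (n - 1) - 1)"
proof -
  have "\<exists>m::nat. (3::real) ^ k = 2 * real m + 1" for k
  proof (induction k)
    case (Suc k)
    then obtain m where "(3::real) ^ k = 2 * real m + 1" by blast
    then show ?case by (intro exI[of _ "3 * m + 1"]) simp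
  qed (auto intro: exI[of _ 0])
  then obtain m :: nat where "(3::real) ^ (n - 1) = 2 * real m + 1" by blast
  then show ?thesis by (simp add: C_num_def)
qed

lemma real_K_num: "real (K_num n) = 7 ^ n / 24 - 3 ^ n / 8 + 1 / 12"
proof -
  have odd: "\<exists>m::nat. (3::real) ^ k = 2 * real m + 1" for k
  proof (induction k)
    case (Suc k)
    then obtain m where "(3::real) ^ k = 2 * real m + 1" by blast
    then show ?case by (intro exI[of _ "3 * m + 1"]) simp
  qed (auto intro: exI[of _ 0])
  have "\<exists>m::nat. (7::real) ^ k + 2 = 3 * 3 ^ k + 24 * real m" for k
  proof (induction k)
    case (Suc k)
    then obtain m where m: "(7::real) ^ k + 2 = 3 * 3 ^ k + 24 * real m" by blast
    obtain a where a: "(3::real) ^ k = 2 * real a + 1" using odd by blast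
    show ?case using m a by (intro exI[of _ "7 * m + a"]) simp
  qed (auto intro: exI[of _ 0])
  then obtain m :: nat where "(7::real) ^ n + 2 = 3 * 3 ^ n + 24 * real m" by blast
  then have "(7::real) ^ n / 24 - 3 ^ n / 8 + 1 / 12 = real m" by (simp add: field_simps)
  then show ?thesis unfolding K_num_def by simp
qed

end

theory Submission
  imports Defs
begin

text \<open>A tuple with no entry equal to 1 is of one of two kinds. If all entries lie in a common circle
  subgroup, with axis the line \<open>l\<close>, then each entry is a point of (circle minus 1), an open interval
  in \<open>l\<close>, and the tuple is a point of the open disk bundle of \<open>n \<lambda>\<^sub>2\<close>; in SU(2) the axis of the tuple
  \<open>(-1, \<dots>, -1)\<close> is not determined, which collapses the zero section. Otherwise two entries
  anticommute in SU(2), up to lifting. Then each entry is \<open>-1\<close> or plus or minus a vector of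
  one orthonormal frame of imaginary quaternions, so that the tuple is the image of a unique word in standard
  position under a unique rotation. Words are counted by a recursion on their length. Each
  homeomorphism is obtained from a continuous bijection from the compact right-hand side onto the
  Hausdorff left-hand side.\<close>

section \<open>Maps out of collapses, sums and wedges\<close>

text \<open>The two families of orbit summands differ because of stabilizers. A word read in SU(2)
  contains \<open>e1\<close> and \<open>e2\<close> with their signs, so only the identity rotation
  fixes it and its orbit is a copy of SO(3), that is, of \<open>RP3\<close>. Read in SO(3), each
  letter is a half-turn, blind to the sign of its axis; the rotations fixing the tuple are the four
  that preserve every coordinate axis, their lifts form \<open>Q8\<close>, and the orbit is
  \<open>S3_mod_Q8\<close>. Orbits avoid the tuples with an entry 1, so nothing in them is collapsed
  and each receives a disjoint basepoint. In SO(3) the centre of a fibre of the disk bundle is a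
  half-turn, which still has an axis, so there the zero section survives. Lines admit no continuous
  choice of a unit vector \<open>u\<close>; the maps out of the disk bundle are therefore written
  through expressions unchanged when \<open>(s, u)\<close> becomes \<open>(-s, -u)\<close>, such as
  \<open>s u\<close> and \<open>outer u\<close>.\<close>

lemma continuous_map_identification_topology:
  assumes "f ` topspace X = S" "continuous_map X Z (h \<circ> f)"
  shows "continuous_map (identification_topology X S f) Z h"
  by (rule continuous_compose_quotient_map[OF quotient_map_identification_topology[OF assms(1)] assms(2)])

lemma openin_collapse:
  "openin (collapse X A) U \<longleftrightarrow> U \<subseteq> insert None (Some ` (topspace X - A)) \<and>
     openin X {x \<in> topspace X. collapse_map A x \<in> U}"
  by (simp add: collapse_def openin_identification_topology)

lemma continuous_map_collapse_map: "continuous_map X (collapse X A) (collapse_map A)"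
  unfolding continuous_map topspace_collapse openin_collapse
  by (auto simp: collapse_map_def)

text \<open>The basepoint \<open>None\<close> belongs to the collapse even when \<open>A\<close> is
  empty, so \<open>collapse_map\<close> need not be onto. Hence \<open>b\<close> is required to lie
  in \<open>Z\<close>, and preimages are computed directly instead of through a quotient
  map.\<close>

lemma continuous_map_from_collapse:
  assumes "continuous_map X Z f" "\<And>x. x \<in> topspace X \<inter> A \<Longrightarrow> f x = b" "b \<in> topspace Z"
  shows "continuous_map (collapse X A) Z (case_option b f)"
  unfolding continuous_map
proof (intro conjI allI impI)
  show "case_option b f ` topspace (collapse X A) \<subseteq> topspace Z"
    using assms by (auto simp: topspace_collapse continuous_map_def)
  fix U assume U: "openin Z U"
  have "{x \<in> topspace X. collapse_map A x \<in> {x \<in> topspace (collapse X A). case_option b f x \<in> U}}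
      = {x \<in> topspace X. f x \<in> U}"
    using assms(2) by (auto simp: topspace_collapse collapse_map_def)
  then show "openin (collapse X A) {x \<in> topspace (collapse X A). case_option b f x \<in> U}"
    using assms(1) U unfolding openin_collapse by (auto simp: continuous_map topspace_collapse)
qed

lemma compact_space_collapse:
  assumes "compact_space X"
  shows "compact_space (collapse X A)"
proof -
  have "compactin (collapse X A) (collapse_map A ` topspace X)"
    using assms compact_space_def image_compactin continuous_map_collapse_map by blast
  moreover have "compactin (collapse X A) {None}"
    by (simp add: topspace_collapse)
  ultimately have "compactin (collapse X A) (collapse_map A ` topspace X \<union> {None})"
    by (rule compactin_Un)
  moreover have "collapse_map A ` topspace X \<union> {None} = topspace (collapse X A)"
    by (auto simp: topspace_collapse collapse_map_def image_iff)
  ultimately show ?thesis by (simp add: compact_space_def)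
qed

text \<open>Open sets that miss \<open>A\<close> or contain \<open>A\<close> descend to the
  collapse. Two points off \<open>A\<close> are separated inside the open complement of
  \<open>A\<close>; a point off \<open>A\<close> is separated from the basepoint because regularity
  separates it from the closed set \<open>A\<close>.\<close>

lemma Hausdorff_space_collapse:
  assumes "Hausdorff_space X" "regular_space X" "closedin X A"
  shows "Hausdorff_space (collapse X A)"
proof -
  have A: "A \<subseteq> topspace X" using assms(3) closedin_subset by blast
  have open_Some: "openin (collapse X A) (Some ` U)" if "openin X U" "U \<inter> A = {}" for U
  proof -
    have "{x \<in> topspace X. collapse_map A x \<in> Some ` U} = U"
      using that openin_subset by (fastforce simp: collapse_map_def split: if_splits)
    then show ?thesis using that openin_subset[OF that(1)] by (auto simp: openin_collapse)
  qed
  have open_None: "openin (collapse X A) (insert None (Some ` (U - A)))" if "openin X U" "A \<subseteq> U" for U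
  proof -
    have "{x \<in> topspace X. collapse_map A x \<in> insert None (Some ` (U - A))} = U"
      using that openin_subset by (fastforce simp: collapse_map_def split: if_splits)
    then show ?thesis using that openin_subset[OF that(1)] by (auto simp: openin_collapse)
  qed
  have sep_None: "\<exists>U V. openin (collapse X A) U \<and> openin (collapse X A) V \<and> None \<in> U \<and> Some x \<in> V \<and> disjnt U V"
    if x: "x \<in> topspace X - A" for x
  proof -
    obtain U V where "openin X U" "openin X V" "x \<in> U" "A \<subseteq> V" "disjnt U V"
      using assms(2,3) x unfolding regular_space_def by meson
    then show ?thesis
      using A by (intro exI[of _ "insert None (Some ` (V - A))"] exI[of _ "Some ` U"] conjI open_Some open_None)
        (auto simp: disjnt_def)
  qed
  have sep_Some: "\<exists>U V. openin (collapse X A) U \<and> openin (collapse X A) V \<and> Some x \<in> U \<and> Some y \<in> V \<and> disjnt U V"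
    if xy: "x \<in> topspace X - A" "y \<in> topspace X - A" "x \<noteq> y" for x y
  proof -
    obtain U V where UV: "openin X U" "openin X V" "x \<in> U" "y \<in> V" "disjnt U V"
      using assms(1) xy unfolding Hausdorff_space_def by (meson DiffD1)
    then have "openin X (U - A)" "openin X (V - A)"
      using assms(3) by auto
    then show ?thesis
      using UV xy by (intro exI[of _ "Some ` (U - A)"] exI[of _ "Some ` (V - A)"] conjI open_Some)
        (auto simp: disjnt_def)
  qed
  show ?thesis
    unfolding Hausdorff_space_def
  proof clarify
    fix p q assume pq: "p \<in> topspace (collapse X A)" "q \<in> topspace (collapse X A)" "p \<noteq> q"
    consider x where "p = None" "q = Some x" "x \<in> topspace X - A"
      | x where "q = None" "p = Some x" "x \<in> topspace X - A"
      | x y where "p = Some x" "q = Some y" "x \<in> topspace X - A" "y \<in> topspace X - A" "x \<noteq> y"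
      using pq unfolding topspace_collapse by blast
    then show "\<exists>U V. openin (collapse X A) U \<and> openin (collapse X A) V \<and> p \<in> U \<and> q \<in> V \<and> disjnt U V"
    proof cases
      case 1 then show ?thesis using sep_None by blast
    next
      case 2 then show ?thesis using sep_None disjnt_sym by meson
    next
      case 3 then show ?thesis using sep_Some by blast
    qed
  qed
qed

section \<open>Disjoint sums\<close>

lemma continuous_map_from_disjoint_sum:
  assumes "continuous_map X Z f" "continuous_map Y Z g"
  shows "continuous_map (disjoint_sum X Y) Z (case_sum f g)"
  unfolding continuous_map
proof (intro conjI allI impI)
  show "case_sum f g ` topspace (disjoint_sum X Y) \<subseteq> topspace Z"
    using assms by (auto simp: topspace_disjoint_sum continuous_map_def)
  fix U assume U: "openin Z U"
  have "Inl -` {x \<in> topspace (disjoint_sum X Y). case_sum f g x \<in> U} = {x \<in> topspace X. f x \<in> U}"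
    "Inr -` {x \<in> topspace (disjoint_sum X Y). case_sum f g x \<in> U} = {x \<in> topspace Y. g x \<in> U}"
    by (auto simp: topspace_disjoint_sum)
  then show "openin (disjoint_sum X Y) {x \<in> topspace (disjoint_sum X Y). case_sum f g x \<in> U}"
    using assms U by (simp add: openin_disjoint_sum continuous_map)
qed

lemma compact_space_disjoint_sum:
  assumes "compact_space X" "compact_space Y"
  shows "compact_space (disjoint_sum X Y)"
proof -
  have "{x \<in> topspace X. Inl x \<in> U} = Inl -` U" "{y \<in> topspace Y. Inr y \<in> U} = Inr -` U"
    if "openin (disjoint_sum X Y) U" for U
    using that openin_subset unfolding openin_disjoint_sum by fastforce+
  then have "continuous_map X (disjoint_sum X Y) Inl" "continuous_map Y (disjoint_sum X Y) Inr"
    by (auto simp: continuous_map topspace_disjoint_sum) (simp_all add: openin_disjoint_sum)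
  then have "compactin (disjoint_sum X Y) (Inl ` topspace X \<union> Inr ` topspace Y)"
    using assms by (intro compactin_Un) (auto simp: compact_space_def intro: image_compactin)
  then show ?thesis
    by (simp add: compact_space_def topspace_disjoint_sum Plus_def)
qed

lemma continuous_map_from_sum_topology:
  assumes "\<And>i. i \<in> I \<Longrightarrow> continuous_map (X i) Z (f i)"
  shows "continuous_map (sum_topology X I) Z (\<lambda>(i, x). f i x)"
  unfolding continuous_map
proof (intro conjI allI impI)
  show "(\<lambda>(i, x). f i x) ` topspace (sum_topology X I) \<subseteq> topspace Z"
    using assms by (fastforce simp: continuous_map_def)
  fix U assume U: "openin Z U"
  have "{x. (i, x) \<in> {p \<in> topspace (sum_topology X I). (case p of (i, x) \<Rightarrow> f i x) \<in> U}}
      = {x \<in> topspace (X i). f i x \<in> U}" if "i \<in> I" for i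
    using that by auto
  then show "openin (sum_topology X I) {p \<in> topspace (sum_topology X I). (case p of (i, x) \<Rightarrow> f i x) \<in> U}"
    using assms U by (auto simp: openin_sum_topology continuous_map)
qed

lemma compact_space_sum_topology:
  assumes "finite I" "\<And>i. i \<in> I \<Longrightarrow> compact_space (X i)"
  shows "compact_space (sum_topology X I)"
proof -
  have "compactin (sum_topology X I) (\<Union>i\<in>I. Pair i ` topspace (X i))"
    using assms
    by (intro compactin_Union) (auto simp: compact_space_def intro: image_compactin continuous_map_component_injection)
  moreover have "(\<Union>i\<in>I. Pair i ` topspace (X i)) = topspace (sum_topology X I)" by auto
  ultimately show ?thesis by (simp add: compact_space_def)
qed

text \<open>All homeomorphisms are built as continuous bijections from a compact space onto a Hausdorff
  space. The next predicate describes such maps wedge summand by wedge summand: \<open>S\<close> is the part of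
  the pointed target \<open>(Z, z0)\<close> that \<open>f\<close> covers away from the basepoint.\<close>

definition covers :: "'a topology \<Rightarrow> 'a \<Rightarrow> 'b topology \<Rightarrow> 'b \<Rightarrow> ('a \<Rightarrow> 'b) \<Rightarrow> 'b set \<Rightarrow> bool" where
  "covers X x0 Z z0 f S \<longleftrightarrow> compact_space X \<and> continuous_map X Z f \<and> x0 \<in> topspace X \<and>
     f x0 = z0 \<and> bij_betw f (topspace X - {x0}) S \<and> z0 \<notin> S"

lemma covers_imp_homeomorphic_space:
  assumes "covers X x0 Z z0 f (topspace Z - {z0})" "Hausdorff_space Z"
  shows "Z homeomorphic_space X"
proof -
  have f: "compact_space X" "continuous_map X Z f" "x0 \<in> topspace X" "f x0 = z0"
    "bij_betw f (topspace X - {x0}) (topspace Z - {z0})"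
    using assms(1) by (auto simp: covers_def)
  have "z0 \<in> topspace Z" using f by (auto simp: continuous_map_def)
  have "bij_betw f (insert x0 (topspace X - {x0})) (insert z0 (topspace Z - {z0}))"
    using f notIn_Un_bij_betw[of x0 "topspace X - {x0}" f "topspace Z - {z0}"] by auto
  then have "bij_betw f (topspace X) (topspace Z)"
    using f(3) \<open>z0 \<in> topspace Z\<close> by (simp add: insert_absorb)
  then have "homeomorphic_map X Z f"
    using f assms(2) by (intro continuous_imp_homeomorphic_map) (auto simp: bij_betw_def)
  then have "X homeomorphic_space Z" by (rule homeomorphic_map_imp_homeomorphic_space)
  then show ?thesis by (subst homeomorphic_space_sym)
qed

lemma covers_collapse:
  assumes "compact_space X" "continuous_map X Z f" "z0 \<in> topspace Z"
    "\<And>x. x \<in> topspace X \<inter> A \<Longrightarrow> f x = z0" "bij_betw f (topspace X - A) S" "z0 \<notin> S"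
  shows "covers (collapse X A) None Z z0 (case_option z0 f) S"
  unfolding covers_def
proof (intro conjI)
  have "topspace (collapse X A) - {None} = Some ` (topspace X - A)"
    by (auto simp: topspace_collapse)
  moreover have "bij_betw (case_option z0 f) (Some ` (topspace X - A)) S"
    using assms(5) by (auto simp: bij_betw_def inj_on_def image_image)
  ultimately show "bij_betw (case_option z0 f) (topspace (collapse X A) - {None}) S" by simp
qed (use assms in \<open>auto simp: topspace_collapse intro: compact_space_collapse continuous_map_from_collapse\<close>)

text \<open>This serves a collapsed set \<open>B\<close> away from the basepoint \<open>x0\<close>,
  whose class goes to an ordinary point \<open>b\<close> of the target. Such is
  \<open>Thom_mod_zero\<close>: its basepoint is the point at infinity, and the zero section goes to
  a single tuple.\<close>

lemma covers_collapse_away: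
  assumes "compact_space X" "continuous_map X Z f" "x0 \<in> topspace X - B" "f x0 = z0" "b \<in> topspace Z"
    "\<And>x. x \<in> topspace X \<inter> B \<Longrightarrow> f x = b" "bij_betw f (topspace X - B - {x0}) S"
    "z0 \<notin> S" "b \<notin> S" "z0 \<noteq> b"
  shows "covers (collapse X B) (Some x0) Z z0 (case_option b f) (insert b S)"
  unfolding covers_def
proof (intro conjI)
  have "topspace (collapse X B) - {Some x0} = insert None (Some ` (topspace X - B - {x0}))"
    by (auto simp: topspace_collapse)
  moreover have "bij_betw (case_option b f) (Some ` (topspace X - B - {x0})) S"
    using assms(7) by (auto simp: bij_betw_def inj_on_def image_image)
  then have "bij_betw (case_option b f) (insert None (Some ` (topspace X - B - {x0}))) (insert b S)"
    using assms(9) notIn_Un_bij_betw[of None _ "case_option b f" S] by force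
  ultimately show "bij_betw (case_option b f) (topspace (collapse X B) - {Some x0}) (insert b S)" by simp
qed (use assms in \<open>auto simp: topspace_collapse intro: compact_space_collapse continuous_map_from_collapse\<close>)

lemma covers_wedge:
  assumes "covers X x0 Z z0 f S" "covers Y y0 Z z0 g T" "S \<inter> T = {}"
  shows "covers (wedge X x0 Y y0) None Z z0 (case_option z0 (case_sum f g)) (S \<union> T)"
  unfolding wedge_def
proof (rule covers_collapse)
  show "compact_space (disjoint_sum X Y)"
    using assms by (intro compact_space_disjoint_sum) (auto simp: covers_def)
  show "continuous_map (disjoint_sum X Y) Z (case_sum f g)"
    using assms by (intro continuous_map_from_disjoint_sum) (auto simp: covers_def)
  show "z0 \<in> topspace Z"
    using assms by (auto simp: covers_def continuous_map_def)
  show "case_sum f g x = z0" if "x \<in> topspace (disjoint_sum X Y) \<inter> {Inl x0, Inr y0}" for x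
    using assms that by (auto simp: covers_def)
  have "topspace (disjoint_sum X Y) - {Inl x0, Inr y0}
      = Inl ` (topspace X - {x0}) \<union> Inr ` (topspace Y - {y0})"
    by (auto simp: topspace_disjoint_sum)
  moreover have "bij_betw (case_sum f g) (Inl ` (topspace X - {x0})) S"
    "bij_betw (case_sum f g) (Inr ` (topspace Y - {y0})) T"
    using assms(1,2) by (auto simp: covers_def bij_betw_def inj_on_def image_image)
  ultimately show "bij_betw (case_sum f g) (topspace (disjoint_sum X Y) - {Inl x0, Inr y0}) (S \<union> T)"
    using assms(3) by (metis bij_betw_combine)
  show "z0 \<notin> S \<union> T"
    using assms by (auto simp: covers_def)
qed

text \<open>The condition on \<open>z0\<close> speaks for \<open>N = 0\<close>, where the bouquet is
  one point and the summands give no information.\<close>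

lemma covers_bouquet:
  assumes "\<And>i. i < N \<Longrightarrow> covers X x0 Z z0 (f i) (S i)"
    "\<And>i j. i < N \<Longrightarrow> j < N \<Longrightarrow> i \<noteq> j \<Longrightarrow> S i \<inter> S j = {}" "z0 \<in> topspace Z"
  shows "covers (bouquet N X x0) None Z z0 (case_option z0 (\<lambda>(i, x). f i x)) (\<Union>i<N. S i)"
  unfolding bouquet_def
proof (rule covers_collapse)
  show "compact_space (sum_topology (\<lambda>_. X) {..<N})"
    using assms by (intro compact_space_sum_topology) (auto simp: covers_def)
  show "continuous_map (sum_topology (\<lambda>_. X) {..<N}) Z (\<lambda>(i, x). f i x)"
    using assms by (intro continuous_map_from_sum_topology) (auto simp: covers_def)
  show "(case p of (i, x) \<Rightarrow> f i x) = z0"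
    if "p \<in> topspace (sum_topology (\<lambda>_. X) {..<N}) \<inter> (\<lambda>i. (i, x0)) ` {..<N}" for p
    using assms that by (auto simp: covers_def)
  have eq: "topspace (sum_topology (\<lambda>_. X) {..<N}) - (\<lambda>i. (i, x0)) ` {..<N}
      = (\<Union>i<N. Pair i ` (topspace X - {x0}))"
    by auto
  have fS: "bij_betw (f i) (topspace X - {x0}) (S i)" if "i < N" for i
    using assms(1) that by (auto simp: covers_def)
  show "bij_betw (\<lambda>(i, x). f i x) (topspace (sum_topology (\<lambda>_. X) {..<N}) - (\<lambda>i. (i, x0)) ` {..<N}) (\<Union>i<N. S i)"
    unfolding eq bij_betw_def
  proof
    show "inj_on (\<lambda>(i, x). f i x) (\<Union>i<N. Pair i ` (topspace X - {x0}))"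
    proof (rule inj_onI)
      fix p q
      assume p: "p \<in> (\<Union>i<N. Pair i ` (topspace X - {x0}))" and q: "q \<in> (\<Union>i<N. Pair i ` (topspace X - {x0}))"
        and eq: "(case p of (i, x) \<Rightarrow> f i x) = (case q of (i, x) \<Rightarrow> f i x)"
      obtain i x where i: "p = (i, x)" "i < N" "x \<in> topspace X - {x0}" using p by auto
      obtain j y where j: "q = (j, y)" "j < N" "y \<in> topspace X - {x0}" using q by auto
      have "f i x \<in> S i" "f j y \<in> S j"
        using bij_betwE[OF fS[OF i(2)]] bij_betwE[OF fS[OF j(2)]] i(3) j(3) by blast+
      then have "i = j" using eq i j assms(2)[of i j] by auto
      with eq i j fS[of i] show "p = q" by (auto simp: bij_betw_def inj_on_def)
    qed
    show "(\<lambda>(i, x). f i x) ` (\<Union>i<N. Pair i ` (topspace X - {x0})) = (\<Union>i<N. S i)"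
      using fS by (auto simp: bij_betw_def image_UN image_image)
  qed
  show "z0 \<notin> (\<Union>i<N. S i)"
    using assms(1) by (auto simp: covers_def)
qed fact

section \<open>Quaternions, SU(2) and SO(3)\<close>

type_synonym quaternion = "real \<times> (real^3)"

definition qmul :: "quaternion \<Rightarrow> quaternion \<Rightarrow> quaternion" where
  "qmul p q = (fst p * fst q - snd p \<bullet> snd q,
     fst p *\<^sub>R snd q + fst q *\<^sub>R snd p + cross3 (snd p) (snd q))"

definition qconj :: "quaternion \<Rightarrow> quaternion" where
  "qconj p = (fst p, - snd p)"

definition outer :: "real^3 \<Rightarrow> real^3^3" where
  "outer v = (\<chi> i j. v $ i * v $ j)"

text \<open>The Euler-Rodrigues formula for conjugation by \<open>p\<close> on imaginary
  quaternions. Being polynomial and even in \<open>p\<close>, it is visibly continuous and agrees on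
  \<open>p\<close> and \<open>-p\<close>.\<close>

definition rotm :: "quaternion \<Rightarrow> real^3^3" where
  "rotm p = ((fst p)\<^sup>2 - snd p \<bullet> snd p) *\<^sub>R mat 1 + 2 *\<^sub>R outer (snd p)
     + (2 * fst p) *\<^sub>R matrix (cross3 (snd p))"

text \<open>The standard identification of unit quaternions with SU(2); the imaginary units go to
  \<open>quat_i\<close>, \<open>quat_j\<close>, \<open>quat_k\<close>.\<close>

definition umat :: "quaternion \<Rightarrow> complex^2^2" where
  "umat p = vector [vector [Complex (fst p) (snd p $ 1), Complex (snd p $ 2) (snd p $ 3)],
     vector [Complex (- snd p $ 2) (snd p $ 3), Complex (fst p) (- snd p $ 1)]]"

lemma power2_norm_quaternion: "(norm (p :: quaternion))\<^sup>2 = (fst p)\<^sup>2 + snd p \<bullet> snd p"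
  by (simp add: norm_prod_def power2_norm_eq_inner)

lemma norm_quaternion: "norm (p :: quaternion) = 1 \<longleftrightarrow> (fst p)\<^sup>2 + snd p \<bullet> snd p = 1"
  by (simp flip: power2_norm_quaternion add: power2_eq_1_iff) (use norm_ge_zero[of p] in linarith)

lemma matrix_cross3_vector_mult: "matrix (cross3 v) *v x = cross3 v x"
  by (simp add: matrix_def cross3_def matrix_vector_mult_def axis_def vec_eq_iff forall_3 sum_3 vector_3)

lemma outer_vector_mult: "outer v *v x = (v \<bullet> x) *\<^sub>R v"
  by (simp add: outer_def vec_eq_iff matrix_vector_mult_def inner_vec_def forall_3 sum_3 algebra_simps)

lemma matrix_scaleR_vector_mult: "(c *\<^sub>R A) *v x = c *\<^sub>R (A *v x)" for A :: "real^'n^'m"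
  by (simp add: vec_eq_iff matrix_vector_mult_def sum_distrib_left mult.assoc)

lemma rotm_vector_mult:
  "rotm p *v x = ((fst p)\<^sup>2 - snd p \<bullet> snd p) *\<^sub>R x + (2 * (snd p \<bullet> x)) *\<^sub>R snd p
     + (2 * fst p) *\<^sub>R cross3 (snd p) x"
  by (simp add: rotm_def matrix_vector_mult_add_rdistrib matrix_scaleR_vector_mult
      outer_vector_mult matrix_cross3_vector_mult)

lemma qmul_assoc: "qmul (qmul p q) r = qmul p (qmul q r)"
  by (simp add: qmul_def cross3_def prod_eq_iff vec_eq_iff forall_3 inner_vec_def sum_3 vector_3
      algebra_simps)

lemma qconj_qmul: "qconj (qmul p q) = qmul (qconj q) (qconj p)"
  by (simp add: qmul_def qconj_def prod_eq_iff inner_commute cross_skew[of "snd p" "snd q"])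

lemma rotm_conjugation: "qmul (qmul p (0, x)) (qconj p) = (0, rotm p *v x)"
  unfolding rotm_vector_mult qmul_def qconj_def cross3_def
  by (simp add: vec_eq_iff forall_3 inner_vec_def sum_3 vector_3 power2_eq_square algebra_simps)

text \<open>Both sides describe conjugation by the product, so associativity of \<open>qmul\<close>
  replaces a computation with matrix entries.\<close>

lemma rotm_qmul: "rotm (qmul p q) = rotm p ** rotm q"
proof -
  have "(0 :: real, rotm (qmul p q) *v x) = (0, rotm p *v (rotm q *v x))" for x
    by (simp only: qconj_qmul qmul_assoc flip: rotm_conjugation)
  then show ?thesis
    by (simp add: matrix_eq matrix_vector_mul_assoc)
qed

lemma rotm_minus: "rotm (- p) = rotm p"
  by (simp add: matrix_eq rotm_vector_mult)

lemma rotm_qconj: "rotm (qconj p) = transpose (rotm p)"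
proof -
  have "(rotm (qconj p) *v x) \<bullet> y = x \<bullet> (rotm p *v y)" for x y
    unfolding rotm_vector_mult qconj_def cross3_def
    by (simp add: inner_vec_def sum_3 vector_3 power2_eq_square algebra_simps)
  then have "(rotm (qconj p) *v x) \<bullet> y = (transpose (rotm p) *v x) \<bullet> y" for x y
    by (simp add: dot_lmul_matrix transpose_matrix_vector)
  then show ?thesis
    by (metis matrix_eq vector_eq_rdot)
qed

lemma qmul_one [simp]: "qmul (1, 0) p = p" "qmul p (1, 0) = p"
  by (simp_all add: qmul_def prod_eq_iff)

lemma qmul_minus [simp]: "qmul (- p) q = - qmul p q" "qmul p (- q) = - qmul p q"
  by (simp_all add: qmul_def prod_eq_iff)

lemma qmul_qconj: "norm p = 1 \<Longrightarrow> qmul p (qconj p) = (1, 0)" "norm p = 1 \<Longrightarrow> qmul (qconj p) p = (1, 0)"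
  by (auto simp: norm_quaternion qmul_def qconj_def power2_eq_square)

lemma norm_qconj [simp]: "norm (qconj p) = norm p"
  by (simp add: qconj_def norm_prod_def)

lemma norm_qmul: "norm (qmul p q) = norm p * norm q"
proof -
  have "(norm (qmul p q))\<^sup>2 = (norm p)\<^sup>2 * (norm q)\<^sup>2"
    unfolding power2_norm_quaternion
    by (simp add: qmul_def cross3_def inner_vec_def sum_3 vector_3 power2_eq_square algebra_simps)
  then show ?thesis
    by (metis norm_ge_zero power2_eq_imp_eq power_mult_distrib mult_nonneg_nonneg)
qed

lemma rotm_one [simp]: "rotm (1, 0) = mat 1"
  by (simp add: matrix_eq rotm_vector_mult)

lemma det_rotm: "norm p = 1 \<Longrightarrow> det (rotm p) = 1"
proof -
  assume p: "norm p = 1"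
  have "det (rotm p) = ((fst p)\<^sup>2 + snd p \<bullet> snd p) ^ 3"
    unfolding rotm_def outer_def matrix_def cross3_def
    by (simp add: det_3 mat_def axis_def inner_vec_def sum_3 vector_3 power2_eq_square power3_eq_cube algebra_simps)
  then show ?thesis using p by (simp add: norm_quaternion)
qed

lemma rotation_matrix_rotm:
  assumes "norm p = 1"
  shows "rotation_matrix (rotm p)"
proof -
  have "transpose (rotm p) ** rotm p = mat 1"
    using assms by (simp flip: rotm_qconj rotm_qmul add: qmul_qconj)
  then show ?thesis
    using assms by (simp add: rotation_matrix_def orthogonal_matrix det_rotm)
qed

text \<open>The trace detects the trivial rotation: it is a combination of the squared real part and
  the squared length of the imaginary part, whose sum is 1, and the value 3 forces the imaginary
  part to vanish.\<close>

lemma rotm_eq_one: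
  assumes "norm p = 1" "rotm p = mat 1"
  shows "p = (1, 0) \<or> p = - (1, 0)"
proof -
  have "3 * ((fst p)\<^sup>2 - snd p \<bullet> snd p) + 2 * (snd p \<bullet> snd p) = (\<Sum>i\<in>UNIV. rotm p $ i $ i)"
    unfolding rotm_def outer_def matrix_def cross3_def
    by (simp add: mat_def axis_def inner_vec_def sum_3 vector_3)
  also have "\<dots> = 3"
    by (simp add: assms(2) mat_def)
  finally have tr: "3 * ((fst p)\<^sup>2 - snd p \<bullet> snd p) + 2 * (snd p \<bullet> snd p) = 3" .
  have "b = 0 \<and> a = 1" if "3 * (a - b) + 2 * b = 3" "a + b = 1" for a b :: real
  proof -
    have "3 * a = b + 3" using that(1) by (simp add: algebra_simps)
    with that(2) have "a = 1" by linarith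
    with that(2) show ?thesis by simp
  qed
  from this[OF tr] have "snd p \<bullet> snd p = 0" "(fst p)\<^sup>2 = 1"
    using assms(1) by (simp_all only: norm_quaternion)
  then show ?thesis
    by (auto simp: prod_eq_iff power2_eq_1_iff)
qed

lemma rotm_eq_iff:
  assumes "norm p = 1" "norm q = 1"
  shows "rotm p = rotm q \<longleftrightarrow> p = q \<or> p = - q"
proof
  assume "rotm p = rotm q"
  then have "rotm (qmul (qconj q) p) = rotm (qmul (qconj q) q)"
    by (simp add: rotm_qmul)
  then have "qmul (qconj q) p = (1, 0) \<or> qmul (qconj q) p = - (1, 0)"
    using assms by (intro rotm_eq_one) (auto simp: qmul_qconj norm_qmul)
  then have "qmul q (qmul (qconj q) p) = q \<or> qmul q (qmul (qconj q) p) = - q"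
    by (metis qmul_one(2) qmul_minus(2))
  then show "p = q \<or> p = - q"
    using assms by (simp add: qmul_qconj flip: qmul_assoc)
qed (auto simp: rotm_minus)

section \<open>Every rotation comes from a unit quaternion\<close>

lemma orthonormal_cross3:
  fixes u v :: "real^3"
  assumes "norm u = 1" "norm v = 1" "u \<bullet> v = 0"
  shows "x = (x \<bullet> u) *\<^sub>R u + (x \<bullet> v) *\<^sub>R v + (x \<bullet> cross3 u v) *\<^sub>R cross3 u v" 
    "norm (cross3 u v) = 1" "cross3 u (cross3 u v) = - v"
proof -
  have uv: "u \<bullet> u = 1" "v \<bullet> v = 1" using assms by (simp_all add: norm_eq_1)
  show "cross3 u (cross3 u v) = - v"
    using assms uv by (simp add: Lagrange)
  have "(norm (cross3 u v))\<^sup>2 = 1"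
    using norm_cross_dot[of u v] assms by simp
  then show n: "norm (cross3 u v) = 1"
    by (simp add: power2_eq_1_iff) (use norm_ge_zero[of "cross3 u v"] in linarith)
  define w where "w = x - ((x \<bullet> u) *\<^sub>R u + (x \<bullet> v) *\<^sub>R v + (x \<bullet> cross3 u v) *\<^sub>R cross3 u v)"
  have w: "w \<bullet> u = 0" "w \<bullet> v = 0" "w \<bullet> cross3 u v = 0"
    using uv assms n unfolding w_def
    by (simp_all add: inner_diff_left inner_add_left inner_commute[of v u] dot_cross_self norm_eq_1)
  \<comment> \<open>The remainder \<open>w\<close> is parallel to the unit vector
    \<open>cross3 u v\<close> by this identity and orthogonal to it by the last fact of
    \<open>w\<close>, which leaves only 0.\<close>
  have "cross3 w (cross3 u v) = 0"
    using w by (simp add: Lagrange)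
  then have "(norm w * norm (cross3 u v))\<^sup>2 = 0"
    using norm_cross_dot[of w "cross3 u v"] w by simp
  then have "w = 0"
    using n by simp
  then show "x = (x \<bullet> u) *\<^sub>R u + (x \<bullet> v) *\<^sub>R v + (x \<bullet> cross3 u v) *\<^sub>R cross3 u v" 
    by (simp add: w_def)
qed

text \<open>The dimension is odd: multiplying \<open>M - 1\<close> by the transpose of
  \<open>M\<close> turns it into the transpose of \<open>1 - M\<close>, so its determinant equals
  its own negative and \<open>M - 1\<close> has a kernel.\<close>

lemma rotation_matrix_fixed_vector:
  fixes M :: "real^3^3"
  assumes "rotation_matrix M"
  obtains u where "norm u = 1" "M *v u = u"
proof -
  have M: "transpose M ** M = mat 1" "det M = 1"
    using assms by (auto simp: rotation_matrix_def orthogonal_matrix_def)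
  have "det (M - mat 1) = det (transpose M ** (M - mat 1))"
    by (simp add: det_mul M)
  also have "transpose M ** (M - mat 1) = transpose (mat 1 - M)"
  proof -
    have "transpose M ** (M - mat 1) + transpose M ** mat 1 = mat 1"
      using matrix_add_ldistrib[of "transpose M" "M - mat 1" "mat 1"] M by simp
    then have "transpose M ** (M - mat 1) = mat 1 - transpose M"
      by (simp add: eq_diff_eq)
    then show ?thesis
      by (auto simp: transpose_def vec_eq_iff mat_def)
  qed
  also have "det (transpose (mat 1 - M)) = det (mat 1 - M)" by (rule det_transpose)
  also have "det (mat 1 - M) = - det (M - mat 1)"
    by (simp add: det_3 algebra_simps)
  finally have "det (M - mat 1) = 0" by simp
  then have "\<not> (\<exists>B. B ** (M - mat 1) = mat 1)"
    using invertible_det_nz invertible_left_inverse by blast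
  then obtain x where "(M - mat 1) *v x = 0" "x \<noteq> 0"
    using matrix_left_invertible_ker[of "M - mat 1"] by blast
  then have "M *v x = x" "x \<noteq> 0"
    by (auto simp: matrix_vector_mult_diff_rdistrib)
  then show ?thesis
    by (intro that[of "x /\<^sub>R norm x"]) (simp_all add: matrix_vector_mult_scaleR)
qed

lemma rotation_matrix_inner:
  assumes "rotation_matrix M"
  shows "(M *v x) \<bullet> (M *v y) = x \<bullet> (y :: real^'n)"
proof -
  have "orthogonal_transformation ((*v) M)"
    using assms by (simp add: orthogonal_transformation_matrix rotation_matrix_def)
  then show ?thesis by (simp add: orthogonal_transformation_def)
qed

lemma rotation_matrix_norm:
  assumes "rotation_matrix M"
  shows "norm (M *v x) = norm (x :: real^'n)"
  using rotation_matrix_inner[OF assms] by (simp add: norm_eq_sqrt_inner)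

text \<open>The quaternion is \<open>cos (\<theta>/2) + sin (\<theta>/2) u\<close>, where \<open>u\<close> spans the axis of the rotation and \<open>\<theta>\<close>
  is its angle.\<close>

lemma rotm_surj:
  assumes M: "rotation_matrix M"
  obtains p where "norm p = 1" "rotm p = M"
proof -
  obtain u where u: "norm u = 1" "M *v u = u"
    using rotation_matrix_fixed_vector[OF M] by blast
  obtain v where v: "norm v = 1" "orthogonal u v"
  proof -
    obtain w where "w \<noteq> 0" "orthogonal u w"
      using orthogonal_to_vector_exists[of u] by auto
    then show ?thesis
      by (intro that[of "w /\<^sub>R norm w"]) (auto simp: orthogonal_def)
  qed
  have uv: "u \<bullet> v = 0" "u \<bullet> u = 1" "v \<bullet> v = 1"
    using u v by (auto simp: orthogonal_def norm_eq_1)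
  define y where "y = M *v v"
  have y: "norm y = 1" "y \<bullet> u = 0"
    using rotation_matrix_norm[OF M, of v] v rotation_matrix_inner[OF M, of v u] u uv
    by (simp_all add: y_def inner_commute)
  have yeq: "y = (y \<bullet> v) *\<^sub>R v + (y \<bullet> cross3 u v) *\<^sub>R cross3 u v"
    using orthonormal_cross3(1)[of u v y] u v uv y by simp
  have "(y \<bullet> v)\<^sup>2 + (y \<bullet> cross3 u v)\<^sup>2 = y \<bullet> y"
    by (subst (3) yeq) (simp add: inner_add_right power2_eq_square)
  then obtain t where t: "y \<bullet> v = cos t" "y \<bullet> cross3 u v = sin t"
    using y sincos_total_2pi[of "y \<bullet> v" "y \<bullet> cross3 u v"] by (auto simp: norm_eq_1)
  define p :: quaternion where "p = (cos (t/2), sin (t/2) *\<^sub>R u)"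
  have p: "norm p = 1"
    by (simp add: norm_quaternion p_def uv power2_eq_square[symmetric])
  have ct: "cos t = (cos (t/2))\<^sup>2 - (sin (t/2))\<^sup>2" "sin t = 2 * sin (t/2) * cos (t/2)"
    using cos_double[of "t/2"] sin_double[of "t/2"] by simp_all
  have pu: "rotm p *v u = M *v u"
  proof -
    have "rotm p *v u = ((cos (t/2))\<^sup>2 + (sin (t/2))\<^sup>2) *\<^sub>R u"
      unfolding rotm_vector_mult p_def
      by (simp add: uv Cross3.cross_mult_left power2_eq_square add.commute sin_cos_squared_add3
          flip: scaleR_add_left)
    then show ?thesis by (simp add: u)
  qed
  have pv: "rotm p *v v = M *v v"
  proof -
    have "rotm p *v v = cos t *\<^sub>R v + sin t *\<^sub>R cross3 u v"
      unfolding rotm_vector_mult p_def ct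
      by (simp add: uv Cross3.cross_mult_left power2_eq_square)
    also have "\<dots> = y" using yeq by (simp add: t)
    finally show ?thesis by (simp add: y_def)
  qed
  \<comment> \<open>Rotations respect cross products, so agreement on \<open>u\<close> and
    \<open>v\<close> carries over to the third frame vector.\<close>
  have pw: "rotm p *v cross3 u v = M *v cross3 u v"
    using cross_rotation_matrix[OF M, of u v] cross_rotation_matrix[OF rotation_matrix_rotm[OF p], of u v] pu pv
    by simp
  have "rotm p *v x = M *v x" for x
    by (subst (1 2) orthonormal_cross3(1)[OF u(1) v(1) uv(1), of x])
      (simp only: matrix_vector_right_distrib matrix_vector_mult_scaleR pu pv pw)
  then show ?thesis
    using that[OF p] by (simp add: matrix_eq)
qed

section \<open>SU(2) as the group of unit quaternions\<close>

lemma umat_qmul: "umat (qmul p q) = umat p ** umat q"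
  by (simp add: umat_def qmul_def cross3_def mat2_eq_iff matrix_matrix_mult_def sum_2 complex_eq_iff
      inner_vec_def sum_3 vector_3 algebra_simps)

lemma umat_minus: "umat (- p) = - umat p"
  by (simp add: umat_def mat2_eq_iff complex_eq_iff)

lemma umat_one: "umat (1, 0) = mat 1"
  by (simp add: umat_def mat2_eq_iff complex_eq_iff mat_def)

lemma umat_eq_iff: "umat p = umat q \<longleftrightarrow> p = q"
  by (auto simp: umat_def mat2_eq_iff complex_eq_iff prod_eq_iff vec_eq_iff forall_3)

definition quaternion_of_mat :: "complex^2^2 \<Rightarrow> quaternion" where
  "quaternion_of_mat A = (Re (A $ 1 $ 1), vector [Im (A $ 1 $ 1), Re (A $ 1 $ 2), Im (A $ 1 $ 2)])"

lemma quaternion_of_umat [simp]: "quaternion_of_mat (umat p) = p"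
  by (simp add: quaternion_of_mat_def umat_def prod_eq_iff vec_eq_iff forall_3)

lemma det_umat: "det (umat p) = complex_of_real ((norm p)\<^sup>2)"
  unfolding power2_norm_quaternion
  by (simp add: umat_def det_2 complex_eq_iff inner_vec_def sum_3 power2_eq_square)

lemma carrier_SU2: "carrier SU2 = umat ` sphere 0 1"
proof
  show "umat ` sphere 0 1 \<subseteq> carrier SU2"
  proof clarify
    fix p :: quaternion assume "p \<in> sphere 0 1"
    then have p: "norm p = 1" by simp
    have "conj_transpose (umat p) = umat (qconj p)"
      by (simp add: conj_transpose_def umat_def qconj_def mat2_eq_iff complex_eq_iff)
    then show "umat p \<in> carrier SU2"
      using p by (simp add: SU2_def unitary_matrix_def det_umat qmul_qconj umat_one flip: umat_qmul)
  qed
  show "carrier SU2 \<subseteq> umat ` sphere 0 1"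
  proof
    fix A assume A: "A \<in> carrier SU2"
    \<comment> \<open>\<open>B\<close> is the adjugate of \<open>A\<close>, its inverse because the
      determinant is 1. Comparing it with the other inverse, the conjugate transpose, shows that the
      second row is determined by the first in the quaternionic pattern.\<close>
    define B where "B = (vector [vector [A $ 2 $ 2, - A $ 1 $ 2], vector [- A $ 2 $ 1, A $ 1 $ 1]] :: complex^2^2)"
    have "A ** B = mat 1"
      using A by (simp add: SU2_def det_2 B_def mat2_eq_iff matrix_matrix_mult_def sum_2 mat_def algebra_simps)
    moreover have "conj_transpose A ** A = mat 1"
      using A by (simp add: SU2_def unitary_matrix_def)
    ultimately have "conj_transpose A = B"
      by (metis matrix_mul_assoc matrix_mul_lid matrix_mul_rid)
    then have "A $ 2 $ 2 = cnj (A $ 1 $ 1)" "A $ 2 $ 1 = - cnj (A $ 1 $ 2)"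
      by (auto simp: conj_transpose_def B_def mat2_eq_iff)
    then have eq: "A = umat (quaternion_of_mat A)"
      by (simp add: umat_def quaternion_of_mat_def mat2_eq_iff complex_eq_iff)
    have "det A = 1" using A by (simp add: SU2_def)
    then have "complex_of_real ((norm (quaternion_of_mat A))\<^sup>2) = 1"
      by (subst (asm) eq) (simp add: det_umat)
    then have "norm (quaternion_of_mat A) = 1"
      by (simp only: of_real_eq_1_iff power2_eq_1_iff) (use norm_ge_zero[of "quaternion_of_mat A"] in linarith)
    then show "A \<in> umat ` sphere 0 1"
      using eq by auto
  qed
qed

lemma carrier_SO3: "carrier SO3 = rotm ` sphere 0 1"
  by (auto simp: SO3_def rotation_matrix_rotm elim!: rotm_surj)

lemma continuous_on_matrix_componentwise:
  assumes "\<And>i j. continuous_on S (\<lambda>x. f x $ i $ j)"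
  shows "continuous_on S (f :: _ \<Rightarrow> 'a::topological_space^'n^'m)"
proof -
  have "continuous_on S (\<lambda>x. \<chi> i j. f x $ i $ j)"
    by (intro continuous_on_vec_lambda assms)
  then show ?thesis by simp
qed

lemma continuous_on_umat: "continuous_on S umat"
proof (rule continuous_on_matrix_componentwise)
  have "\<forall>i j. continuous_on S (\<lambda>p. umat p $ i $ j)"
    by (simp add: umat_def forall_2 continuous_intros)
  then show "continuous_on S (\<lambda>p. umat p $ i $ j)" for i j by blast
qed

lemma continuous_on_outer: "continuous_on S outer"
  unfolding outer_def by (intro continuous_intros)

lemma continuous_on_matrix_cross3: "continuous_on S (\<lambda>v. matrix (cross3 v))"
  unfolding matrix_def by (intro continuous_intros continuous_on_cross)

lemma continuous_on_rotm: "continuous_on S rotm"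
  unfolding rotm_def
  by (intro continuous_intros continuous_on_compose2[OF continuous_on_outer[of UNIV]]
      continuous_on_compose2[OF continuous_on_matrix_cross3[of UNIV]]) auto

lemma continuous_on_quaternion_of_mat: "continuous_on S quaternion_of_mat"
proof -
  have "\<forall>i. continuous_on S (\<lambda>A :: complex^2^2. (vector [Im (A $ 1 $ 1), Re (A $ 1 $ 2), Im (A $ 1 $ 2)] :: real^3) $ i)"
    by (simp add: forall_3 vector_3 continuous_intros)
  then have "continuous_on S (\<lambda>A :: complex^2^2. \<chi> i. (vector [Im (A $ 1 $ 1), Re (A $ 1 $ 2), Im (A $ 1 $ 2)] :: real^3) $ i)"
    by (intro continuous_on_vec_lambda) blast
  then show ?thesis
    unfolding quaternion_of_mat_def by (intro continuous_on_Pair continuous_intros) simp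
qed

section \<open>Commutators in terms of quaternions\<close>

lemma (in group) commutator_eq_iff:
  assumes "x \<in> carrier G" "y \<in> carrier G" "z \<in> carrier G"
  shows "commutator G x y = z \<longleftrightarrow> x \<otimes> y = z \<otimes> (y \<otimes> x)"
proof -
  have "commutator G x y \<otimes> (y \<otimes> x) = x \<otimes> y"
    using assms by (simp add: commutator_def m_assoc inv_solve_right' flip: inv_mult_group)
  then show ?thesis
    using assms by (metis commutator_def inv_closed m_closed right_cancel)
qed

lemma qmul_commute_iff: "qmul p q = qmul q p \<longleftrightarrow> cross3 (snd p) (snd q) = 0"
proof -
  have "qmul p q = qmul q p \<longleftrightarrow> cross3 (snd p) (snd q) = cross3 (snd q) (snd p)"
    by (auto simp: qmul_def inner_commute add.commute)
  also have "\<dots> \<longleftrightarrow> cross3 (snd p) (snd q) = 0"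
    by (subst cross_skew) (auto simp: eq_neg_iff_add_eq_0 simp flip: scaleR_2)
  finally show ?thesis .
qed

lemma qmul_anticommute_iff:
  assumes "norm p = 1" "norm q = 1"
  shows "qmul p q = - qmul q p \<longleftrightarrow> fst p = 0 \<and> fst q = 0 \<and> snd p \<bullet> snd q = 0"
proof
  assume "qmul p q = - qmul q p"
  moreover define w c where "w = fst p *\<^sub>R snd q + fst q *\<^sub>R snd p" and "c = cross3 (snd p) (snd q)"
  have "qmul p q = (fst p * fst q - snd p \<bullet> snd q, w + c)" "qmul q p = (fst p * fst q - snd p \<bullet> snd q, w - c)"
    using cross_skew[of "snd q" "snd p"]
    by (simp_all add: qmul_def w_def c_def inner_commute mult.commute add.commute)
  ultimately have "fst p * fst q - snd p \<bullet> snd q = 0" "w + c = - (w - c)"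
    by simp_all
  then have *: "fst p * fst q = snd p \<bullet> snd q" and "2 *\<^sub>R w = 0"
    by (simp_all add: scaleR_2 eq_neg_iff_add_eq_0)
  then have "w = 0"
    by (metis scaleR_eq_0_iff zero_neq_numeral)
  \<comment> \<open>Pairing \<open>w\<close> with each imaginary part and substituting
    \<open>*\<close> leaves one real part times the squared norm of the other quaternion. As
    \<open>w = 0\<close> and the norms are 1, both real parts vanish.\<close>
  have "snd p \<bullet> (fst p *\<^sub>R snd q + fst q *\<^sub>R snd p) = fst q * ((fst p)\<^sup>2 + snd p \<bullet> snd p)"
    "snd q \<bullet> (fst p *\<^sub>R snd q + fst q *\<^sub>R snd p) = fst p * ((fst q)\<^sup>2 + snd q \<bullet> snd q)"
    using * by (simp_all add: inner_add_right inner_commute power2_eq_square algebra_simps)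
  then have "fst q = 0" "fst p = 0"
    unfolding assms[unfolded norm_quaternion] \<open>w = 0\<close>[unfolded w_def] by simp_all
  then show "fst p = 0 \<and> fst q = 0 \<and> snd p \<bullet> snd q = 0"
    using * by simp
next
  assume "fst p = 0 \<and> fst q = 0 \<and> snd p \<bullet> snd q = 0"
  then show "qmul p q = - qmul q p"
    using cross_skew[of "snd p" "snd q"] by (auto simp: qmul_def prod_eq_iff inner_commute)
qed

lemma commutator_SU2:
  assumes "norm p = 1" "norm q = 1"
  shows "commutator SU2 (umat p) (umat q) = mat 1 \<longleftrightarrow> qmul p q = qmul q p"
    "commutator SU2 (umat p) (umat q) = - mat 1 \<longleftrightarrow> qmul p q = - qmul q p"
proof -
  interpret group SU2 by (rule group_SU2)
  have c: "umat p \<in> carrier SU2" "umat q \<in> carrier SU2" "mat 1 \<in> carrier SU2" "- mat 1 \<in> carrier SU2"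
    using assms Q8_subset_SU2 by (auto simp: carrier_SU2 Q8_def)
  have m: "x \<otimes>\<^bsub>SU2\<^esub> y = x ** y" for x y by (simp add: SU2_def)
  show "commutator SU2 (umat p) (umat q) = mat 1 \<longleftrightarrow> qmul p q = qmul q p"
    unfolding commutator_eq_iff[OF c(1,2,3)] m by (simp add: umat_eq_iff flip: umat_qmul)
  have "- mat 1 = umat (- (1, 0))" by (simp only: umat_minus umat_one)
  then show "commutator SU2 (umat p) (umat q) = - mat 1 \<longleftrightarrow> qmul p q = - qmul q p"
    unfolding commutator_eq_iff[OF c(1,2,4)] m
    by (simp only: qmul_minus qmul_one umat_eq_iff flip: umat_qmul)
qed

text \<open>Lifts of commuting rotations commute up to sign. Thus commuting tuples in SO(3) and
  tuples in SU(2) with central commutators lead to the same relations between quaternions.\<close>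

lemma commutator_SO3:
  assumes "norm p = 1" "norm q = 1"
  shows "commutator SO3 (rotm p) (rotm q) = mat 1 \<longleftrightarrow> qmul p q = qmul q p \<or> qmul p q = - qmul q p"
proof -
  interpret group SO3 by (rule group_SO3)
  have c: "rotm p \<in> carrier SO3" "rotm q \<in> carrier SO3" "\<one>\<^bsub>SO3\<^esub> = mat 1"
    using assms by (auto simp: carrier_SO3 SO3_def rotation_matrix_rotm)
  have m: "x \<otimes>\<^bsub>SO3\<^esub> y = x ** y" for x y by (simp add: SO3_def)
  have "commutator SO3 (rotm p) (rotm q) = mat 1 \<longleftrightarrow> rotm (qmul p q) = rotm (qmul q p)"
    using commutator_eq_iff[OF c(1,2) one_closed] unfolding c(3) m by (simp add: rotm_qmul)
  then show ?thesis
    using assms by (simp add: rotm_eq_iff norm_qmul)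
qed

section \<open>Words in the coordinate axes\<close>

abbreviation e1 :: "real^3" where "e1 \<equiv> axis 1 1"
abbreviation e2 :: "real^3" where "e2 \<equiv> axis 2 1"
abbreviation e3 :: "real^3" where "e3 \<equiv> axis 3 1"

text \<open>Only the arguments 1 and 2 matter. There is no third step: a rotation known on
  \<open>e1\<close> and \<open>e2\<close> is known on \<open>e3\<close>.\<close>

definition frame :: "nat \<Rightarrow> real^3" where
  "frame s = (if s = 1 then e1 else e2)"

text \<open>A tuple of vectors in standard position. The state \<open>s\<close> counts the coordinate axes met so far;
  \<open>A s\<close> is the set of letters that keep the state, and the letter \<open>frame s\<close> raises it
  from \<open>s - 1\<close> to \<open>s\<close>.\<close>

fun words :: "(nat \<Rightarrow> (real^3) set) \<Rightarrow> nat \<Rightarrow> nat \<Rightarrow> (nat \<Rightarrow> real^3) set" where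
  "words A 0 s = (if s = 0 then {\<lambda>_. 0} else {})"
| "words A (Suc n) s = (\<lambda>(c, x). c(n := x)) ` (words A n s \<times> A s) \<union>
     (if s = 0 then {} else (\<lambda>c. c(n := frame s)) ` words A n (s - 1))"

text \<open>The letter 0 encodes the entry \<open>-1\<close>, a unit vector the corresponding
  imaginary unit. After one axis only its two directions are pinned down; after two axes all six
  are. Hence the sizes 1, 3, 7, the last two being the bases of the powers in
  \<open>K_num\<close>.\<close>

definition signed_letters :: "nat \<Rightarrow> (real^3) set" where
  "signed_letters s = (if s = 0 then {0} else if s = 1 then {0, e1, - e1}
     else {0, e1, - e1, e2, - e2, e3, - e3})"

text \<open>In SO(3) the sign of a lift is invisible, and the entry \<open>-1\<close> would be the
  excluded identity rotation. Removing 0 and the signs leaves the sizes 0, 1, 3.\<close>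

definition unsigned_letters :: "nat \<Rightarrow> (real^3) set" where
  "unsigned_letters s = (if s = 0 then {} else if s = 1 then {e1} else {e1, e2, e3})"

lemma axes_eq_iff [simp]:
  "e1 \<noteq> e2" "e1 \<noteq> e3" "e2 \<noteq> e1" "e2 \<noteq> e3" "e3 \<noteq> e1" "e3 \<noteq> e2"
  "e1 \<noteq> - e1" "e1 \<noteq> - e2" "e1 \<noteq> - e3" "e2 \<noteq> - e1" "e2 \<noteq> - e2" "e2 \<noteq> - e3"
  "e3 \<noteq> - e1" "e3 \<noteq> - e2" "e3 \<noteq> - e3" "- e1 \<noteq> e1" "- e1 \<noteq> e2" "- e1 \<noteq> e3"
  "- e2 \<noteq> e1" "- e2 \<noteq> e2" "- e2 \<noteq> e3" "- e3 \<noteq> e1" "- e3 \<noteq> e2" "- e3 \<noteq> e3"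
  "e1 \<noteq> 0" "e2 \<noteq> 0" "e3 \<noteq> 0"
  by (simp_all add: vec_eq_iff forall_3 axis_def)

lemma words_SucE:
  assumes "c \<in> words A (Suc n) s"
  obtains d x r where "d \<in> words A n r" "c = d(n := x)" "r = s \<and> x \<in> A s \<or> s = Suc r \<and> x = frame s"
  using assms by (auto split: if_splits)

lemma words_SucI:
  "d \<in> words A n s \<Longrightarrow> x \<in> A s \<Longrightarrow> d(n := x) \<in> words A (Suc n) s"
  "d \<in> words A n r \<Longrightarrow> s = Suc r \<Longrightarrow> d(n := frame s) \<in> words A (Suc n) s"
  by auto

text \<open>Padding with 0 makes a word of length \<open>n\<close> recoverable from
  \<open>c(n := x)\<close>, which the counting needs.\<close>

lemma words_eq_zero: "c \<in> words A n s \<Longrightarrow> n \<le> i \<Longrightarrow> c i = 0"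
  by (induction n arbitrary: c s i) (auto elim!: words_SucE split: if_splits simp del: words.simps(2))

lemma words_frame:
  "c \<in> words A n s \<Longrightarrow> 1 \<le> r \<Longrightarrow> r \<le> s \<Longrightarrow> \<exists>i<n. c i = frame r"
proof (induction n arbitrary: c s)
  case (Suc n)
  obtain d x t where d: "d \<in> words A n t" "c = d(n := x)" "t = s \<and> x \<in> A s \<or> s = Suc t \<and> x = frame s"
    using Suc.prems(1) by (rule words_SucE)
  show ?case
  proof (cases "r \<le> t")
    case True
    then obtain i where "i < n" "d i = frame r"
      using Suc.IH[OF d(1)] Suc.prems by blast
    then show ?thesis using d(2) by (intro exI[of _ i]) auto
  next
    case False
    then have "r = s" "x = frame s" using d(3) Suc.prems by auto
    then show ?thesis using d(2) by auto
  qed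
qed (auto split: if_splits)

lemma words_signed_letters: "c \<in> words signed_letters n s \<Longrightarrow> s \<le> 2 \<Longrightarrow> c i \<in> signed_letters s"
proof (induction n arbitrary: c s)
  case (Suc n)
  obtain d x t where d: "d \<in> words signed_letters n t" "c = d(n := x)"
    "t = s \<and> x \<in> signed_letters s \<or> s = Suc t \<and> x = frame s"
    using Suc.prems(1) by (rule words_SucE)
  then have "d i \<in> signed_letters t" "t \<le> s" using Suc by auto
  moreover have "signed_letters t \<subseteq> signed_letters s" if "t \<le> s"
    using that Suc.prems(2) by (auto simp: signed_letters_def)
  moreover have "x \<in> signed_letters s"
    using d(3) Suc.prems(2) by (auto simp: signed_letters_def frame_def)
  ultimately show ?case using d(2) by auto
qed (auto simp: signed_letters_def split: if_splits)

lemma rotation_matrix_minus_vector: "(M :: real^3^3) *v (- x) = - (M *v x)"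
  using matrix_vector_mult_scaleR[of M "-1" x] by simp

text \<open>An orthonormal frame is determined, up to signs in \<open>S\<close>, by the word that it turns into a
  given tuple.\<close>

lemma words_rigid:
  assumes S: "S \<subseteq> {1, -1 :: real}" "1 \<in> S"
    and A1: "\<And>s x. s \<le> 2 \<Longrightarrow> x \<in> A s \<Longrightarrow> (\<And>r. 1 \<le> r \<Longrightarrow> r \<le> s \<Longrightarrow> \<exists>\<epsilon>\<in>S. M *v frame r = \<epsilon> *\<^sub>R frame r)
      \<Longrightarrow> \<exists>\<epsilon>\<in>S. M *v x = \<epsilon> *\<^sub>R x"
    and A2: "\<And>s x y \<epsilon>. s \<le> 2 \<Longrightarrow> x \<in> A s \<or> s < 2 \<and> x = frame (Suc s) \<Longrightarrow> y \<in> A s \<or> s < 2 \<and> y = frame (Suc s)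
      \<Longrightarrow> \<epsilon> \<in> S \<Longrightarrow> x = \<epsilon> *\<^sub>R y \<Longrightarrow> x = y"
    and A3: "\<And>s. s < 2 \<Longrightarrow> frame (Suc s) \<notin> A s"
    and inj: "\<And>x y. M *v x = M *v y \<Longrightarrow> x = y"
  shows "c \<in> words A n s \<Longrightarrow> c' \<in> words A n s' \<Longrightarrow> s \<le> 2 \<Longrightarrow> s' \<le> 2 \<Longrightarrow>
    (\<And>i. i < n \<Longrightarrow> \<exists>\<epsilon>\<in>S. M *v c i = \<epsilon> *\<^sub>R c' i) \<Longrightarrow>
    s = s' \<and> c = c' \<and> (\<forall>r. 1 \<le> r \<longrightarrow> r \<le> s \<longrightarrow> (\<exists>\<epsilon>\<in>S. M *v frame r = \<epsilon> *\<^sub>R frame r))"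
proof (induction n arbitrary: c c' s s')
  case (Suc n)
  have SS: "\<epsilon> * \<delta> \<in> S" "\<epsilon> * \<epsilon> = 1" if "\<epsilon> \<in> S" "\<delta> \<in> S" for \<epsilon> \<delta>
  proof -
    have "S = {1} \<or> S = {1, -1}" using S by blast
    then show "\<epsilon> * \<delta> \<in> S" "\<epsilon> * \<epsilon> = 1" using that by auto
  qed
  obtain d x t where d: "d \<in> words A n t" "c = d(n := x)" "t = s \<and> x \<in> A s \<or> s = Suc t \<and> x = frame s"
    using Suc.prems(1) by (rule words_SucE)
  obtain d' x' t' where d': "d' \<in> words A n t'" "c' = d'(n := x')" "t' = s' \<and> x' \<in> A s' \<or> s' = Suc t' \<and> x' = frame s'"
    using Suc.prems(2) by (rule words_SucE)
  have "\<exists>\<epsilon>\<in>S. M *v d i = \<epsilon> *\<^sub>R d' i" if "i < n" for i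
    using Suc.prems(5)[of i] that d(2) d'(2) by auto
  moreover have "t \<le> 2" "t' \<le> 2" using d(3) d'(3) Suc.prems by auto
  ultimately have IH: "t = t'" "d = d'"
    "\<And>r. 1 \<le> r \<Longrightarrow> r \<le> t \<Longrightarrow> \<exists>\<epsilon>\<in>S. M *v frame r = \<epsilon> *\<^sub>R frame r"
    using Suc.IH[OF d(1) d'(1)] by blast+
  obtain \<epsilon> where \<epsilon>: "\<epsilon> \<in> S" "M *v x = \<epsilon> *\<^sub>R x'"
    using Suc.prems(5)[of n] d(2) d'(2) by auto
  have x: "x \<in> A t \<or> t < 2 \<and> x = frame (Suc t)" and x': "x' \<in> A t \<or> t < 2 \<and> x' = frame (Suc t)"
    using d(3) d'(3) Suc.prems(3,4) IH(1) by auto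
  \<comment> \<open>At state \<open>t\<close> a letter is either old, and then \<open>A1\<close>
    says that \<open>M\<close> multiplies it by a sign, or it is \<open>frame (Suc t)\<close>. If
    one of \<open>x\<close>, \<open>x'\<close> is old, the two agree up to a sign and
    \<open>A2\<close> identifies them; otherwise both are the same frame vector.\<close>
  have xx': "x = x'"
  proof (cases "x \<in> A t \<or> x' \<in> A t")
    case True
    then show ?thesis
    proof
      assume "x \<in> A t"
      then obtain \<delta> where \<delta>: "\<delta> \<in> S" "M *v x = \<delta> *\<^sub>R x"
        using A1[OF \<open>t \<le> 2\<close> _ IH(3)] by blast
      have "x = (\<delta> * \<delta>) *\<^sub>R x" using SS(2)[OF \<delta>(1) \<delta>(1)] by simp
      also have "\<dots> = (\<delta> * \<epsilon>) *\<^sub>R x'" using \<delta>(2) \<epsilon>(2) by (metis scaleR_scaleR)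
      finally show ?thesis using A2[OF \<open>t \<le> 2\<close> x x' SS(1)[OF \<delta>(1) \<epsilon>(1)]] by blast
    next
      assume "x' \<in> A t"
      then obtain \<delta> where \<delta>: "\<delta> \<in> S" "M *v x' = \<delta> *\<^sub>R x'"
        using A1[OF \<open>t \<le> 2\<close> _ IH(3)] by blast
      have "M *v ((\<epsilon> * \<delta>) *\<^sub>R x') = (\<epsilon> * (\<delta> * \<delta>)) *\<^sub>R x'"
        by (simp add: matrix_vector_mult_scaleR \<delta>(2))
      also have "\<dots> = M *v x" using SS(2)[OF \<delta>(1) \<delta>(1)] \<epsilon>(2) by simp
      finally have "x = (\<epsilon> * \<delta>) *\<^sub>R x'" using inj by metis
      then show ?thesis using A2[OF \<open>t \<le> 2\<close> x x' SS(1)[OF \<epsilon>(1) \<delta>(1)]] by blast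
    qed
  qed (use x x' in auto)
  \<comment> \<open>By \<open>A3\<close> the letter that raises the state is not among those that
    keep it, so equal letters move the common state \<open>t\<close> in the same way.\<close>
  have ss': "s = s'"
    using d(3) d'(3) IH(1) xx' A3 Suc.prems(3,4) by (metis Suc_le_lessD numeral_2_eq_2)
  show ?case
  proof (intro conjI allI impI)
    show "s = s'" by (rule ss')
    show "c = c'" using d(2) d'(2) IH(2) xx' by simp
    fix r assume r: "1 \<le> r" "r \<le> s"
    show "\<exists>\<epsilon>\<in>S. M *v frame r = \<epsilon> *\<^sub>R frame r"
    proof (cases "r \<le> t")
      case False
      then have "x = frame r" using d(3) r by (metis le_Suc_eq)
      then show ?thesis using \<epsilon> xx' by auto
    qed (use IH(3) r in blast)
  qed
qed (auto split: if_splits)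

section \<open>Rigidity of signed and of unsigned words\<close>

lemma rotation_matrix_inj:
  assumes "rotation_matrix (M :: real^3^3)" "M *v x = M *v y"
  shows "x = y"
proof -
  have "norm (M *v (x - y)) = 0" using assms(2) by (simp add: matrix_vector_mult_diff_distrib)
  then show ?thesis using rotation_matrix_norm[OF assms(1)] by simp
qed

lemma rotation_matrix_axes:
  assumes M: "rotation_matrix M" and "M *v e1 = a *\<^sub>R e1" "M *v e2 = b *\<^sub>R e2"
  shows "M *v e3 = (a * b) *\<^sub>R e3"
proof -
  have "M *v e3 = cross3 (M *v e1) (M *v e2)"
    using cross_rotation_matrix[OF M, of e1 e2] by (simp add: cross_basis)
  then show ?thesis
    by (simp add: assms cross_basis Cross3.cross_mult_left Cross3.cross_mult_right)
qed

lemma le_2_cases: "(s::nat) \<le> 2 \<longleftrightarrow> s = 0 \<or> s = 1 \<or> s = 2" by auto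

lemma signed_words_rigid:
  assumes M: "rotation_matrix M" and "c \<in> words signed_letters n s" "c' \<in> words signed_letters n s'"
    "s \<le> 2" "s' \<le> 2" "\<And>i. i < n \<Longrightarrow> M *v c i = c' i"
  shows "s = s' \<and> c = c' \<and> (\<forall>r. 1 \<le> r \<longrightarrow> r \<le> s \<longrightarrow> M *v frame r = frame r)"
proof -
  have "s = s' \<and> c = c' \<and> (\<forall>r. 1 \<le> r \<longrightarrow> r \<le> s \<longrightarrow> (\<exists>\<epsilon>\<in>{1}. M *v frame r = \<epsilon> *\<^sub>R frame r))"
  proof (rule words_rigid[where S = "{1}" and A = signed_letters and n = n])
    fix s x assume s: "s \<le> 2" "x \<in> signed_letters s"
      and f: "\<And>r. 1 \<le> r \<Longrightarrow> r \<le> s \<Longrightarrow> \<exists>\<epsilon>\<in>{1}. M *v frame r = \<epsilon> *\<^sub>R frame r"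
    have "M *v e1 = e1" if "s \<ge> 1" using f[of 1] that by (simp add: frame_def)
    moreover have "M *v e2 = e2" if "s = 2" using f[of 2] that by (simp add: frame_def)
    moreover have "M *v e3 = e3" if "s = 2"
      using rotation_matrix_axes[OF M, of 1 1] that calculation by simp
    ultimately show "\<exists>\<epsilon>\<in>{1}. M *v x = \<epsilon> *\<^sub>R x"
      using s by (auto simp: signed_letters_def rotation_matrix_minus_vector split: if_splits)
  next
    show "frame (Suc s) \<notin> signed_letters s" if "s < 2" for s
      using that by (auto simp: signed_letters_def frame_def less_2_cases_iff)
  qed (use assms rotation_matrix_inj in auto)
  then show ?thesis by simp
qed

lemma unsigned_words_rigid:
  assumes M: "rotation_matrix M" and "c \<in> words unsigned_letters n s" "c' \<in> words unsigned_letters n s'"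
    "s \<le> 2" "s' \<le> 2" "\<And>i. i < n \<Longrightarrow> M *v c i = c' i \<or> M *v c i = - c' i"
  shows "s = s' \<and> c = c' \<and>
    (\<forall>r. 1 \<le> r \<longrightarrow> r \<le> s \<longrightarrow> M *v frame r = frame r \<or> M *v frame r = - frame r)"
proof -
  have "s = s' \<and> c = c' \<and> (\<forall>r. 1 \<le> r \<longrightarrow> r \<le> s \<longrightarrow> (\<exists>\<epsilon>\<in>{1,-1}. M *v frame r = \<epsilon> *\<^sub>R frame r))"
  proof (rule words_rigid[where S = "{1,-1}" and A = unsigned_letters and n = n])
    fix s x assume s: "s \<le> 2" "x \<in> unsigned_letters s"
      and f: "\<And>r. 1 \<le> r \<Longrightarrow> r \<le> s \<Longrightarrow> \<exists>\<epsilon>\<in>{1,-1}. M *v frame r = \<epsilon> *\<^sub>R frame r"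
    have 1: "\<exists>\<epsilon>\<in>{1,-1}. M *v e1 = \<epsilon> *\<^sub>R e1" if "s \<ge> 1" using f[of 1] that by (simp add: frame_def)
    have 2: "\<exists>\<epsilon>\<in>{1,-1}. M *v e2 = \<epsilon> *\<^sub>R e2" if "s = 2" using f[of 2] that by (simp add: frame_def)
    have "\<exists>\<epsilon>\<in>{1,-1}. M *v e3 = \<epsilon> *\<^sub>R e3" if s2: "s = 2"
    proof -
      obtain a where "a \<in> {1,-1}" "M *v e1 = a *\<^sub>R e1"
        using 1 s2 by fastforce
      moreover obtain b where "b \<in> {1,-1}" "M *v e2 = b *\<^sub>R e2"
        using 2 s2 by blast
      ultimately show ?thesis
        using rotation_matrix_axes[OF M, of a b] by (intro bexI[of _ "a * b"]) auto
    qed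
    then show "\<exists>\<epsilon>\<in>{1,-1}. M *v x = \<epsilon> *\<^sub>R x"
      using s 1 2 by (auto simp: unsigned_letters_def le_2_cases split: if_splits)
  next
    fix s x y and \<epsilon> :: real
    assume "s \<le> 2" "x \<in> unsigned_letters s \<or> s < 2 \<and> x = frame (Suc s)"
      "y \<in> unsigned_letters s \<or> s < 2 \<and> y = frame (Suc s)" "\<epsilon> \<in> {1,-1}" "x = \<epsilon> *\<^sub>R y"
    then have "x \<in> {e1, e2, e3}" "y \<in> {e1, e2, e3}" "x = y \<or> x = - y"
      by (auto simp: unsigned_letters_def frame_def split: if_splits)
    then show "x = y" by auto
  next
    show "frame (Suc s) \<notin> unsigned_letters s" if "s < 2" for s
      using that by (auto simp: unsigned_letters_def frame_def less_2_cases_iff)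
  next
    fix i assume "i < n"
    then show "\<exists>\<epsilon>\<in>{1,-1}. M *v c i = \<epsilon> *\<^sub>R c' i" using assms(6)[of i] by auto
  qed (use assms rotation_matrix_inj in auto)
  then show ?thesis by simp
qed

section \<open>Counting words\<close>

lemma rotation_matrix_one: "rotation_matrix (mat 1)"
  by (simp add: rotation_matrix_def orthogonal_matrix_id)

text \<open>A word of state \<open>s\<close> arises either by keeping \<open>s\<close> or by raising
  \<open>s - 1\<close>. The two kinds are disjoint because the word without its last letter
  determines its own state, which is the hypothesis \<open>rigid\<close>.\<close>

lemma card_words_Suc:
  assumes "finite (A s)" "s \<le> 2" "s \<ge> 1"
    and rigid: "\<And>c r t. c \<in> words A n r \<Longrightarrow> c \<in> words A n t \<Longrightarrow> r \<le> 2 \<Longrightarrow> t \<le> 2 \<Longrightarrow> r = t"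
    and fin: "finite (words A n s)" "finite (words A n (s - 1))"
  shows "card (words A (Suc n) s) = card (words A n s) * card (A s) + card (words A n (s - 1))"
    "finite (words A (Suc n) s)"
proof -
  have upd: "c = d \<and> x = y" if "c \<in> words A n r" "d \<in> words A n t" "c(n := x) = d(n := y)" for c d x y r t
  proof -
    have "c i = d i" for i
      using fun_cong[OF that(3), of i] words_eq_zero[OF that(1), of n] words_eq_zero[OF that(2), of n]
      by (cases "i = n") auto
    then show ?thesis using fun_cong[OF that(3), of n] by auto
  qed
  let ?P = "(\<lambda>(c, x). c(n := x)) ` (words A n s \<times> A s)" and ?Q = "(\<lambda>c. c(n := frame s)) ` words A n (s - 1)"
  have "inj_on (\<lambda>(c, x). c(n := x)) (words A n s \<times> A s)" "inj_on (\<lambda>c. c(n := frame s)) (words A n (s - 1))"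
    using upd by (fastforce intro!: inj_onI)+
  then have "card ?P = card (words A n s) * card (A s)" "card ?Q = card (words A n (s - 1))"
    by (simp_all add: card_image card_cartesian_product)
  moreover have "?P \<inter> ?Q = {}"
  proof (rule ccontr)
    assume "?P \<inter> ?Q \<noteq> {}"
    then obtain c d x where "c \<in> words A n s" "d \<in> words A n (s - 1)" "c(n := x) = d(n := frame s)"
      by auto
    then have "s = s - 1"
      using upd rigid[of c s "s - 1"] assms(2) by (metis diff_le_self le_trans)
    then show False using assms(3) by simp
  qed
  moreover have "words A (Suc n) s = ?P \<union> ?Q" using assms(3) by simp
  moreover have "finite ?P" "finite ?Q" using assms by auto
  ultimately show "card (words A (Suc n) s) = card (words A n s) * card (A s) + card (words A n (s - 1))"
    "finite (words A (Suc n) s)"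
    by (simp_all add: card_Un_disjoint del: words.simps)
qed

text \<open>The counts \<open>a\<close> and \<open>k\<close> at states 1 and 2 obey
  \<open>a' = 3 a + 1\<close> and \<open>k' = 7 k + a\<close>. The closed form counts orbits: of the
  \<open>7^n\<close> tuples in \<open>Q8\<close> without entry 1, \<open>3 * 3^n - 2\<close>
  commute, since they lie in one of three cyclic subgroups of order 4 that share \<open>-1\<close>;
  the 24 rotations of the cube permute the others freely.\<close>

lemma card_signed_words:
  "finite (words signed_letters n s) \<or> s > 2"
  "card (words signed_letters n 0) = 1" "2 * card (words signed_letters n 1) + 1 = 3 ^ n"
  "card (words signed_letters n 2) = K_num n"
proof -
  have rigid: "r = t" if "c \<in> words signed_letters n r" "c \<in> words signed_letters n t" "r \<le> 2" "t \<le> 2" for c n r t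
    using signed_words_rigid[OF rotation_matrix_one that] by simp
  have A: "finite (signed_letters s)" "card (signed_letters 1) = 3" "card (signed_letters 2) = 7" for s
    by (auto simp: signed_letters_def)
  have 0: "words signed_letters n 0 = {\<lambda>_. 0}" for n
    by (induction n) (auto simp: signed_letters_def)
  have *: "finite (words signed_letters n 1) \<and> finite (words signed_letters n 2) \<and>
      2 * card (words signed_letters n 1) + 1 = 3 ^ n \<and> card (words signed_letters n 2) = K_num n" for n
  proof (induction n)
    case 0 show ?case by (simp add: K_num_def)
  next
    case (Suc n)
    have f: "finite (words signed_letters n (1 - 1))" "finite (words signed_letters n 1)" "finite (words signed_letters n (2 - 1))"
        "finite (words signed_letters n 2)"
      using Suc 0 by auto
    note c1 = card_words_Suc[OF A(1) _ _ rigid f(2,1)]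
      and c2 = card_words_Suc[OF A(1) _ _ rigid f(4,3)]
    have 1: "finite (words signed_letters (Suc n) 1)" "finite (words signed_letters (Suc n) 2)"
      using c1(2) c2(2) by (simp_all del: words.simps)
    have 2: "card (words signed_letters (Suc n) 1) = card (words signed_letters n 1) * 3 + 1"
      using c1(1) A 0[of n] by (simp del: words.simps)
    have 3: "card (words signed_letters (Suc n) 2) = card (words signed_letters n 2) * 7 + card (words signed_letters n 1)"
      using c2(1) A by (simp del: words.simps)
    have "real (2 * card (words signed_letters n 1) + 1) = real (3 ^ n)"
      using Suc by simp
    then have "real (card (words signed_letters n 1)) = (3 ^ n - 1) / 2"
      by simp
    then have "real (card (words signed_letters (Suc n) 2)) = real (K_num (Suc n))"
      unfolding 3 using Suc by (simp add: real_K_num field_simps)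
    then show ?case using 1 2 Suc by (simp del: words.simps)
  qed
  show "finite (words signed_letters n s) \<or> s > 2"
    using * 0 by (cases "s \<le> 2") (auto simp: le_2_cases)
  show "card (words signed_letters n 0) = 1" "2 * card (words signed_letters n 1) + 1 = 3 ^ n"
    "card (words signed_letters n 2) = K_num n"
    using * 0 by auto
qed

text \<open>At state 1 there is only the constant word \<open>e1\<close>, so the count at state 2
  obeys \<open>c' = 3 c + 1\<close> from length 1 on. In closed form this is
  \<open>(3^n - 3) / 6\<close>: choices of one of three axes per entry, without the three constant
  ones, up to permutation of the axes.\<close>

lemma card_unsigned_words:
  "finite (words unsigned_letters n 2)" "card (words unsigned_letters n 2) = C_num n"
proof -
  have rigid: "r = t" if "c \<in> words unsigned_letters n r" "c \<in> words unsigned_letters n t" "r \<le> 2" "t \<le> 2" for c n r t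
    using unsigned_words_rigid[OF rotation_matrix_one that] by simp
  have A: "finite (unsigned_letters s)" "card (unsigned_letters 1) = 1" "card (unsigned_letters 2) = 3" for s
    by (auto simp: unsigned_letters_def)
  have 0: "words unsigned_letters n 0 = (if n = 0 then {\<lambda>_. 0} else {})" for n
    by (induction n) (auto simp: unsigned_letters_def)
  have *: "finite (words unsigned_letters n 1) \<and> finite (words unsigned_letters n 2) \<and>
      card (words unsigned_letters n 1) = (if n = 0 then 0 else 1) \<and> card (words unsigned_letters n 2) = C_num n" for n
  proof (induction n)
    case 0 show ?case by (simp add: C_num_def)
  next
    case (Suc n)
    have f: "finite (words unsigned_letters n (1 - 1))" "finite (words unsigned_letters n 1)" "finite (words unsigned_letters n (2 - 1))"
        "finite (words unsigned_letters n 2)"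
      using Suc 0 by auto
    note c1 = card_words_Suc[OF A(1) _ _ rigid f(2,1)]
      and c2 = card_words_Suc[OF A(1) _ _ rigid f(4,3)]
    have 1: "finite (words unsigned_letters (Suc n) 1)" "finite (words unsigned_letters (Suc n) 2)"
      using c1(2) c2(2) by (simp_all del: words.simps)
    have 2: "card (words unsigned_letters (Suc n) 1) = card (words unsigned_letters n 1) * 1 + (if n = 0 then 1 else 0)"
      using c1(1) A 0[of n] by (simp del: words.simps)
    have 3: "card (words unsigned_letters (Suc n) 2) = card (words unsigned_letters n 2) * 3 + card (words unsigned_letters n 1)"
      using c2(1) A by (simp del: words.simps)
    \<comment> \<open>The truncated exponent \<open>n - 1\<close> makes \<open>n = 0\<close> a
      separate case; \<open>C_num\<close> is 0 at both 0 and 1.\<close>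
    have "real (card (words unsigned_letters (Suc n) 2)) = real (C_num (Suc n))"
      unfolding 3 using Suc by (cases n) (simp_all add: real_C_num field_simps)
    then show ?case using 1 2 Suc by (simp del: words.simps)
  qed
  then show "finite (words unsigned_letters n 2)" "card (words unsigned_letters n 2) = C_num n"
    by auto
qed

section \<open>Bringing tuples into standard position\<close>

lemma rotation_matrix_mult_transpose:
  assumes "rotation_matrix (M :: real^3^3)"
  shows "M *v (transpose M *v x) = x"
  using assms by (simp add: rotation_matrix_def orthogonal_matrix_def matrix_vector_mul_assoc del: transpose_matrix_vector)

lemma rotation_matrix_mul:
  "rotation_matrix M \<Longrightarrow> rotation_matrix N \<Longrightarrow> rotation_matrix (M ** N :: real^'n^'n)"
  by (simp add: rotation_matrix_def orthogonal_matrix_mul det_mul)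

lemma rotation_about_e1:
  fixes z :: "real^3"
  assumes "norm z = 1" "z $ 1 = 0"
  obtains R where "rotation_matrix R" "R *v e1 = e1" "R *v e2 = z"
proof
  \<comment> \<open>The columns of \<open>R\<close> are \<open>e1\<close>, \<open>z\<close> and
    \<open>cross3 e1 z\<close>.\<close>
  define R :: "real^3^3" where "R = vector [vector [1, 0, 0], vector [0, z $ 2, - z $ 3], vector [0, z $ 3, z $ 2]]"
  have z: "z $ 2 * z $ 2 + z $ 3 * z $ 3 = 1"
    using assms by (simp add: norm_eq_1 inner_vec_def sum_3)
  then have "transpose R ** R = mat 1"
    by (simp add: R_def vec_eq_iff forall_3 matrix_matrix_mult_def transpose_def mat_def sum_3 algebra_simps)
  moreover have "det R = 1"
    using z by (simp add: R_def det_3)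
  ultimately show "rotation_matrix R"
    by (simp add: rotation_matrix_def orthogonal_matrix)
  show "R *v e1 = e1" "R *v e2 = z"
    using assms by (simp_all add: R_def vec_eq_iff forall_3 matrix_vector_mult_def axis_def sum_3)
qed

text \<open>The rotation is adjusted while the entries are read. The new entry, pulled back to
  \<open>z\<close>, is either an available letter or a direction orthogonal to the axes met so far.
  In the second case \<open>M\<close> is replaced by a rotation with the same effect on all earlier
  letters that takes the next frame vector to the new entry.\<close>

lemma signed_words_exhaust:
  fixes y :: "nat \<Rightarrow> real^3"
  assumes "\<And>i. i < n \<Longrightarrow> y i = 0 \<or> norm (y i) = 1"
    "\<And>i j. i < n \<Longrightarrow> j < n \<Longrightarrow> y i = y j \<or> y i = - y j \<or> y i \<bullet> y j = 0"
  shows "\<exists>M s c. rotation_matrix M \<and> s \<le> 2 \<and> c \<in> words signed_letters n s \<and> (\<forall>i<n. y i = M *v c i)"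
  using assms
proof (induction n)
  case 0
  then show ?case
    using rotation_matrix_one by (intro exI[of _ "mat 1"] exI[of _ 0] exI[of _ "\<lambda>_. 0"]) simp
next
  case (Suc n)
  have "\<exists>M s c. rotation_matrix M \<and> s \<le> 2 \<and> c \<in> words signed_letters n s \<and> (\<forall>i<n. y i = M *v c i)"
    by (rule Suc.IH) (use Suc.prems in auto)
  then obtain M s c where M: "rotation_matrix M" "s \<le> 2" and c: "c \<in> words signed_letters n s"
    and yc: "\<And>i. i < n \<Longrightarrow> y i = M *v c i"
    by blast
  define z where "z = transpose M *v y n"
  have yz: "y n = M *v z"
    using M by (simp only: z_def rotation_matrix_mult_transpose)
  have z: "z = 0 \<or> norm z = 1"
    using Suc.prems(1)[of n] rotation_matrix_norm[OF M(1), of z] yz by auto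
  \<comment> \<open>Every axis counted by the state occurs as an earlier entry, so the pairwise
    hypothesis applies to it and can be pulled back along \<open>M\<close>.\<close>
  have rel: "z = frame r \<or> z = - frame r \<or> z \<bullet> frame r = 0" if r: "1 \<le> r" "r \<le> s" for r
  proof -
    obtain i where i: "i < n" "c i = frame r"
      using words_frame[OF c r] by blast
    have "y n = y i \<or> y n = - y i \<or> y n \<bullet> y i = 0"
      using Suc.prems(2)[of n i] i by auto
    then show ?thesis
      using rotation_matrix_inj[OF M(1)] rotation_matrix_inner[OF M(1)]
      by (auto simp: yz yc[OF i(1)] i(2) simp flip: rotation_matrix_minus_vector)
  qed
  have keep: ?case if "z \<in> signed_letters s"
  proof (intro exI conjI allI impI)
    show "c(n := z) \<in> words signed_letters (Suc n) s" by (rule words_SucI(1)[OF c that])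
    show "y i = M *v (c(n := z)) i" if "i < Suc n" for i
      using that yc[of i] yz by (cases "i = n") auto
  qed (use M in auto)
  have raise: ?case
    if "s < 2" "rotation_matrix N" "N *v frame (Suc s) = y n" "\<And>x. x \<in> signed_letters s \<Longrightarrow> N *v x = M *v x" for N
  proof (intro exI conjI allI impI)
    show "c(n := frame (Suc s)) \<in> words signed_letters (Suc n) (Suc s)" by (rule words_SucI(2)[OF c refl])
    show "y i = N *v (c(n := frame (Suc s))) i" if "i < Suc n" for i
      using that yc[of i] words_signed_letters[OF c M(2), of i] \<open>N *v frame (Suc s) = y n\<close>
        \<open>\<And>x. x \<in> signed_letters s \<Longrightarrow> N *v x = M *v x\<close> by (cases "i = n") auto
  qed (use that in auto)
  consider "z \<in> signed_letters s" | "z \<notin> signed_letters s" "norm z = 1" "s = 0"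
    | "z \<notin> signed_letters s" "norm z = 1" "s = 1" | "s = 2"
  proof -
    have "norm z = 1" if "z \<notin> signed_letters s"
      using z that by (auto simp: signed_letters_def split: if_splits)
    then show ?thesis using that M(2) unfolding le_2_cases by blast
  qed
  then show ?case
  proof cases
    case 1 then show ?thesis by (rule keep)
  next
    case 2
    then have "norm (y n) = 1" using yz rotation_matrix_norm[OF M(1)] by simp
    then obtain N :: "real^3^3" where "rotation_matrix N" "N *v e1 = y n"
      using rotation_matrix_exists_basis[of "y n" 1] by auto
    then show ?thesis
      using 2 by (intro raise[of N]) (auto simp: frame_def signed_letters_def)
  next
    case 3
    then have "z \<bullet> e1 = 0" using rel[of 1] by (auto simp: frame_def signed_letters_def)
    then have "z $ 1 = 0" by (simp add: inner_axis)
    then obtain R where R: "rotation_matrix R" "R *v e1 = e1" "R *v e2 = z"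
      using rotation_about_e1 3 by blast
    show ?thesis
    proof (rule raise[of "M ** R"])
      show "rotation_matrix (M ** R)" using M R by (simp add: rotation_matrix_mul)
      show "(M ** R) *v frame (Suc s) = y n"
        using 3 R yz by (simp add: frame_def flip: matrix_vector_mul_assoc)
      show "(M ** R) *v x = M *v x" if "x \<in> signed_letters s" for x
        using that 3 R by (auto simp: signed_letters_def rotation_matrix_minus_vector simp flip: matrix_vector_mul_assoc)
    qed (use 3 in simp)
  next
    case 4
    \<comment> \<open>A vector orthogonal to \<open>e1\<close> and \<open>e2\<close> is a multiple
      of \<open>e3\<close>; with norm 0 or 1 it is 0, \<open>e3\<close> or
      \<open>- e3\<close>.\<close>
    have "z \<in> signed_letters 2"
    proof (cases "z \<bullet> e1 = 0 \<and> z \<bullet> e2 = 0")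
      case True
      then have "z $ 1 = 0" "z $ 2 = 0" by (simp_all add: inner_axis)
      moreover from this have "z $ 3 = 0 \<or> z $ 3 = 1 \<or> z $ 3 = -1"
        using z by (auto simp: norm_eq_1 inner_vec_def sum_3 square_eq_1_iff)
      ultimately show ?thesis
        by (auto simp: signed_letters_def vec_eq_iff forall_3 axis_def)
    next
      case False
      then show ?thesis
        using rel[of 1] rel[of 2] 4 by (auto simp: signed_letters_def frame_def)
    qed
    then show ?thesis using keep 4 by simp
  qed
qed

definition unsign :: "real^3 \<Rightarrow> real^3" where
  "unsign x = (if x \<in> {- e1, - e2, - e3} then - x else x)"

lemma unsign_cases: "unsign x = x \<or> unsign x = - x"
  by (simp add: unsign_def)

text \<open>The letters that raise the state carry no minus sign, so dropping signs changes neither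
  them nor the states.\<close>

lemma unsign_words:
  "c \<in> words signed_letters n s \<Longrightarrow> s \<le> 2 \<Longrightarrow> (\<And>i. i < n \<Longrightarrow> c i \<noteq> 0) \<Longrightarrow>
    unsign \<circ> c \<in> words unsigned_letters n s"
proof (induction n arbitrary: c s)
  case 0
  then show ?case by (auto simp: unsign_def fun_eq_iff split: if_splits)
next
  case (Suc n)
  obtain d x t where d: "d \<in> words signed_letters n t" "c = d(n := x)"
    "t = s \<and> x \<in> signed_letters s \<or> s = Suc t \<and> x = frame s"
    using Suc.prems(1) by (rule words_SucE)
  have "d i \<noteq> 0" if "i < n" for i using Suc.prems(3)[of i] d(2) that by auto
  then have IH: "unsign \<circ> d \<in> words unsigned_letters n t"
    using d(1,3) Suc.prems(2) by (intro Suc.IH) auto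
  have "x \<noteq> 0" using Suc.prems(3)[of n] d(2) by auto
  have eq: "unsign \<circ> c = (unsign \<circ> d)(n := unsign x)" using d(2) by auto
  from d(3) show ?case
  proof
    assume "t = s \<and> x \<in> signed_letters s"
    then have "unsign x \<in> unsigned_letters s" "t = s"
      using \<open>x \<noteq> 0\<close> by (auto simp: signed_letters_def unsigned_letters_def unsign_def split: if_splits)
    then show ?thesis using words_SucI(1) IH unfolding eq by blast
  next
    assume "s = Suc t \<and> x = frame s"
    then have "unsign x = frame s" "s = Suc t" by (auto simp: unsign_def frame_def)
    then show ?thesis using words_SucI(2)[OF IH, of s] unfolding eq by (simp del: words.simps fun_upd_apply)
  qed
qed

section \<open>The disk bundle\<close>

text \<open>The sup norm enters because a tuple is sent to the basepoint as soon as one coordinate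
  reaches modulus 1, whereas the sphere bundle of the Thom space is defined by the Euclidean
  norm.\<close>

primrec max_abs :: "nat \<Rightarrow> (nat \<Rightarrow> real) \<Rightarrow> real" where
  "max_abs 0 t = 0"
| "max_abs (Suc n) t = max (max_abs n t) \<bar>t n\<bar>"

lemma max_abs_cong: "(\<And>i. i < n \<Longrightarrow> \<bar>t i\<bar> = \<bar>t' i\<bar>) \<Longrightarrow> max_abs n t = max_abs n t'"
  by (induction n) auto

lemma max_abs_nonneg: "0 \<le> max_abs n t"
  by (induction n) auto

lemma abs_le_max_abs: "i < n \<Longrightarrow> \<bar>t i\<bar> \<le> max_abs n t"
  by (induction n) (auto simp: less_Suc_eq)

lemma max_abs_le: "0 \<le> b \<Longrightarrow> (\<And>i. i < n \<Longrightarrow> \<bar>t i\<bar> \<le> b) \<Longrightarrow> max_abs n t \<le> b"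
  by (induction n) auto

lemma max_abs_attained: "max_abs n t \<noteq> 0 \<Longrightarrow> \<exists>i<n. \<bar>t i\<bar> = max_abs n t"
proof (induction n)
  case (Suc n)
  show ?case
  proof (cases "\<bar>t n\<bar> \<ge> max_abs n t")
    case False
    then obtain i where "i < n" "\<bar>t i\<bar> = max_abs n t" using Suc abs_ge_zero[of "t n"] by auto
    then show ?thesis using False by (intro exI[of _ i]) auto
  qed auto
qed simp

lemma max_abs_divide: "c > 0 \<Longrightarrow> max_abs n (\<lambda>i. t i / c) = max_abs n t / c"
  by (induction n) (auto simp: max_def divide_le_cancel)

lemma L2_set_divide: "c > 0 \<Longrightarrow> L2_set (\<lambda>i. t i / c) A = L2_set t A / c"
  using L2_set_left_distrib[of "1/c" t A] by simp

lemma L2_set_abs: "L2_set (\<lambda>i. \<bar>t i\<bar>) A = L2_set t A"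
  by (simp add: L2_set_def)

lemma max_abs_le_L2_set: "max_abs n t \<le> L2_set t {..<n}"
  using member_le_L2_set[of "{..<n}" _ t] member_le_L2_set[of "{..<n}" _ "\<lambda>i. \<bar>t i\<bar>"]
  by (intro max_abs_le) (auto simp: L2_set_abs)

text \<open>Mutually inverse homeomorphisms between the Euclidean unit ball and the cube, which
  preserve rays. The denominators are chosen so that no case distinction is needed at the origin.\<close>

definition to_cube :: "nat \<Rightarrow> (nat \<Rightarrow> real) \<Rightarrow> nat \<Rightarrow> real" where
  "to_cube n t i = t i / (1 - L2_set t {..<n} + max_abs n t)"

definition to_ball :: "nat \<Rightarrow> (nat \<Rightarrow> real) \<Rightarrow> nat \<Rightarrow> real" where
  "to_ball n s i = s i / (1 + L2_set s {..<n} - max_abs n s)"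

text \<open>A nonpositive denominator would need Euclidean norm 1 and sup norm 0 at once.\<close>

lemma to_cube_denominator_pos:
  assumes "L2_set t {..<n} \<le> 1"
  shows "1 - L2_set t {..<n} + max_abs n t > 0"
proof (cases "max_abs n t = 0")
  case True
  then have "L2_set t {..<n} = 0"
    using abs_le_max_abs[of _ n t] by (intro L2_set_0') fastforce
  then show ?thesis using True by simp
next
  case False
  then show ?thesis using assms max_abs_nonneg[of n t] by linarith
qed

lemma to_ball_denominator_pos: "1 + L2_set s {..<n} - max_abs n s > 0"
  using max_abs_le_L2_set[of n s] by linarith

text \<open>Both norms are divided by the denominator \<open>d\<close>. The quotient
  \<open>max_abs n t / d\<close> compares with 1 exactly as the Euclidean norm does, and the
  denominator of \<open>to_ball\<close> at the image is \<open>1 / d\<close>.\<close>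

lemma max_abs_to_cube:
  assumes "L2_set t {..<n} \<le> 1"
  shows "max_abs n (to_cube n t) \<le> 1" "max_abs n (to_cube n t) = 1 \<longleftrightarrow> L2_set t {..<n} = 1"
    "to_ball n (to_cube n t) i = t i"
proof -
  define d where "d = 1 - L2_set t {..<n} + max_abs n t"
  have d: "d > 0" using to_cube_denominator_pos[OF assms] by (simp add: d_def)
  have c: "to_cube n t = (\<lambda>i. t i / d)" by (simp add: to_cube_def d_def fun_eq_iff)
  have m: "max_abs n (to_cube n t) = max_abs n t / d" "L2_set (to_cube n t) {..<n} = L2_set t {..<n} / d"
    unfolding c using d by (simp_all add: max_abs_divide L2_set_divide)
  show "max_abs n (to_cube n t) \<le> 1" "max_abs n (to_cube n t) = 1 \<longleftrightarrow> L2_set t {..<n} = 1"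
    using d assms by (auto simp: m d_def)
  have "1 + L2_set t {..<n} / d - max_abs n t / d = (d + L2_set t {..<n} - max_abs n t) / d"
    using d by (simp add: field_simps)
  also have "d + L2_set t {..<n} - max_abs n t = 1" by (simp add: d_def)
  finally have "1 + L2_set t {..<n} / d - max_abs n t / d = 1 / d" .
  then show "to_ball n (to_cube n t) i = t i"
    unfolding to_ball_def m using d by (simp add: c)
qed

lemma L2_set_to_ball:
  assumes "max_abs n s \<le> 1"
  shows "L2_set (to_ball n s) {..<n} \<le> 1" "to_cube n (to_ball n s) i = s i"
proof -
  define d where "d = 1 + L2_set s {..<n} - max_abs n s"
  have d: "d > 0" using to_ball_denominator_pos by (simp add: d_def)
  have c: "to_ball n s = (\<lambda>i. s i / d)" by (simp add: to_ball_def d_def fun_eq_iff)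
  have m: "max_abs n (to_ball n s) = max_abs n s / d" "L2_set (to_ball n s) {..<n} = L2_set s {..<n} / d"
    unfolding c using d by (simp_all add: max_abs_divide L2_set_divide)
  show "L2_set (to_ball n s) {..<n} \<le> 1"
    using d assms by (auto simp: m d_def)
  have "1 - L2_set s {..<n} / d + max_abs n s / d = (d - L2_set s {..<n} + max_abs n s) / d"
    using d by (simp add: field_simps)
  also have "d - L2_set s {..<n} + max_abs n s = 1" by (simp add: d_def)
  finally have "1 - L2_set s {..<n} / d + max_abs n s / d = 1 / d" .
  then show "to_cube n (to_ball n s) i = s i"
    unfolding to_cube_def m using d by (simp add: c)
qed

lemma continuous_map_scaleR:
  fixes g :: "'a \<Rightarrow> 'b::real_normed_vector"
  shows "continuous_map X euclideanreal f \<Longrightarrow> continuous_map X euclidean g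
    \<Longrightarrow> continuous_map X euclidean (\<lambda>x. f x *\<^sub>R g x)"
  by (simp add: continuous_map_atin tendsto_scaleR)

lemma continuous_map_compose_continuous_on:
  assumes "continuous_map X euclidean f" "continuous_on UNIV h"
  shows "continuous_map X euclidean (\<lambda>x. h (f x))"
  using continuous_map_compose[OF assms(1), of euclidean h] assms(2) by (simp add: o_def)

lemma continuous_map_L2_set:
  assumes "\<And>i. i \<in> I \<Longrightarrow> continuous_map X euclideanreal (\<lambda>x. f x i)" "finite I"
  shows "continuous_map X euclideanreal (\<lambda>x. L2_set (f x) I)"
  unfolding L2_set_def by (intro continuous_intros assms)

lemma continuous_map_max_abs:
  assumes "\<And>i. i < n \<Longrightarrow> continuous_map X euclideanreal (\<lambda>x. f x i)"
  shows "continuous_map X euclideanreal (\<lambda>x. max_abs n (f x))"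
  using assms by (induction n) (auto intro!: continuous_intros)

section \<open>Projective space and the disk bundle in coordinates\<close>

lemma topspace_projective_space: "topspace projective_space = (\<lambda>x. {x, - x}) ` sphere 0 1"
  unfolding projective_space_def by (simp add: topspace_identification_topology)

lemma compact_space_projective_space: "compact_space (projective_space :: 'a::euclidean_space set topology)"
proof -
  have "compactin (top_of_set (sphere (0::'a) 1)) (sphere 0 1)"
    by (simp add: compactin_subtopology)
  then show ?thesis
    unfolding compact_space_def topspace_projective_space
    using image_compactin quotient_imp_continuous_map[OF quotient_map_projective_space] by blast
qed

lemma antipodal_pair_eq_iff: "{x, - x} = {y, - y} \<longleftrightarrow> y = x \<or> y = - (x :: 'a::real_vector)"
  by (auto simp: doubleton_eq_iff)

lemma span_antipodal_pair: "v \<in> span {x, - x} \<longleftrightarrow> (\<exists>c. v = c *\<^sub>R x)"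
proof -
  have "span {x, - x} = span {x}"
    by (rule span_eq[THEN iffD2]) (auto intro: span_neg span_base)
  then show ?thesis by (auto simp: span_singleton)
qed

text \<open>Coordinates after the choice of a unit vector on the line; the only ambiguity on
  \<open>{..<n}\<close> is passing from \<open>(u, t)\<close> to \<open>(-u, -t)\<close>.\<close>

definition bundle_point :: "nat \<Rightarrow> real^3 \<Rightarrow> (nat \<Rightarrow> real) \<Rightarrow> lambda2_sum" where
  "bundle_point n u t = ({u, - u}, \<lambda>i\<in>{..<n}. ({u, - u}, t i *\<^sub>R u))"

lemma topspace_n_lambda2: "topspace (n_lambda2 n) = {bundle_point n u t |u t. norm u = 1}"
proof (intro equalityI subsetI)
  fix z assume z: "z \<in> topspace (n_lambda2 n)"
  obtain l e where le: "z = (l, e)" by fastforce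
  obtain u where u: "norm u = 1" "l = {u, - u}"
    using z by (auto simp: n_lambda2_def whitney_power_def topspace_projective_space le)
  have e: "e \<in> extensional {..<n}" "\<And>i. i < n \<Longrightarrow> fst (e i) = l" "\<And>i. i < n \<Longrightarrow> snd (e i) \<in> span (fst (e i))"
    using z by (auto simp: n_lambda2_def whitney_power_def tautological_bundle_def le PiE_def Pi_def case_prod_beta)
  have "\<forall>i. \<exists>c. i < n \<longrightarrow> snd (e i) = c *\<^sub>R u"
    using e u by (metis span_antipodal_pair)
  then obtain t where t: "\<And>i. i < n \<Longrightarrow> snd (e i) = t i *\<^sub>R u" by metis
  have "e = (\<lambda>i\<in>{..<n}. ({u, - u}, t i *\<^sub>R u))"
    using e t u by (auto simp: fun_eq_iff prod_eq_iff extensional_def)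
  then show "z \<in> {bundle_point n u t |u t. norm u = 1}"
    using u by (auto simp: le bundle_point_def)
next
  fix z assume "z \<in> {bundle_point n u t |u t. norm u = 1}"
  then obtain u t where "z = bundle_point n u t" "norm u = 1" by auto
  then show "z \<in> topspace (n_lambda2 n)"
    by (auto simp: n_lambda2_def whitney_power_def tautological_bundle_def bundle_point_def
        topspace_projective_space span_antipodal_pair)
qed

lemma n_lambda2_norm_bundle_point:
  "norm u = 1 \<Longrightarrow> n_lambda2_norm n (bundle_point n u t) = L2_set t {..<n}"
  unfolding n_lambda2_norm_def bundle_point_def
  by (simp, subst L2_set_abs[symmetric], intro L2_set_cong) auto

lemma bundle_point_eq_iff:
  assumes "norm u = 1" "norm v = 1"
  shows "bundle_point n u t = bundle_point n v s \<longleftrightarrow>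
    v = u \<and> (\<forall>i<n. s i = t i) \<or> v = - u \<and> (\<forall>i<n. s i = - t i)"
proof -
  have "u \<noteq> 0" using assms by auto
  have "bundle_point n u t = bundle_point n v s \<longleftrightarrow> (v = u \<or> v = - u) \<and> (\<forall>i<n. t i *\<^sub>R u = s i *\<^sub>R v)"
    by (auto simp: bundle_point_def antipodal_pair_eq_iff fun_eq_iff restrict_def)
  also have "\<dots> \<longleftrightarrow> v = u \<and> (\<forall>i<n. s i = t i) \<or> v = - u \<and> (\<forall>i<n. s i = - t i)"
    using \<open>u \<noteq> 0\<close> by (auto simp flip: scaleR_minus_left)
  finally show ?thesis .
qed

lemma zero_section_eq: "norm u = 1 \<Longrightarrow> zero_section n {u, - u} = bundle_point n u (\<lambda>_. 0)"
  by (simp add: zero_section_def bundle_point_def)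

definition disk_bundle :: "nat \<Rightarrow> lambda2_sum topology" where
  "disk_bundle n = subtopology (n_lambda2 n) {z. n_lambda2_norm n z \<le> 1}"

lemma topspace_disk_bundle:
  "topspace (disk_bundle n) = {bundle_point n u t |u t. norm u = 1 \<and> L2_set t {..<n} \<le> 1}"
  unfolding disk_bundle_def topspace_subtopology topspace_n_lambda2
  using n_lambda2_norm_bundle_point by auto blast

lemma Thom_n_lambda2_eq:
  "Thom_n_lambda2 n = collapse (disk_bundle n) {bundle_point n u t |u t. norm u = 1 \<and> L2_set t {..<n} = 1}"
proof -
  have "{e \<in> topspace (n_lambda2 n). n_lambda2_norm n e = 1}
      = {bundle_point n u t |u t. norm u = 1 \<and> L2_set t {..<n} = 1}"
    unfolding topspace_n_lambda2 using n_lambda2_norm_bundle_point by auto blast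
  then show ?thesis by (simp add: Thom_n_lambda2_def Thom_space_def disk_bundle_def)
qed

text \<open>The disk bundle is the continuous image of a closed subset of sphere times cube: the
  Euclidean unit ball lies in the cube, whose product topology is compact.\<close>

lemma compact_space_disk_bundle: "compact_space (disk_bundle n)"
proof -
  let ?T = "product_topology (\<lambda>_. top_of_set {-1..1::real}) {..<n}"
  let ?X = "prod_topology (top_of_set (sphere (0::real^3) 1)) ?T"
  let ?C = "{p \<in> topspace ?X. L2_set (snd p) {..<n} \<le> 1}"
  have coord: "continuous_map ?X euclideanreal (\<lambda>p. snd p i)" if "i < n" for i
  proof -
    have "continuous_map ?X (top_of_set {-1..1}) (\<lambda>p. snd p i)"
      using that continuous_map_compose[OF continuous_map_snd
          continuous_map_product_projection[of i "{..<n}" "\<lambda>_. top_of_set {-1..1::real}"]] by (simp add: o_def)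
    then show ?thesis by (rule continuous_map_into_fulltopology)
  qed
  have "closedin ?X {p \<in> topspace ?X. L2_set (snd p) {..<n} \<in> {..1}}"
    using coord by (intro closedin_continuous_map_preimage[where Y=euclideanreal] continuous_map_L2_set) auto
  moreover have "compact_space ?X"
    by (simp add: compact_space_prod_topology compact_space_product_topology compact_space_subtopology)
  ultimately have C: "compactin ?X ?C"
    by (simp add: closedin_compact_space)
  have pair: "continuous_map ?X RP2 (\<lambda>p. {fst p, - fst p})"
    using continuous_map_compose[OF continuous_map_fst[of "top_of_set (sphere (0::real^3) 1)" ?T]
        quotient_imp_continuous_map[OF quotient_map_projective_space]] by (simp add: o_def)
  have vec: "continuous_map ?X euclidean (\<lambda>p. snd p i *\<^sub>R fst p)" if "i < n" for i
    by (intro continuous_map_scaleR coord that continuous_map_into_fulltopology[OF continuous_map_fst])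
  have "continuous_map ?X (n_lambda2 n) (\<lambda>p. bundle_point n (fst p) (snd p))"
    unfolding n_lambda2_def whitney_power_def bundle_point_def continuous_map_in_subtopology
  proof (intro conjI continuous_map_pairedI pair)
    show "continuous_map ?X (product_topology (\<lambda>_. tautological_bundle) {..<n})
        (\<lambda>p. \<lambda>i\<in>{..<n}. ({fst p, - fst p}, snd p i *\<^sub>R fst p))"
      unfolding continuous_map_componentwise tautological_bundle_def
      by (auto simp: continuous_map_in_subtopology span_antipodal_pair intro!: continuous_map_pairedI pair vec)
  qed auto
  then have "compactin (n_lambda2 n) ((\<lambda>p. bundle_point n (fst p) (snd p)) ` ?C)"
    using C image_compactin by blast
  moreover have "(\<lambda>p. bundle_point n (fst p) (snd p)) ` ?C = topspace (disk_bundle n)"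
  proof
    show "(\<lambda>p. bundle_point n (fst p) (snd p)) ` ?C \<subseteq> topspace (disk_bundle n)"
      by (auto simp: topspace_disk_bundle)
    show "topspace (disk_bundle n) \<subseteq> (\<lambda>p. bundle_point n (fst p) (snd p)) ` ?C"
    proof
      fix z assume "z \<in> topspace (disk_bundle n)"
      then obtain u t where ut: "z = bundle_point n u t" "norm u = 1" "L2_set t {..<n} \<le> 1"
        by (auto simp: topspace_disk_bundle)
      have "\<bar>t i\<bar> \<le> 1" if "i < n" for i
        using abs_le_max_abs[OF that, of t] max_abs_le_L2_set[of n t] ut(3) by linarith
      \<comment> \<open>Points of the product are extensional functions, so \<open>t\<close> is cut
        off outside \<open>{..<n}\<close>; \<open>bundle_point\<close> and the norm do not see the
        difference.\<close>
      then have "restrict t {..<n} \<in> topspace ?T"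
        by (auto simp: abs_le_iff)
      moreover have "L2_set (restrict t {..<n}) {..<n} = L2_set t {..<n}"
        by (intro L2_set_cong) auto
      ultimately have "(u, restrict t {..<n}) \<in> ?C"
        using ut(2,3) by (simp only: mem_Collect_eq topspace_prod_topology mem_Times_iff) simp
      moreover have "z = bundle_point n u (restrict t {..<n})"
        by (auto simp: ut bundle_point_def)
      ultimately show "z \<in> (\<lambda>p. bundle_point n (fst p) (snd p)) ` ?C" by (metis (lifting) fst_conv snd_conv imageI)
    qed
  qed
  ultimately have "compactin (n_lambda2 n) (topspace (n_lambda2 n) \<inter> {z. n_lambda2_norm n z \<le> 1})"
    by (simp only: disk_bundle_def topspace_subtopology)
  then show ?thesis
    unfolding disk_bundle_def by (subst subtopology_restrict[symmetric]) (rule compact_space_subtopology)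
qed

text \<open>The map \<open>to_cube\<close> written without choosing \<open>u\<close>. The
  denominator uses only lengths of fibre vectors, and the result \<open>s u\<close> is insensitive
  to the sign of \<open>u\<close>, so continuity needs no local sections.\<close>

definition cube_vector :: "nat \<Rightarrow> lambda2_sum \<Rightarrow> nat \<Rightarrow> real^3" where
  "cube_vector n z i = (1 / (1 - L2_set (\<lambda>i. norm (snd (snd z i))) {..<n} + max_abs n (\<lambda>i. norm (snd (snd z i)))))
     *\<^sub>R snd (snd z i)"

lemma cube_vector_bundle_point:
  assumes "norm u = 1" "i < n"
  shows "cube_vector n (bundle_point n u t) i = to_cube n t i *\<^sub>R u"
proof -
  have n: "norm (snd (snd (bundle_point n u t) i)) = \<bar>t i\<bar>" if "i < n" for i
    using that assms by (simp add: bundle_point_def)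
  have "L2_set (\<lambda>i. norm (snd (snd (bundle_point n u t) i))) {..<n} = L2_set t {..<n}"
    by (subst (2) L2_set_abs[symmetric], intro L2_set_cong) (auto simp: n)
  moreover have "max_abs n (\<lambda>i. norm (snd (snd (bundle_point n u t) i))) = max_abs n t"
    using n by (intro max_abs_cong) simp
  ultimately show ?thesis
    using assms(2) by (simp add: cube_vector_def to_cube_def) (simp add: bundle_point_def)
qed

lemma continuous_map_cube_vector:
  assumes "i < n"
  shows "continuous_map (disk_bundle n) euclidean (\<lambda>z. cube_vector n z i)"
proof -
  have v: "continuous_map (disk_bundle n) euclidean (\<lambda>z. snd (snd z i))" if "i < n" for i
  proof -
    have 1: "continuous_map (prod_topology RP2 (product_topology (\<lambda>_. tautological_bundle) {..<n})) tautological_bundle (\<lambda>z. snd z i)"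
      using that continuous_map_compose[OF continuous_map_snd
          continuous_map_product_projection[of i "{..<n}" "\<lambda>_. tautological_bundle"]] by (simp add: o_def)
    have 2: "continuous_map tautological_bundle euclidean snd"
      unfolding tautological_bundle_def by (intro continuous_map_from_subtopology continuous_map_snd)
    show ?thesis
      unfolding disk_bundle_def n_lambda2_def whitney_power_def
      using continuous_map_compose[OF 1 2] by (intro continuous_map_from_subtopology) (simp add: o_def)
  qed
  have "1 - L2_set (\<lambda>i. norm (snd (snd z i))) {..<n} + max_abs n (\<lambda>i. norm (snd (snd z i))) \<noteq> 0"
    if "z \<in> topspace (disk_bundle n)" for z
  proof -
    have "L2_set (\<lambda>i. norm (snd (snd z i))) {..<n} \<le> 1"
      using that by (auto simp: disk_bundle_def n_lambda2_norm_def case_prod_beta)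
    then show ?thesis using to_cube_denominator_pos by fastforce
  qed
  then show ?thesis
    unfolding cube_vector_def
    by (intro continuous_map_scaleR v assms continuous_intros continuous_map_L2_set continuous_map_max_abs)
      auto
qed

text \<open>The orthogonal projection onto the line. As \<open>outer\<close> is even, it does not
  matter which of the two unit vectors is chosen.\<close>

definition line_projection :: "(real^3) set \<Rightarrow> real^3^3" where
  "line_projection l = outer (SOME u. u \<in> l)"

lemma line_projection_pair: "line_projection {u, - u} = outer u"
proof -
  have "(SOME v. v \<in> {u, - u}) \<in> {u, - u}" by (rule someI_ex) auto
  then show ?thesis by (auto simp: line_projection_def outer_def)
qed

lemma continuous_map_line_projection: "continuous_map RP2 euclidean line_projection"
  unfolding projective_space_def
proof (rule continuous_map_identification_topology)
  show "continuous_map (top_of_set (sphere 0 1)) euclidean (line_projection \<circ> (\<lambda>x. {x, - x}))"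
    using continuous_on_outer by (simp add: o_def line_projection_pair)
qed simp

section \<open>Commuting tuples in SU(2)\<close>

lemma topspace_B_space:
  "topspace (B_space n G K) = {x \<in> PiE {..<n} (\<lambda>_. carrier G). \<forall>i<n. \<forall>j<n. commutator G (x i) (x j) \<in> K}"
  by (auto simp: B_space_def)

lemma continuous_map_into_B_space:
  assumes "\<And>i. i < n \<Longrightarrow> continuous_map Y euclidean (\<lambda>y. f y i)"
    "\<And>y. y \<in> topspace Y \<Longrightarrow> f y \<in> topspace (B_space n G K)"
  shows "continuous_map Y (B_space n G K) f"
  unfolding B_space_def continuous_map_in_subtopology continuous_map_componentwise
proof (intro conjI ballI)
  show "f ` topspace Y \<subseteq> extensional {..<n}"
    using assms(2) by (auto simp: topspace_B_space PiE_def)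
  show "continuous_map Y euclidean (\<lambda>x. f x i)" if "i \<in> {..<n}" for i
    using that assms(1) by auto
  show "(\<lambda>x. f x i) \<in> topspace Y \<rightarrow> carrier G" if "i \<in> {..<n}" for i
    using that assms(2) by (fastforce simp: topspace_B_space PiE_def)
  show "f \<in> topspace Y \<rightarrow> {x. \<forall>i<n. \<forall>j<n. commutator G (x i) (x j) \<in> K}"
    using assms(2) by (auto simp: topspace_B_space)
qed

text \<open>The tuple space is regular as a subspace of a product of metrizable spaces, and the
  collapsed set is closed as a finite union of coordinate conditions.\<close>

lemma Hausdorff_space_B_quotient:
  fixes G :: "'a::metric_space monoid"
  shows "Hausdorff_space (collapse (B_space n G K) (S1_set n G K))"
proof (rule Hausdorff_space_collapse)
  show "Hausdorff_space (B_space n G K)"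
    unfolding B_space_def
    by (simp add: Hausdorff_space_subtopology Hausdorff_space_product_topology)
  show "regular_space (B_space n G K)"
    unfolding B_space_def
    by (simp add: regular_space_subtopology regular_space_product_topology regular_space_euclidean)
  have "closedin (B_space n G K) {x \<in> topspace (B_space n G K). x i \<in> {\<one>\<^bsub>G\<^esub>}}" if "i < n" for i
  proof (rule closedin_continuous_map_preimage[where Y=euclidean])
    show "continuous_map (B_space n G K) euclidean (\<lambda>x. x i)"
      unfolding B_space_def
      using that continuous_map_product_projection[of i "{..<n}" "\<lambda>_. top_of_set (carrier G)"]
      by (intro continuous_map_from_subtopology) (auto intro: continuous_map_into_fulltopology)
  qed simp
  then have "closedin (B_space n G K) (\<Union>i<n. {x \<in> topspace (B_space n G K). x i \<in> {\<one>\<^bsub>G\<^esub>}})"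
    by (intro closedin_Union) auto
  moreover have "(\<Union>i<n. {x \<in> topspace (B_space n G K). x i \<in> {\<one>\<^bsub>G\<^esub>}}) = S1_set n G K"
    by (auto simp: S1_set_def)
  ultimately show "closedin (B_space n G K) (S1_set n G K)" by simp
qed

lemma bij_betw_collapse_map:
  assumes "bij_betw f S T" "T \<inter> A = {}"
  shows "bij_betw (collapse_map A \<circ> f) S (Some ` T)"
proof -
  have "bij_betw (collapse_map A) T (Some ` T)"
    using assms(2) by (auto simp: bij_betw_def inj_on_def collapse_map_def image_iff)
  then show ?thesis using assms(1) bij_betw_trans by blast
qed

lemma one_SU2 [simp]: "\<one>\<^bsub>SU2\<^esub> = mat 1" and one_SO3 [simp]: "\<one>\<^bsub>SO3\<^esub> = mat 1"
  by (simp_all add: SU2_def SO3_def)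

lemma umat_eq_one [simp]: "umat p = mat 1 \<longleftrightarrow> p = (1, 0)" "umat p = - mat 1 \<longleftrightarrow> p = (-1, 0)"
proof -
  show "umat p = mat 1 \<longleftrightarrow> p = (1, 0)" by (simp only: umat_eq_iff flip: umat_one)
  have "- mat 1 = umat (-1, 0)" using umat_minus[of "(1, 0)"] by (simp add: umat_one)
  then show "umat p = - mat 1 \<longleftrightarrow> p = (-1, 0)" by (simp only: umat_eq_iff)
qed

lemma cross3_unit_eq_0:
  assumes "norm u = 1" "cross3 u y = 0"
  shows "y = (u \<bullet> y) *\<^sub>R u"
proof -
  have "cross3 u (cross3 u y) = (u \<bullet> y) *\<^sub>R u - (u \<bullet> u) *\<^sub>R y" by (rule Lagrange)
  then show ?thesis using assms by (simp add: norm_eq_1)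
qed

lemma unit_scaleR_eq:
  assumes "norm u = 1" "norm v = 1" "a *\<^sub>R u = b *\<^sub>R v" "a \<noteq> 0"
  shows "v = u \<or> v = - (u :: 'a::real_normed_vector)"
proof -
  have "\<bar>a\<bar> = \<bar>b\<bar>" using arg_cong[OF assms(3), of norm] assms(1,2) by simp
  then have "b = a \<or> b = - a" by auto
  then show ?thesis using assms(3,4) by (auto simp flip: scaleR_minus_right)
qed

lemma to_ball_cong:
  assumes "\<And>j. j < n \<Longrightarrow> \<bar>t j\<bar> = \<bar>t' j\<bar>" "t i = c * t' i"
  shows "to_ball n t i = c * to_ball n t' i"
proof -
  have "L2_set t {..<n} = L2_set t' {..<n}"
    using assms(1) by (subst (1 2) L2_set_abs[symmetric], intro L2_set_cong) auto
  moreover have "max_abs n t = max_abs n t'" using assms(1) by (rule max_abs_cong)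
  ultimately show ?thesis using assms(2) by (simp add: to_ball_def)
qed

text \<open>The group elements reveal cube coordinates, whereas points of the bundle have ball
  coordinates. The inverse \<open>to_ball\<close> is odd, so a common sign \<open>c\<close> passes
  back through it.\<close>

lemma bundle_point_eqI:
  assumes "norm u = 1" "L2_set t {..<n} \<le> 1" "L2_set t' {..<n} \<le> 1"
    "c = 1 \<or> c = -1" "v = c *\<^sub>R u" "\<And>i. i < n \<Longrightarrow> to_cube n t' i = c * to_cube n t i"
  shows "bundle_point n u t = bundle_point n v t'"
proof -
  have "t' i = c * t i" if "i < n" for i
  proof -
    have "to_ball n (to_cube n t') i = c * to_ball n (to_cube n t) i"
      using assms(4,6) that by (intro to_ball_cong) auto
    then show ?thesis using assms(2,3) by (simp add: max_abs_to_cube)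
  qed
  then show ?thesis
    using assms bundle_point_eq_iff[of u v n t t'] by auto
qed

lemma max_abs_less_1_iff: "max_abs n s < 1 \<longleftrightarrow> (\<forall>i<n. \<bar>s i\<bar> < 1)"
  by (induction n) (auto simp: less_Suc_eq)

lemma L2_set_less_1_iff:
  assumes "L2_set t {..<n} \<le> 1"
  shows "L2_set t {..<n} < 1 \<longleftrightarrow> (\<forall>i<n. \<bar>to_cube n t i\<bar> < 1)"
proof -
  have "L2_set t {..<n} < 1 \<longleftrightarrow> max_abs n (to_cube n t) < 1"
    using max_abs_to_cube(1,2)[OF assms] assms by (simp add: less_le)
  then show ?thesis by (simp only: max_abs_less_1_iff)
qed

lemma to_cube_le_1:
  assumes "L2_set t {..<n} \<le> 1" "i < n"
  shows "\<bar>to_cube n t i\<bar> \<le> 1"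
  using max_abs_to_cube(1)[OF assms(1)] abs_le_max_abs[OF assms(2), of "to_cube n t"] by linarith

lemma to_cube_attains_1:
  assumes "L2_set t {..<n} = 1"
  shows "\<exists>i<n. \<bar>to_cube n t i\<bar> = 1"
  using max_abs_to_cube(2)[of t n] max_abs_attained[of n "to_cube n t"] assms by auto

lemma bundle_point_from_cube:
  assumes "\<And>i. i < n \<Longrightarrow> \<bar>s i\<bar> < 1"
  obtains t where "L2_set t {..<n} < 1" "\<And>i. i < n \<Longrightarrow> to_cube n t i = s i"
proof
  have s: "max_abs n s \<le> 1" using assms by (intro max_abs_le) (auto intro: less_imp_le)
  show "to_cube n (to_ball n s) i = s i" for i using L2_set_to_ball[OF s] by simp
  then show "L2_set (to_ball n s) {..<n} < 1"
    using L2_set_less_1_iff[OF L2_set_to_ball(1)[OF s]] assms by simp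
qed

text \<open>The square of the unit quaternion \<open>(s, sqrt (1 - s\<^sup>2) u)\<close>, as a function of \<open>w = s u\<close>. It maps the
  open unit ball onto the unit quaternions other than 1, with \<open>0\<close> going to \<open>-1\<close>.\<close>

definition ball_quaternion :: "real^3 \<Rightarrow> quaternion" where
  "ball_quaternion w = (2 * (w \<bullet> w) - 1, (2 * sqrt (1 - w \<bullet> w)) *\<^sub>R w)"

lemma continuous_on_ball_quaternion: "continuous_on S ball_quaternion"
  unfolding ball_quaternion_def by (intro continuous_intros)

lemma inner_le_1: "norm w \<le> 1 \<Longrightarrow> w \<bullet> w \<le> 1" "norm w < 1 \<Longrightarrow> w \<bullet> w < 1"
  by (simp_all add: norm_le_square norm_lt_square)

lemma norm_ball_quaternion:
  assumes "norm w \<le> 1"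
  shows "norm (ball_quaternion w) = 1"
  using inner_le_1(1)[OF assms]
  by (simp add: norm_quaternion ball_quaternion_def power2_eq_square algebra_simps)

lemma ball_quaternion_eq_minus_1: "ball_quaternion w = (-1, 0) \<longleftrightarrow> w = 0"
  by (auto simp: ball_quaternion_def)

lemma ball_quaternion_eq_1: "norm w \<le> 1 \<Longrightarrow> ball_quaternion w = (1, 0) \<longleftrightarrow> norm w = 1"
  by (auto simp: ball_quaternion_def norm_eq_1)

text \<open>Equal real parts give equal lengths, hence equal square root factors, and the factor is
  nonzero inside the open ball.\<close>

lemma ball_quaternion_inj:
  assumes "norm w < 1" "ball_quaternion w = ball_quaternion w'"
  shows "w = w'"
proof -
  have "w \<bullet> w = w' \<bullet> w'" "(2 * sqrt (1 - w \<bullet> w)) *\<^sub>R w = (2 * sqrt (1 - w' \<bullet> w')) *\<^sub>R w'"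
    using assms(2) by (auto simp: ball_quaternion_def)
  then show ?thesis using inner_le_1(2)[OF assms(1)] by simp
qed

lemma ball_quaternion_surj:
  assumes "norm u = 1" "norm (a, c *\<^sub>R u) = 1" "(a, c *\<^sub>R u) \<noteq> (1, 0)"
  obtains s where "\<bar>s\<bar> < 1" "ball_quaternion (s *\<^sub>R u) = (a, c *\<^sub>R u)"
proof -
  have u: "u \<bullet> u = 1" using assms(1) by (simp add: norm_eq_1)
  have ac: "a\<^sup>2 + c\<^sup>2 = 1" using assms(2) u by (simp add: norm_quaternion power2_eq_square)
  have "a \<noteq> 1" using ac assms(3) by auto
  moreover have "a\<^sup>2 \<le> 1" using ac zero_le_power2[of c] by linarith
  then have "a \<le> 1" by (simp add: abs_square_le_1)
  ultimately have a: "a < 1" by simp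
  \<comment> \<open>For a quaternion with real part \<open>a = 2 s^2 - 1\<close> and imaginary
    coefficient \<open>c = 2 s sqrt (1 - s^2)\<close>, this \<open>r\<close> is
    \<open>sqrt (1 - s^2)\<close>. It is nonzero because \<open>a < 1\<close>, so \<open>s\<close>
    can be solved for.\<close>
  define r where "r = sqrt ((1 - a) / 2)"
  have r: "r > 0" "r\<^sup>2 = (1 - a) / 2" using a by (simp_all add: r_def)
  define s where "s = c / (2 * r)"
  have "s\<^sup>2 = c\<^sup>2 / (4 * r\<^sup>2)" by (simp add: s_def power_divide power_mult_distrib)
  also have "\<dots> = (1 - a\<^sup>2) / (2 * (1 - a))"
  proof -
    have "c\<^sup>2 = 1 - a\<^sup>2" "4 * r\<^sup>2 = 2 * (1 - a)" using ac by (simp_all add: r)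
    then show ?thesis by (simp only:)
  qed
  also have "\<dots> = (1 + a) / 2" using a by (simp add: field_simps power2_eq_square)
  finally have s2: "s\<^sup>2 = (1 + a) / 2" .
  then have "s\<^sup>2 < 1" using a by simp
  then have "\<bar>s\<bar> < 1" by (simp add: abs_square_less_1)
  moreover have "1 - s\<^sup>2 = r\<^sup>2" using s2 r by (simp add: field_simps)
  then have "sqrt (1 - s * s) = r" using r by (simp add: power2_eq_square real_sqrt_unique)
  then have "ball_quaternion (s *\<^sub>R u) = (a, c *\<^sub>R u)"
    using s2 r u by (simp add: ball_quaternion_def power2_eq_square) (simp add: s_def)
  ultimately show ?thesis using that by blast
qed

section \<open>The disk summand for SU(2)\<close>

definition commuting :: "nat \<Rightarrow> (nat \<Rightarrow> complex^2^2) \<Rightarrow> bool" where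
  "commuting n x \<longleftrightarrow> (\<forall>i<n. \<forall>j<n. commutator SU2 (x i) (x j) = mat 1)"

definition SU2_disk_map :: "nat \<Rightarrow> lambda2_sum \<Rightarrow> nat \<Rightarrow> complex^2^2" where
  "SU2_disk_map n z = (\<lambda>i\<in>{..<n}. umat (ball_quaternion (cube_vector n z i)))"

lemma SU2_disk_map_bundle_point:
  assumes "norm u = 1"
  shows "SU2_disk_map n (bundle_point n u t) = (\<lambda>i\<in>{..<n}. umat (ball_quaternion (to_cube n t i *\<^sub>R u)))"
  using assms by (auto simp: SU2_disk_map_def cube_vector_bundle_point)

lemma commutator_ball_quaternion:
  assumes "norm u = 1" "\<bar>a\<bar> \<le> 1" "\<bar>b\<bar> \<le> 1"
  shows "commutator SU2 (umat (ball_quaternion (a *\<^sub>R u))) (umat (ball_quaternion (b *\<^sub>R u))) = mat 1"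
  using assms
  by (simp add: commutator_SU2 norm_ball_quaternion qmul_commute_iff)
    (simp add: ball_quaternion_def Cross3.cross_mult_left Cross3.cross_mult_right)

lemma SU2_disk_map_in:
  assumes "mat 1 \<in> K" "z \<in> topspace (disk_bundle n)"
  shows "SU2_disk_map n z \<in> topspace (B_space n SU2 K)" "commuting n (SU2_disk_map n z)"
proof -
  obtain u t where ut: "z = bundle_point n u t" "norm u = 1" "L2_set t {..<n} \<le> 1"
    using assms(2) by (auto simp: topspace_disk_bundle)
  show "commuting n (SU2_disk_map n z)"
    using ut to_cube_le_1[OF ut(3)]
    by (simp add: commuting_def SU2_disk_map_bundle_point commutator_ball_quaternion)
  then show "SU2_disk_map n z \<in> topspace (B_space n SU2 K)"
    using ut to_cube_le_1[OF ut(3)] assms(1)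
    by (auto simp: topspace_B_space commuting_def SU2_disk_map_bundle_point carrier_SU2 norm_ball_quaternion)
qed

lemma continuous_map_SU2_disk_map:
  assumes "mat 1 \<in> K"
  shows "continuous_map (disk_bundle n) (B_space n SU2 K) (SU2_disk_map n)"
proof (rule continuous_map_into_B_space)
  fix i assume i: "i < n"
  have "continuous_map (disk_bundle n) euclidean (\<lambda>z. umat (ball_quaternion (cube_vector n z i)))"
    by (intro continuous_map_compose_continuous_on[where h = umat]
        continuous_map_compose_continuous_on[where h = ball_quaternion]
        continuous_map_cube_vector i continuous_on_umat continuous_on_ball_quaternion)
  then show "continuous_map (disk_bundle n) euclidean (\<lambda>z. SU2_disk_map n z i)"
    using i by (simp add: SU2_disk_map_def)
qed (use SU2_disk_map_in assms in blast)

text \<open>An entry other than 1 and \<open>-1\<close> determines its axis up to sign, and the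
  entries that commute with it lie on the same axis. Removing the zero section on one side and the
  constant tuple \<open>-1\<close> on the other leaves exactly the tuples that have such an
  entry.\<close>

lemma SU2_disk_map_bij:
  "bij_betw (SU2_disk_map n) {bundle_point n u t |u t. norm u = 1 \<and> L2_set t {..<n} < 1 \<and> (\<exists>i<n. t i \<noteq> 0)}
     {x \<in> PiE {..<n} (\<lambda>_. carrier SU2). commuting n x \<and> (\<forall>i<n. x i \<noteq> mat 1) \<and> (\<exists>i<n. x i \<noteq> - mat 1)}"
    (is "bij_betw _ ?D ?T")
  unfolding bij_betw_def
proof
  have nz: "to_cube n t i \<noteq> 0" if "t i \<noteq> 0" "L2_set t {..<n} < 1" for t i
    using that to_cube_denominator_pos[of t n] by (auto simp: to_cube_def)
  show "inj_on (SU2_disk_map n) ?D"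
  proof (rule inj_onI)
    fix z z' assume "z \<in> ?D" "z' \<in> ?D" and eq: "SU2_disk_map n z = SU2_disk_map n z'"
    then obtain u t v t' k where z: "z = bundle_point n u t" "norm u = 1" "L2_set t {..<n} < 1"
      and k: "k < n" "t k \<noteq> 0"
      and z': "z' = bundle_point n v t'" "norm v = 1" "L2_set t' {..<n} < 1"
      by auto
    have s: "to_cube n t i *\<^sub>R u = to_cube n t' i *\<^sub>R v" if "i < n" for i
    proof (rule ball_quaternion_inj)
      show "norm (to_cube n t i *\<^sub>R u) < 1" using z that L2_set_less_1_iff[of t n] by simp
      show "ball_quaternion (to_cube n t i *\<^sub>R u) = ball_quaternion (to_cube n t' i *\<^sub>R v)"
        using fun_cong[OF eq, of i] that z z' by (simp add: SU2_disk_map_bundle_point umat_eq_iff)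
    qed
    obtain c where c: "c = 1 \<or> c = -1" "v = c *\<^sub>R u"
    proof (cases "v = u")
      case False
      then have "v = -u" using unit_scaleR_eq[OF z(2) z'(2) s[OF k(1)] nz[of t k, OF k(2) z(3)]] by blast
      then show ?thesis using that[of "-1"] by simp
    qed (use that[of 1] in simp)
    have "to_cube n t' i = c * to_cube n t i" if "i < n" for i
    proof -
      have "u \<noteq> 0" using z(2) by auto
      then have "to_cube n t i = c * to_cube n t' i" using s[OF that] c by (auto simp flip: scaleR_minus_left)
      then show ?thesis using c(1) by auto
    qed
    then show "z = z'" unfolding z(1) z'(1)
      using z z' c by (intro bundle_point_eqI[of u t n t' c v]) auto
  qed
  show "SU2_disk_map n ` ?D = ?T"
  proof (intro equalityI subsetI)
    fix x assume "x \<in> SU2_disk_map n ` ?D"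
    then obtain u t k where x: "x = SU2_disk_map n (bundle_point n u t)" and u: "norm u = 1" "L2_set t {..<n} < 1"
      and k: "k < n" "t k \<noteq> 0"
      by auto
    have "bundle_point n u t \<in> topspace (disk_bundle n)"
      using u less_imp_le unfolding topspace_disk_bundle by blast
    then have "x \<in> topspace (B_space n SU2 {mat 1})" "commuting n x"
      unfolding x using SU2_disk_map_in[of "{mat 1}"] by auto
    moreover have "x i \<noteq> mat 1" if "i < n" for i
    proof -
      have "\<bar>to_cube n t i\<bar> < 1" using that u L2_set_less_1_iff[of t n] by simp
      then show ?thesis using that u by (simp add: x SU2_disk_map_bundle_point ball_quaternion_eq_1)
    qed
    moreover have "x k \<noteq> - mat 1"
      using k u nz[of t k] by (auto simp: x SU2_disk_map_bundle_point ball_quaternion_eq_minus_1)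
    ultimately show "x \<in> ?T" using k by (auto simp: topspace_B_space)
  next
    fix x assume x: "x \<in> ?T"
    have "\<exists>p. norm p = 1 \<and> x i = umat p" if "i < n" for i
    proof -
      have "x i \<in> carrier SU2" using x that by auto
      then show ?thesis unfolding carrier_SU2 by (metis (lifting) imageE mem_sphere_0)
    qed
    then obtain p where p: "\<And>i. i < n \<Longrightarrow> norm (p i) = 1" "\<And>i. i < n \<Longrightarrow> x i = umat (p i)"
      by metis
    have com: "cross3 (snd (p i)) (snd (p j)) = 0" if "i < n" "j < n" for i j
      using x that p by (simp add: commuting_def commutator_SU2 qmul_commute_iff)
    obtain k where k: "k < n" "x k \<noteq> - mat 1" using x by auto
    have "x k \<noteq> mat 1" using x k by auto
    then have "snd (p k) \<noteq> 0"
      using k p(1)[OF k(1)] unfolding p(2)[OF k(1)]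
      by (auto simp: norm_quaternion prod_eq_iff power2_eq_1_iff)
    \<comment> \<open>The common axis is the direction of the imaginary part of \<open>p k\<close>,
      nonzero because this entry is neither 1 nor \<open>-1\<close>; the commuting relations make
      every other imaginary part parallel to it.\<close>
    define u where "u = snd (p k) /\<^sub>R norm (snd (p k))"
    have u: "norm u = 1" using \<open>snd (p k) \<noteq> 0\<close> by (simp add: u_def)
    have "\<exists>s. \<bar>s\<bar> < 1 \<and> ball_quaternion (s *\<^sub>R u) = p i" if "i < n" for i
    proof -
      have "cross3 u (snd (p i)) = 0" using com[OF k(1) that] by (simp add: u_def Cross3.cross_mult_left)
      then have "snd (p i) = (u \<bullet> snd (p i)) *\<^sub>R u" by (rule cross3_unit_eq_0[OF u])
      then have eq: "p i = (fst (p i), (u \<bullet> snd (p i)) *\<^sub>R u)" by (simp add: prod_eq_iff)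
      moreover have "p i \<noteq> (1, 0)" using x that p(2)[OF that] by auto
      ultimately show ?thesis using ball_quaternion_surj[OF u] p(1)[OF that] by metis
    qed
    then obtain s where s: "\<And>i. i < n \<Longrightarrow> \<bar>s i\<bar> < 1" "\<And>i. i < n \<Longrightarrow> ball_quaternion (s i *\<^sub>R u) = p i"
      by metis
    obtain t where t: "L2_set t {..<n} < 1" "\<And>i. i < n \<Longrightarrow> to_cube n t i = s i"
      using bundle_point_from_cube s(1) by blast
    have "x = SU2_disk_map n (bundle_point n u t)"
      using x p(2) s(2) t(2) by (auto simp: SU2_disk_map_bundle_point[OF u] fun_eq_iff PiE_def extensional_def)
    moreover have "t k \<noteq> 0"
    proof
      assume "t k = 0"
      then have "s k = 0" using t(2)[OF k(1)] by (simp add: to_cube_def)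
      then have "p k = (-1, 0)" using s(2)[OF k(1)] by (simp add: ball_quaternion_def)
      then show False using k p(2) by simp
    qed
    ultimately show "x \<in> SU2_disk_map n ` ?D" using u t k by blast
  qed
qed

lemma L2_set_bundle_point:
  assumes "bundle_point n u t = bundle_point n v s" "norm u = 1" "norm v = 1"
  shows "L2_set t {..<n} = L2_set s {..<n}"
  using arg_cong[OF assms(1), of "n_lambda2_norm n"] assms(2,3) by (simp add: n_lambda2_norm_bundle_point)

lemma disk_bundle_interior:
  "topspace (disk_bundle n) - {bundle_point n u t |u t. norm u = 1 \<and> L2_set t {..<n} = 1}
    = {bundle_point n u t |u t. norm u = 1 \<and> L2_set t {..<n} < 1}" (is "_ - ?S = ?I")
proof (intro equalityI subsetI)
  fix z assume z: "z \<in> topspace (disk_bundle n) - ?S"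
  then obtain u t where ut: "z = bundle_point n u t" "norm u = 1" "L2_set t {..<n} \<le> 1"
    by (auto simp: topspace_disk_bundle)
  then have "L2_set t {..<n} \<noteq> 1" using z by blast
  then show "z \<in> ?I" using ut by (auto simp: less_le)
next
  fix z assume "z \<in> ?I"
  then obtain u t where ut: "z = bundle_point n u t" "norm u = 1" "L2_set t {..<n} < 1"
    by blast
  have "z \<notin> ?S"
  proof
    assume "z \<in> ?S"
    then obtain v s where "z = bundle_point n v s" "norm v = 1" "L2_set s {..<n} = 1" by blast
    then show False using L2_set_bundle_point[of n u t v s] ut by simp
  qed
  moreover have "z \<in> topspace (disk_bundle n)"
    using ut less_imp_le unfolding topspace_disk_bundle by blast
  ultimately show "z \<in> topspace (disk_bundle n) - ?S" by blast
qed

lemma insert_None_diff: "insert None (Some ` P) - Some ` Q - {None} = Some ` (P - Q)"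
  by auto

text \<open>On the sphere bundle some cube coordinate has modulus 1, so the image has an entry 1 and
  goes to the basepoint. The zero section goes to the constant tuple \<open>?m\<close>, the one
  commuting tuple that \<open>SU2_disk_map_bij\<close> omits.\<close>

lemma covers_SU2_disk:
  assumes "mat 1 \<in> K" "n \<ge> 1"
  shows "\<exists>f. covers (Thom_mod_zero n) (Some None) (collapse (B_space n SU2 K) (S1_set n SU2 K)) None f
    (Some ` {x \<in> topspace (B_space n SU2 K) - S1_set n SU2 K. commuting n x})"
proof -
  let ?X = "B_space n SU2 K" and ?A = "S1_set n SU2 K"
  let ?S = "{bundle_point n u t |u t. norm u = 1 \<and> L2_set t {..<n} = 1}"
  let ?B = "Some ` zero_section n ` topspace RP2"
  let ?m = "\<lambda>i\<in>{..<n}. - mat 1 :: complex^2^2"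
  let ?D = "{bundle_point n u t |u t. norm u = 1 \<and> L2_set t {..<n} < 1 \<and> (\<exists>i<n. t i \<noteq> 0)}"
  let ?T = "{x \<in> PiE {..<n} (\<lambda>_. carrier SU2). commuting n x \<and> (\<forall>i<n. x i \<noteq> mat 1) \<and> (\<exists>i<n. x i \<noteq> - mat 1)}"
  define f where "f = case_option None (collapse_map ?A \<circ> SU2_disk_map n)"
  have zero: "SU2_disk_map n (zero_section n l) = ?m" if l: "l \<in> topspace RP2" for l
  proof -
    obtain u where "norm u = 1" "l = {u, - u}" using l by (auto simp: topspace_projective_space)
    moreover have "umat (ball_quaternion 0) = - mat 1" by (simp add: ball_quaternion_eq_minus_1)
    ultimately show ?thesis
      by (auto simp: zero_section_eq SU2_disk_map_bundle_point to_cube_def)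
  qed
  have zeroD: "zero_section n l \<in> topspace (disk_bundle n) - ?S" if l: "l \<in> topspace RP2" for l
  proof -
    obtain u where u: "norm u = 1" "l = {u, - u}" using l by (auto simp: topspace_projective_space)
    have "bundle_point n u (\<lambda>_. 0) \<noteq> bundle_point n v t" if "norm v = 1" "L2_set t {..<n} = 1" for v t
    proof
      assume "bundle_point n u (\<lambda>_. 0) = bundle_point n v t"
      then have "\<forall>i\<in>{..<n}. t i = 0" using bundle_point_eq_iff u that by auto
      then have "L2_set t {..<n} = 0" by (rule L2_set_0')
      then show False using that by simp
    qed
    moreover have "L2_set (\<lambda>_. 0 :: real) {..<n} \<le> 1" by (simp add: L2_set_0')
    ultimately show ?thesis using u by (auto simp: zero_section_eq topspace_disk_bundle)
  qed
  have m: "?m \<in> topspace ?X - ?A" "commuting n ?m"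
  proof -
    \<comment> \<open>Any point of the zero section has value \<open>?m\<close>, so
      \<open>?m\<close> inherits membership and commutation from the disk map.\<close>
    have "(axis 1 1 :: real^3) \<in> sphere 0 1" by (simp add: norm_axis_1)
    then obtain l where l: "l \<in> topspace RP2" unfolding topspace_projective_space by blast
    then show "commuting n ?m" "?m \<in> topspace ?X - ?A"
      using SU2_disk_map_in[OF assms(1), of "zero_section n l" n] zeroD[OF l] zero[OF l]
      by (auto simp: S1_set_def mat2_eq_iff mat_def)
  qed
  have TX: "insert ?m ?T = {x \<in> topspace ?X - ?A. commuting n x}"
  proof (intro equalityI subsetI)
    fix x assume "x \<in> insert ?m ?T"
    then show "x \<in> {x \<in> topspace ?X - ?A. commuting n x}"
    proof
      assume "x \<in> ?T"
      then show ?thesis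
        using assms(1) by (auto simp: topspace_B_space S1_set_def commuting_def)
    qed (use m in simp)
  next
    fix x assume "x \<in> {x \<in> topspace ?X - ?A. commuting n x}"
    moreover have "x = ?m" if "x \<in> topspace ?X" "\<And>i. i < n \<Longrightarrow> x i = - mat 1"
      using that by (auto simp: topspace_B_space PiE_def extensional_def fun_eq_iff)
    ultimately show "x \<in> insert ?m ?T"
      by (auto simp: topspace_B_space S1_set_def)
  qed
  have TA: "?T \<inter> ?A = {}" by (auto simp: S1_set_def)
  have mT: "?m \<notin> ?T" by auto
  have cont: "continuous_map (Thom_n_lambda2 n) (collapse ?X ?A) f"
    unfolding f_def Thom_n_lambda2_eq
  proof (rule continuous_map_from_collapse)
    show "continuous_map (disk_bundle n) (collapse ?X ?A) (collapse_map ?A \<circ> SU2_disk_map n)"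
      using continuous_map_compose continuous_map_SU2_disk_map[OF assms(1)] continuous_map_collapse_map by blast
    fix z assume z: "z \<in> topspace (disk_bundle n) \<inter> ?S"
    then obtain u t where ut: "z = bundle_point n u t" "norm u = 1" "L2_set t {..<n} = 1" by auto
    obtain i where i: "i < n" "\<bar>to_cube n t i\<bar> = 1" using to_cube_attains_1[OF ut(3)] by blast
    then have "SU2_disk_map n z i = mat 1"
      using ut by (simp add: SU2_disk_map_bundle_point ball_quaternion_eq_1)
    then have "SU2_disk_map n z \<in> ?A"
      using SU2_disk_map_in(1)[OF assms(1)] z i by (auto simp: S1_set_def)
    then show "(collapse_map ?A \<circ> SU2_disk_map n) z = None" by (simp add: collapse_map_def)
  qed (simp add: topspace_collapse)
  have topT: "topspace (Thom_n_lambda2 n) = insert None (Some ` (topspace (disk_bundle n) - ?S))"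
    by (simp add: Thom_n_lambda2_eq topspace_collapse)
  have DD: "topspace (Thom_n_lambda2 n) - ?B - {None} = Some ` ?D"
  proof -
    have "topspace (disk_bundle n) - ?S - zero_section n ` topspace RP2 = ?D"
      unfolding disk_bundle_interior
    proof (intro equalityI subsetI)
      fix z assume z: "z \<in> {bundle_point n u t |u t. norm u = 1 \<and> L2_set t {..<n} < 1} - zero_section n ` topspace RP2"
      then obtain u t where ut: "z = bundle_point n u t" "norm u = 1" "L2_set t {..<n} < 1"
        by blast
      have "\<exists>i<n. t i \<noteq> 0"
      proof (rule ccontr)
        assume "\<not> (\<exists>i<n. t i \<noteq> 0)"
        then have "z = zero_section n {u, - u}"
          using ut by (simp add: zero_section_eq bundle_point_eq_iff)
        then show False using z ut by (auto simp: topspace_projective_space)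
      qed
      then show "z \<in> ?D" using ut by blast
    next
      fix z assume "z \<in> ?D"
      then obtain u t k where ut: "z = bundle_point n u t" "norm u = 1" "L2_set t {..<n} < 1" "k < n" "t k \<noteq> 0"
        by blast
      then have "z \<notin> zero_section n ` topspace RP2"
        by (auto simp: topspace_projective_space zero_section_eq bundle_point_eq_iff)
      then show "z \<in> {bundle_point n u t |u t. norm u = 1 \<and> L2_set t {..<n} < 1} - zero_section n ` topspace RP2"
        using ut by blast
    qed
    then show ?thesis unfolding topT insert_None_diff by simp
  qed
  have bij: "bij_betw f (topspace (Thom_n_lambda2 n) - ?B - {None}) (Some ` ?T)"
    using bij_betw_collapse_map[OF SU2_disk_map_bij TA]
    unfolding DD f_def by (auto simp: bij_betw_def inj_on_def image_image)
  have "covers (Thom_mod_zero n) (Some None) (collapse ?X ?A) None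
      (case_option (Some ?m) f) (insert (Some ?m) (Some ` ?T))"
    unfolding Thom_mod_zero_def
  proof (rule covers_collapse_away[OF _ cont _ _ _ _ bij])
    show "compact_space (Thom_n_lambda2 n)"
      by (simp add: Thom_n_lambda2_eq compact_space_collapse compact_space_disk_bundle)
    show "Some ?m \<in> topspace (collapse ?X ?A)" using m by (auto simp: topspace_collapse)
    show "f x = Some ?m" if "x \<in> topspace (Thom_n_lambda2 n) \<inter> ?B" for x
      using that zero m by (auto simp: f_def collapse_map_def)
  qed (use mT in \<open>auto simp: topT f_def\<close>)
  then show ?thesis unfolding TX[symmetric] by auto
qed

section \<open>Coaxial tuples in SO(3)\<close>

definition axis_quaternion :: "real \<Rightarrow> real^3 \<Rightarrow> quaternion" where
  "axis_quaternion s u = (s, sqrt (1 - s\<^sup>2) *\<^sub>R u)"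

text \<open>The rotation \<open>rotm (axis_quaternion s u)\<close> in terms of \<open>P = outer u\<close> and \<open>w = s u\<close>, which depend
  only on the line through \<open>u\<close> and on a point of that line.\<close>

definition line_rotation :: "real^3^3 \<Rightarrow> real^3 \<Rightarrow> real^3^3" where
  "line_rotation P w = (2 * (w \<bullet> w) - 1) *\<^sub>R mat 1 + (2 * (1 - w \<bullet> w)) *\<^sub>R P
     + (2 * sqrt (1 - w \<bullet> w)) *\<^sub>R matrix (cross3 w)"

lemma norm_axis_quaternion:
  "norm u = 1 \<Longrightarrow> \<bar>s\<bar> \<le> 1 \<Longrightarrow> norm (axis_quaternion s u) = 1"
  by (simp add: norm_quaternion axis_quaternion_def norm_eq_1 abs_square_le_1)

lemma line_rotation_eq:
  assumes "norm u = 1" "\<bar>s\<bar> \<le> 1"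
  shows "line_rotation (outer u) (s *\<^sub>R u) = rotm (axis_quaternion s u)"
proof -
  have u: "u \<bullet> u = 1" using assms(1) by (simp add: norm_eq_1)
  have s: "sqrt (1 - s\<^sup>2) * sqrt (1 - s\<^sup>2) = 1 - s\<^sup>2" using assms(2) by (simp add: abs_square_le_1)
  have 1: "outer (c *\<^sub>R u) = (c * c) *\<^sub>R outer u" "matrix (cross3 (c *\<^sub>R u)) = c *\<^sub>R matrix (cross3 u)" for c
    by (auto simp: outer_def matrix_def vec_eq_iff Cross3.cross_mult_left)
  show ?thesis
    unfolding line_rotation_def rotm_def axis_quaternion_def fst_conv snd_conv 1
    using s u by (simp add: power2_eq_square mult.assoc)
qed

text \<open>Pairing the equation with \<open>u\<close> gives equality in the Cauchy-Schwarz
  inequality for \<open>u\<close> and the imaginary part, so the two are parallel.\<close>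

lemma rotm_fixed_vector:
  assumes "norm p = 1" "rotm p *v u = u" "norm u = 1"
  shows "snd p = (u \<bullet> snd p) *\<^sub>R u"
proof -
  have u: "u \<bullet> u = 1" using assms(3) by (simp add: norm_eq_1)
  have "(rotm p *v u) \<bullet> u = (fst p)\<^sup>2 - snd p \<bullet> snd p + 2 * (snd p \<bullet> u)\<^sup>2"
    unfolding rotm_vector_mult
    by (simp add: inner_add_left u dot_cross_self power2_eq_square)
  then have "(u \<bullet> snd p)\<^sup>2 = snd p \<bullet> snd p"
    using assms(1,2) u by (simp add: norm_quaternion inner_commute)
  then have "(norm (cross3 u (snd p)))\<^sup>2 = 0"
    using norm_cross_dot[of u "snd p"] assms(3) by (simp add: power2_norm_eq_inner)
  then have "cross3 u (snd p) = 0" by simp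
  then show ?thesis by (rule cross3_unit_eq_0[OF assms(3)])
qed

lemma rotm_fixes_axis:
  assumes "norm p = 1" "snd p = c *\<^sub>R u"
  shows "rotm p *v u = u"
proof -
  have "rotm p *v u = ((fst p)\<^sup>2 + snd p \<bullet> snd p) *\<^sub>R u"
    unfolding rotm_vector_mult assms(2)
    by (simp add: Cross3.cross_mult_left power2_eq_square flip: scaleR_add_left)
  then show ?thesis using assms(1) by (simp add: norm_quaternion)
qed

lemma rotm_axis_quaternion_surj:
  assumes "norm u = 1" "norm p = 1" "rotm p *v u = u" "rotm p \<noteq> mat 1"
  obtains s where "\<bar>s\<bar> < 1" "rotm (axis_quaternion s u) = rotm p"
proof -
  have u: "u \<bullet> u = 1" using assms(1) by (simp add: norm_eq_1)
  define c where "c = u \<bullet> snd p"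
  have sp: "snd p = c *\<^sub>R u" using rotm_fixed_vector assms c_def by blast
  have ac: "(fst p)\<^sup>2 + c\<^sup>2 = 1" using assms(2) u by (simp add: norm_quaternion sp power2_eq_square)
  have "c \<noteq> 0"
  proof
    assume "c = 0"
    then have "p = (1, 0) \<or> p = - (1, 0)" using ac sp by (auto simp: prod_eq_iff power2_eq_1_iff)
    then show False using assms(4) rotm_one rotm_minus by metis
  qed
  then have "c\<^sup>2 > 0" by simp
  then have "(fst p)\<^sup>2 < 1" using ac by linarith
  then have a: "\<bar>fst p\<bar> < 1" by (simp add: abs_square_less_1)
  have r: "sqrt (1 - (fst p)\<^sup>2) = \<bar>c\<bar>" using ac by (metis add_diff_cancel_left' real_sqrt_abs)
  \<comment> \<open>An \<open>axis_quaternion\<close> has a nonnegative multiple of \<open>u\<close>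
    as imaginary part; this selects one of the lifts \<open>p\<close> and \<open>-p\<close>.\<close>
  consider "c > 0" | "c < 0" using \<open>c \<noteq> 0\<close> by linarith
  then show ?thesis
  proof cases
    case 1
    then have "axis_quaternion (fst p) u = p" using r sp by (simp add: axis_quaternion_def prod_eq_iff)
    then show ?thesis using that[of "fst p"] a by simp
  next
    case 2
    then have "axis_quaternion (- fst p) u = - p" using r sp by (simp add: axis_quaternion_def prod_eq_iff)
    then show ?thesis using that[of "- fst p"] a by (simp add: rotm_minus)
  qed
qed

text \<open>For \<open>s\<close> of modulus below 1 the imaginary part is nonzero, so each lift
  exhibits its axis; the two possible lifts account for the two cases.\<close>

lemma rotm_axis_quaternion_inj:
  assumes "norm u = 1" "norm v = 1" "\<bar>s\<bar> < 1" "\<bar>s'\<bar> < 1"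
    "rotm (axis_quaternion s u) = rotm (axis_quaternion s' v)"
  shows "v = u \<and> s' = s \<or> v = - u \<and> s' = - s"
proof -
  have "axis_quaternion s u = axis_quaternion s' v \<or> axis_quaternion s u = - axis_quaternion s' v"
    using assms rotm_eq_iff norm_axis_quaternion by (metis less_imp_le)
  moreover have "sqrt (1 - s\<^sup>2) \<noteq> 0" using assms(3) abs_square_less_1[of s] by auto
  ultimately show ?thesis
    by (auto simp: axis_quaternion_def simp flip: scaleR_minus_right)
qed

lemma rotm_axis_quaternion_eq_one:
  assumes "norm u = 1" "\<bar>s\<bar> \<le> 1"
  shows "rotm (axis_quaternion s u) = mat 1 \<longleftrightarrow> \<bar>s\<bar> = 1"
proof -
  have "u \<noteq> 0" using assms(1) by auto
  have "rotm (axis_quaternion s u) = mat 1 \<longleftrightarrow> axis_quaternion s u = (1, 0) \<or> axis_quaternion s u = - (1, 0)"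
    using rotm_eq_iff[of "axis_quaternion s u" "(1, 0)"] norm_axis_quaternion[OF assms] by (simp add: norm_quaternion)
  also have "\<dots> \<longleftrightarrow> s = 1 \<or> s = -1" using \<open>u \<noteq> 0\<close> by (auto simp: axis_quaternion_def)
  also have "\<dots> \<longleftrightarrow> \<bar>s\<bar> = 1" by auto
  finally show ?thesis .
qed

text \<open>Commutation cannot split the SO(3) tuples, since half-turns about orthogonal axes
  commute without sharing an axis.\<close>

definition coaxial :: "nat \<Rightarrow> (nat \<Rightarrow> real^3^3) \<Rightarrow> bool" where
  "coaxial n x \<longleftrightarrow> (\<exists>u. norm u = 1 \<and> (\<forall>i<n. x i *v u = u))"

definition SO3_disk_map :: "nat \<Rightarrow> lambda2_sum \<Rightarrow> nat \<Rightarrow> real^3^3" where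
  "SO3_disk_map n z = (\<lambda>i\<in>{..<n}. line_rotation (line_projection (fst z)) (cube_vector n z i))"

lemma SO3_disk_map_bundle_point:
  assumes "norm u = 1" "L2_set t {..<n} \<le> 1"
  shows "SO3_disk_map n (bundle_point n u t) = (\<lambda>i\<in>{..<n}. rotm (axis_quaternion (to_cube n t i) u))"
proof -
  have "line_projection (fst (bundle_point n u t)) = outer u"
    by (simp add: bundle_point_def line_projection_pair)
  then show ?thesis
    using assms to_cube_le_1[OF assms(2)]
    by (auto simp: SO3_disk_map_def cube_vector_bundle_point line_rotation_eq)
qed

lemma SO3_disk_map_in:
  assumes "z \<in> topspace (disk_bundle n)"
  shows "SO3_disk_map n z \<in> topspace (Hom_space n SO3)" "coaxial n (SO3_disk_map n z)"
proof -
  obtain u t where ut: "z = bundle_point n u t" "norm u = 1" "L2_set t {..<n} \<le> 1"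
    using assms by (auto simp: topspace_disk_bundle)
  let ?p = "\<lambda>i. axis_quaternion (to_cube n t i) u"
  have p: "norm (?p i) = 1" if "i < n" for i
    using ut to_cube_le_1[OF ut(3)] that by (intro norm_axis_quaternion)
  have "commutator SO3 (rotm (?p i)) (rotm (?p j)) = mat 1" if "i < n" "j < n" for i j
    unfolding commutator_SO3[OF p[OF that(1)] p[OF that(2)]] qmul_commute_iff
    by (simp add: axis_quaternion_def Cross3.cross_mult_left Cross3.cross_mult_right)
  then show "SO3_disk_map n z \<in> topspace (Hom_space n SO3)"
    using ut p by (auto simp: topspace_B_space SO3_disk_map_bundle_point carrier_SO3)
  have "rotm (?p i) *v u = u" if "i < n" for i
    using rotm_fixes_axis[OF p[OF that]] by (simp add: axis_quaternion_def)
  then show "coaxial n (SO3_disk_map n z)"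
    using ut by (auto simp: coaxial_def SO3_disk_map_bundle_point)
qed

lemma continuous_map_SO3_disk_map:
  "continuous_map (disk_bundle n) (Hom_space n SO3) (SO3_disk_map n)"
proof (rule continuous_map_into_B_space)
  fix i assume i: "i < n"
  have P: "continuous_map (disk_bundle n) euclidean (\<lambda>z. line_projection (fst z))"
    unfolding disk_bundle_def n_lambda2_def whitney_power_def
    using continuous_map_compose[OF continuous_map_fst continuous_map_line_projection]
    by (intro continuous_map_from_subtopology) (simp add: o_def)
  have h: "continuous_on UNIV (\<lambda>(P, w). line_rotation P w)"
    unfolding line_rotation_def case_prod_beta
    by (intro continuous_intros continuous_on_compose2[OF continuous_on_matrix_cross3[of UNIV]]) auto
  have "continuous_map (disk_bundle n) euclidean (\<lambda>z. (line_projection (fst z), cube_vector n z i))"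
    using continuous_map_pairedI[OF P continuous_map_cube_vector[OF i]] by simp
  from continuous_map_compose_continuous_on[OF this h]
  show "continuous_map (disk_bundle n) euclidean (\<lambda>z. SO3_disk_map n z i)"
    using i by (simp add: SO3_disk_map_def)
qed (use SO3_disk_map_in in blast)

text \<open>Every nontrivial rotation determines its axis, including the half-turn at the centre of
  a fibre. In contrast to SU(2), the zero section therefore stays in the domain.\<close>

lemma SO3_disk_map_bij:
  assumes "n \<ge> 1"
  shows "bij_betw (SO3_disk_map n) {bundle_point n u t |u t. norm u = 1 \<and> L2_set t {..<n} < 1}
     {x \<in> topspace (Hom_space n SO3) - Hom_S1_set n SO3. coaxial n x}"
    (is "bij_betw _ ?D ?T")
  unfolding bij_betw_def
proof
  have F: "SO3_disk_map n (bundle_point n u t) i = rotm (axis_quaternion (to_cube n t i) u)"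
    if "norm u = 1" "L2_set t {..<n} < 1" "i < n" for u t i
    using that by (simp add: SO3_disk_map_bundle_point)
  have less: "\<bar>to_cube n t i\<bar> < 1" if "L2_set t {..<n} < 1" "i < n" for t i
    using that L2_set_less_1_iff[of t n] by simp
  show "inj_on (SO3_disk_map n) ?D"
  proof (rule inj_onI)
    fix z z' assume "z \<in> ?D" "z' \<in> ?D" and eq: "SO3_disk_map n z = SO3_disk_map n z'"
    then obtain u t v t' where z: "z = bundle_point n u t" "norm u = 1" "L2_set t {..<n} < 1"
      and z': "z' = bundle_point n v t'" "norm v = 1" "L2_set t' {..<n} < 1"
      by blast
    have *: "v = u \<and> to_cube n t' i = to_cube n t i \<or> v = - u \<and> to_cube n t' i = - to_cube n t i" if "i < n" for i
      using fun_cong[OF eq, of i] F z z' that less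
      by (intro rotm_axis_quaternion_inj) auto
    have "u \<noteq> - u"
    proof
      assume "u = - u"
      then have "u \<bullet> u = - (u \<bullet> u)" by (metis inner_minus_left)
      then show False using z(2) by (simp add: norm_eq_1)
    qed
    obtain c where c: "c = 1 \<or> c = -1" "v = c *\<^sub>R u"
    proof (cases "v = u")
      case False
      \<comment> \<open>Here \<open>n \<ge> 1\<close> provides an entry from which the axis can be
        read.\<close>
      then have "v = -u" using *[of 0] assms by auto
      then show ?thesis using that[of "-1"] by simp
    qed (use that[of 1] in simp)
    have "to_cube n t' i = c * to_cube n t i" if "i < n" for i
      using *[OF that] c \<open>u \<noteq> - u\<close> by auto
    then show "z = z'" unfolding z(1) z'(1)
      using z z' c by (intro bundle_point_eqI[of u t n t' c v]) auto
  qed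
  show "SO3_disk_map n ` ?D = ?T"
  proof (intro equalityI subsetI)
    fix x assume "x \<in> SO3_disk_map n ` ?D"
    then obtain u t where x: "x = SO3_disk_map n (bundle_point n u t)" and u: "norm u = 1" "L2_set t {..<n} < 1"
      by auto
    have "bundle_point n u t \<in> topspace (disk_bundle n)"
      using u less_imp_le unfolding topspace_disk_bundle by blast
    then have "x \<in> topspace (Hom_space n SO3)" "coaxial n x"
      unfolding x using SO3_disk_map_in by auto
    moreover have "x i \<noteq> mat 1" if "i < n" for i
      using less[OF u(2) that] u that F by (simp add: x rotm_axis_quaternion_eq_one)
    ultimately show "x \<in> ?T" by (auto simp: S1_set_def)
  next
    fix x assume x: "x \<in> ?T"
    then obtain u where u: "norm u = 1" "\<And>i. i < n \<Longrightarrow> x i *v u = u"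
      by (auto simp: coaxial_def)
    have "\<exists>s. \<bar>s\<bar> < 1 \<and> rotm (axis_quaternion s u) = x i" if "i < n" for i
    proof -
      have "x i \<in> carrier SO3" using x that by (auto simp: topspace_B_space)
      then obtain p where p: "norm p = 1" "x i = rotm p" unfolding carrier_SO3 by auto
      moreover have "x i \<noteq> mat 1" using x that by (auto simp: S1_set_def)
      ultimately show ?thesis
        using rotm_axis_quaternion_surj[OF u(1) p(1)] u(2)[OF that] by metis
    qed
    then obtain s where s: "\<And>i. i < n \<Longrightarrow> \<bar>s i\<bar> < 1" "\<And>i. i < n \<Longrightarrow> rotm (axis_quaternion (s i) u) = x i"
      by metis
    obtain t where t: "L2_set t {..<n} < 1" "\<And>i. i < n \<Longrightarrow> to_cube n t i = s i"
      using bundle_point_from_cube s(1) by blast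
    have "x = SO3_disk_map n (bundle_point n u t)"
    proof
      fix i
      show "x i = SO3_disk_map n (bundle_point n u t) i"
      proof (cases "i < n")
        case True then show ?thesis using F[OF u(1) t(1)] s(2) t(2) by simp
      next
        case False
        then show ?thesis using x by (auto simp: topspace_B_space PiE_def extensional_def SO3_disk_map_def)
      qed
    qed
    then show "x \<in> SO3_disk_map n ` ?D" using u t by blast
  qed
qed

lemma covers_SO3_disk:
  assumes "n \<ge> 1"
  shows "\<exists>f. covers (Thom_n_lambda2 n) None (collapse (Hom_space n SO3) (Hom_S1_set n SO3)) None f
    (Some ` {x \<in> topspace (Hom_space n SO3) - Hom_S1_set n SO3. coaxial n x})"
proof -
  let ?X = "Hom_space n SO3" and ?A = "Hom_S1_set n SO3"
  let ?S = "{bundle_point n u t |u t. norm u = 1 \<and> L2_set t {..<n} = 1}"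
  have "covers (Thom_n_lambda2 n) None (collapse ?X ?A) None (case_option None (collapse_map ?A \<circ> SO3_disk_map n))
    (Some ` {x \<in> topspace ?X - ?A. coaxial n x})"
    unfolding Thom_n_lambda2_eq
  proof (rule covers_collapse[OF compact_space_disk_bundle])
    show "continuous_map (disk_bundle n) (collapse ?X ?A) (collapse_map ?A \<circ> SO3_disk_map n)"
      using continuous_map_compose continuous_map_SO3_disk_map continuous_map_collapse_map by blast
    show "bij_betw (collapse_map ?A \<circ> SO3_disk_map n) (topspace (disk_bundle n) - ?S)
        (Some ` {x \<in> topspace ?X - ?A. coaxial n x})"
      unfolding disk_bundle_interior
      by (rule bij_betw_collapse_map[OF SO3_disk_map_bij[OF assms]]) auto
    fix z assume z: "z \<in> topspace (disk_bundle n) \<inter> ?S"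
    then obtain u t where ut: "z = bundle_point n u t" "norm u = 1" "L2_set t {..<n} = 1" by auto
    obtain i where i: "i < n" "\<bar>to_cube n t i\<bar> = 1" using to_cube_attains_1[OF ut(3)] by blast
    then have "SO3_disk_map n z i = mat 1"
      using ut by (simp add: SO3_disk_map_bundle_point rotm_axis_quaternion_eq_one)
    then have "SO3_disk_map n z \<in> ?A"
      using SO3_disk_map_in(1) z i by (auto simp: S1_set_def)
    then show "(collapse_map ?A \<circ> SO3_disk_map n) z = None" by (simp add: collapse_map_def)
  qed (simp_all add: topspace_collapse image_iff)
  then show ?thesis by blast
qed

section \<open>Noncommuting tuples in SU(2)\<close>

text \<open>The central element \<open>-1\<close> for \<open>y = 0\<close>, and the purely imaginary quaternion \<open>y\<close> for a unit vector
  \<open>y\<close>.\<close>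

definition pure_quaternion :: "real^3 \<Rightarrow> quaternion" where
  "pure_quaternion y = (y \<bullet> y - 1, y)"

lemma pure_quaternion_eq_iff [simp]: "pure_quaternion y = pure_quaternion y' \<longleftrightarrow> y = y'"
  by (auto simp: pure_quaternion_def)

lemma pure_quaternion_neq_1: "pure_quaternion y \<noteq> (1, 0)"
  by (auto simp: pure_quaternion_def)

lemma norm_pure_quaternion: "y = 0 \<or> norm y = 1 \<Longrightarrow> norm (pure_quaternion y) = 1"
  by (auto simp: norm_quaternion pure_quaternion_def norm_eq_1)

lemma continuous_on_pure_quaternion: "continuous_on S pure_quaternion"
  unfolding pure_quaternion_def by (intro continuous_intros)

lemma qmul_pure_quaternion:
  assumes "y = 0 \<or> norm y = 1" "y' = 0 \<or> norm y' = 1"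
  shows "y' = y \<or> y' = - y \<Longrightarrow> qmul (pure_quaternion y) (pure_quaternion y') = qmul (pure_quaternion y') (pure_quaternion y)"
    "y \<bullet> y' = 0 \<Longrightarrow> qmul (pure_quaternion y) (pure_quaternion y') = qmul (pure_quaternion y') (pure_quaternion y)
      \<or> qmul (pure_quaternion y) (pure_quaternion y') = - qmul (pure_quaternion y') (pure_quaternion y)"
proof -
  show "y' = y \<or> y' = - y \<Longrightarrow> qmul (pure_quaternion y) (pure_quaternion y') = qmul (pure_quaternion y') (pure_quaternion y)"
    by (auto simp: qmul_commute_iff pure_quaternion_def)
  assume 0: "y \<bullet> y' = 0"
  show "qmul (pure_quaternion y) (pure_quaternion y') = qmul (pure_quaternion y') (pure_quaternion y)
      \<or> qmul (pure_quaternion y) (pure_quaternion y') = - qmul (pure_quaternion y') (pure_quaternion y)"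
  proof (cases "y = 0 \<or> y' = 0")
    case True
    then show ?thesis by (auto simp: qmul_commute_iff pure_quaternion_def)
  next
    case False
    then have "norm y = 1" "norm y' = 1" using assms by auto
    then show ?thesis
      using 0 assms qmul_anticommute_iff[of "pure_quaternion y" "pure_quaternion y'"] norm_pure_quaternion
      by (simp add: pure_quaternion_def norm_eq_1)
  qed
qed

text \<open>The entries \<open>k\<close> and \<open>l\<close> are orthogonal imaginary units. An
  entry with nonzero real part cannot anticommute with anything, so it commutes with both; its
  imaginary part is then parallel to two orthogonal vectors and vanishes, and the entry is
  \<open>-1\<close>. All entries are thus pure in the sense of
  \<open>pure_quaternion\<close>.\<close>

lemma noncommuting_quaternions:
  assumes p: "\<And>i. i < n \<Longrightarrow> norm (p i) = 1" "\<And>i. i < n \<Longrightarrow> p i \<noteq> (1, 0)"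
    and com: "\<And>i j. i < n \<Longrightarrow> j < n \<Longrightarrow> qmul (p i) (p j) = qmul (p j) (p i) \<or> qmul (p i) (p j) = - qmul (p j) (p i)"
    and k: "k < n" "l < n" "qmul (p k) (p l) \<noteq> qmul (p l) (p k)"
  obtains M c where "rotation_matrix M" "c \<in> words signed_letters n 2"
    "\<And>i. i < n \<Longrightarrow> p i = pure_quaternion (M *v c i)"
proof -
  define y where "y i = snd (p i)" for i
  have com': "cross3 (y i) (y j) = 0 \<or> fst (p i) = 0 \<and> fst (p j) = 0 \<and> y i \<bullet> y j = 0" if "i < n" "j < n" for i j
    using com[OF that] p(1)[OF that(1)] p(1)[OF that(2)]
    by (auto simp: qmul_commute_iff qmul_anticommute_iff y_def)
  have kl: "fst (p k) = 0" "fst (p l) = 0" "y k \<bullet> y l = 0"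
    using com'[OF k(1,2)] k by (auto simp: qmul_commute_iff y_def)
  then have n: "norm (y k) = 1" "norm (y l) = 1"
    using p(1)[OF k(1)] p(1)[OF k(2)] by (auto simp: norm_quaternion y_def norm_eq_1)
  have pure: "p i = pure_quaternion (y i) \<and> (y i = 0 \<or> norm (y i) = 1)" if i: "i < n" for i
  proof (cases "fst (p i) = 0")
    case True
    then have "norm (y i) = 1" using p(1)[OF i] by (simp add: norm_quaternion y_def norm_eq_1)
    then show ?thesis using True by (simp add: pure_quaternion_def prod_eq_iff y_def norm_eq_1)
  next
    case False
    then have "cross3 (y k) (y i) = 0" "cross3 (y l) (y i) = 0"
      using com'[OF k(1) i] com'[OF k(2) i] by auto
    then have *: "y i = (y k \<bullet> y i) *\<^sub>R y k" "y i = (y l \<bullet> y i) *\<^sub>R y l"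
      using cross3_unit_eq_0 n by blast+
    have "y l \<bullet> y i = 0" by (subst *(1)) (simp add: kl(3) inner_commute)
    then have "y i = 0" using *(2) by simp
    moreover from this have "fst (p i) = -1"
      using p[OF i] by (auto simp: norm_quaternion y_def prod_eq_iff power2_eq_1_iff)
    ultimately show ?thesis by (simp add: pure_quaternion_def prod_eq_iff y_def)
  qed
  have rel: "y i = y j \<or> y i = - y j \<or> y i \<bullet> y j = 0" if ij: "i < n" "j < n" for i j
  proof (cases "y i = 0 \<or> y j = 0 \<or> y i \<bullet> y j = 0")
    case False
    then have "cross3 (y i) (y j) = 0" "norm (y i) = 1" "norm (y j) = 1"
      using com'[OF ij] pure ij by auto
    then have "y j = (y i \<bullet> y j) *\<^sub>R y i" by (intro cross3_unit_eq_0)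
    then show ?thesis
      using unit_scaleR_eq[of "y j" "y i" 1 "y i \<bullet> y j"] \<open>norm (y i) = 1\<close> \<open>norm (y j) = 1\<close> by auto
  qed auto
  have "\<exists>M s c. rotation_matrix M \<and> s \<le> 2 \<and> c \<in> words signed_letters n s \<and> (\<forall>i<n. y i = M *v c i)"
    by (rule signed_words_exhaust) (use pure rel in auto)
  then obtain M s c where M: "rotation_matrix M" "s \<le> 2" "c \<in> words signed_letters n s" "\<And>i. i < n \<Longrightarrow> y i = M *v c i"
    by blast
  \<comment> \<open>At a lower state all vectors lie on one line and the entries \<open>k\<close>
    and \<open>l\<close> would commute.\<close>
  have "s = 2"
  proof (rule ccontr)
    assume "s \<noteq> 2"
    then have "c i \<in> {0, e1, - e1}" for i
      using words_signed_letters[OF M(3,2), of i] M(2) by (auto simp: signed_letters_def le_2_cases)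
    then have "c k = 0 \<or> c k = e1 \<or> c k = - e1" "c l = 0 \<or> c l = e1 \<or> c l = - e1" by auto
    then have "cross3 (y k) (y l) = 0"
      unfolding M(4)[OF k(1)] M(4)[OF k(2)] by (auto simp: rotation_matrix_minus_vector)
    then show False using k(3) by (simp add: qmul_commute_iff y_def)
  qed
  then show ?thesis using that M pure by auto
qed

lemma signed_word_relations:
  assumes M: "rotation_matrix M" and c: "c \<in> words signed_letters n s" "s \<le> 2"
  shows "M *v c i = 0 \<or> norm (M *v c i) = 1"
    "(M *v c j = M *v c i \<or> M *v c j = - (M *v c i)) \<or> (M *v c i) \<bullet> (M *v c j) = 0"
proof -
  have *: "c i \<in> {0, e1, - e1, e2, - e2, e3, - e3}" for i
    using words_signed_letters[OF c, of i] by (auto simp: signed_letters_def split: if_splits)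
  show "M *v c i = 0 \<or> norm (M *v c i) = 1"
    using *[of i] by (auto simp: rotation_matrix_norm[OF M] norm_axis_1)
  have "c j = c i \<or> c j = - c i \<or> c i \<bullet> c j = 0"
    using *[of i] *[of j] by (auto simp: inner_axis_axis)
  then show "(M *v c j = M *v c i \<or> M *v c j = - (M *v c i)) \<or> (M *v c i) \<bullet> (M *v c j) = 0"
    by (auto simp: rotation_matrix_inner[OF M] rotation_matrix_minus_vector)
qed

lemma word_axes:
  assumes "c \<in> words A n 2"
  obtains k l where "k < n" "l < n" "c k = e1" "c l = e2"
  using words_frame[OF assms, of 1] words_frame[OF assms, of 2] by (auto simp: frame_def)

lemma rotation_matrix_eqI:
  assumes "rotation_matrix M" "rotation_matrix N" "M *v e1 = N *v e1" "M *v e2 = N *v e2"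
  shows "M = N"
proof -
  have "M *v e3 = cross3 (M *v e1) (M *v e2)" "N *v e3 = cross3 (N *v e1) (N *v e2)"
    using cross_rotation_matrix[of M e1 e2] cross_rotation_matrix[of N e1 e2] assms by (simp_all add: cross_basis)
  then have 3: "M *v e3 = N *v e3" using assms by simp
  have x: "x = (x $ 1) *\<^sub>R e1 + (x $ 2) *\<^sub>R e2 + (x $ 3) *\<^sub>R e3" for x :: "real^3"
    by (simp add: vec_eq_iff forall_3 axis_def)
  have "M *v x = N *v x" for x
    by (subst (1 2) x) (simp only: matrix_vector_right_distrib matrix_vector_mult_scaleR assms 3)
  then show ?thesis by (simp add: matrix_eq)
qed

lemma rotation_matrix_transpose_mult:
  assumes "rotation_matrix (M :: real^3^3)"
  shows "transpose M *v (M *v x) = x" "rotation_matrix (transpose M)"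
  using assms by (simp_all add: rotation_matrix_def orthogonal_matrix_def matrix_vector_mul_assoc det_transpose del: transpose_matrix_vector)

section \<open>Projective 3-space as the rotation group\<close>

definition quaternion_of_vec :: "real^4 \<Rightarrow> quaternion" where
  "quaternion_of_vec p = (p $ 1, vector [p $ 2, p $ 3, p $ 4])"

definition vec_of_quaternion :: "quaternion \<Rightarrow> real^4" where
  "vec_of_quaternion q = vector [fst q, snd q $ 1, snd q $ 2, snd q $ 3]"

lemma vector_4:
  "(vector [a, b, c, d] :: 'a::zero^4) $ 1 = a" "(vector [a, b, c, d] :: 'a^4) $ 2 = b"
  "(vector [a, b, c, d] :: 'a^4) $ 3 = c" "(vector [a, b, c, d] :: 'a^4) $ 4 = d"
  by (simp_all add: vector_def)

lemma quaternion_of_vec_inverse [simp]: "vec_of_quaternion (quaternion_of_vec p) = p"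
  by (simp add: quaternion_of_vec_def vec_of_quaternion_def vec_eq_iff forall_4 vector_3 vector_4)

lemma vec_of_quaternion_inverse [simp]: "quaternion_of_vec (vec_of_quaternion q) = q"
  by (simp add: quaternion_of_vec_def vec_of_quaternion_def prod_eq_iff vec_eq_iff forall_3 vector_3 vector_4)

lemma norm_quaternion_of_vec [simp]: "norm (quaternion_of_vec p) = norm p"
  by (simp add: quaternion_of_vec_def norm_prod_def power2_norm_eq_inner)
    (simp add: norm_eq_sqrt_inner inner_vec_def sum_3 sum_4 vector_3 power2_eq_square)

lemma norm_vec_of_quaternion [simp]: "norm (vec_of_quaternion q) = norm q"
  using norm_quaternion_of_vec[of "vec_of_quaternion q"] by simp

lemma quaternion_of_vec_minus [simp]: "quaternion_of_vec (- p) = - quaternion_of_vec p"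
  by (simp add: quaternion_of_vec_def prod_eq_iff vec_eq_iff forall_3 vector_3)

lemma quaternion_of_vec_eq_iff [simp]: "quaternion_of_vec p = quaternion_of_vec q \<longleftrightarrow> p = q"
  by (metis quaternion_of_vec_inverse)

lemma continuous_on_quaternion_of_vec: "continuous_on S quaternion_of_vec"
proof -
  have "\<forall>i. continuous_on S (\<lambda>p :: real^4. (vector [p $ 2, p $ 3, p $ 4] :: real^3) $ i)"
    by (simp add: forall_3 vector_3 continuous_intros)
  then have "continuous_on S (\<lambda>p :: real^4. \<chi> i. (vector [p $ 2, p $ 3, p $ 4] :: real^3) $ i)"
    by (intro continuous_on_vec_lambda) blast
  then show ?thesis
    unfolding quaternion_of_vec_def by (intro continuous_on_Pair continuous_intros) simp
qed

text \<open>The choice of representative is harmless because \<open>rotm\<close> is even.\<close>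

definition RP3_rotation :: "(real^4) set \<Rightarrow> real^3^3" where
  "RP3_rotation l = rotm (quaternion_of_vec (SOME p. p \<in> l))"

lemma RP3_rotation_pair: "RP3_rotation {p, - p} = rotm (quaternion_of_vec p)"
proof -
  have "(SOME q. q \<in> {p, - p}) \<in> {p, - p}" by (rule someI_ex) auto
  then show ?thesis by (auto simp: RP3_rotation_def rotm_minus)
qed

lemma RP3_rotation_bij: "bij_betw RP3_rotation (topspace RP3) (carrier SO3)"
  unfolding bij_betw_def
proof
  show "inj_on RP3_rotation (topspace RP3)"
    by (auto simp: inj_on_def topspace_projective_space RP3_rotation_pair rotm_eq_iff
        simp flip: quaternion_of_vec_minus)
  have "carrier SO3 \<subseteq> RP3_rotation ` topspace RP3"
  proof
    fix x assume "x \<in> carrier SO3"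
    then obtain q where q: "norm q = 1" "x = rotm q" unfolding carrier_SO3 by auto
    let ?p = "vec_of_quaternion q"
    have "{?p, - ?p} \<in> topspace RP3" using q by (auto simp: topspace_projective_space)
    moreover have "RP3_rotation {?p, - ?p} = x" using q by (simp add: RP3_rotation_pair)
    ultimately show "x \<in> RP3_rotation ` topspace RP3" by blast
  qed
  then show "RP3_rotation ` topspace RP3 = carrier SO3"
    by (auto simp: topspace_projective_space RP3_rotation_pair carrier_SO3)
qed

lemma continuous_map_RP3_rotation: "continuous_map RP3 euclidean RP3_rotation"
  unfolding projective_space_def
proof (rule continuous_map_identification_topology)
  show "continuous_map (top_of_set (sphere 0 1)) euclidean (RP3_rotation \<circ> (\<lambda>x. {x, - x}))"
    by (simp add: o_def RP3_rotation_pair)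
      (intro continuous_on_compose2[OF continuous_on_rotm[of UNIV] continuous_on_quaternion_of_vec] subset_UNIV)
qed simp

section \<open>Orbits of words in SU(2)\<close>

definition SU2_orbit_map :: "nat \<Rightarrow> (nat \<Rightarrow> real^3) \<Rightarrow> (real^4) set \<Rightarrow> nat \<Rightarrow> complex^2^2" where
  "SU2_orbit_map n c l = (\<lambda>i\<in>{..<n}. umat (pure_quaternion (RP3_rotation l *v c i)))"

lemma matrix_vector_continuous: "continuous_on S (\<lambda>M :: real^'n^'m. M *v x)"
  unfolding matrix_vector_mult_def by (intro continuous_intros)

lemma pm_one_iff: "x \<in> pm_one \<longleftrightarrow> x = mat 1 \<or> x = - mat 1"
  by (auto simp: pm_one_def)

lemma RP3_rotation_matrix: "l \<in> topspace RP3 \<Longrightarrow> rotation_matrix (RP3_rotation l)"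
  using RP3_rotation_bij by (auto simp: bij_betw_def SO3_def)

lemma SU2_orbit_map_in:
  assumes c: "c \<in> words signed_letters n 2" and l: "l \<in> topspace RP3"
  shows "SU2_orbit_map n c l \<in> {x \<in> topspace (B_space n SU2 pm_one) - S1_set n SU2 pm_one. \<not> commuting n x}"
proof -
  let ?y = "\<lambda>i. RP3_rotation l *v c i"
  note M = RP3_rotation_matrix[OF l]
  have y: "?y i = 0 \<or> norm (?y i) = 1" for i using signed_word_relations[OF M c] by simp
  have 1: "norm (pure_quaternion (?y i)) = 1" for i using norm_pure_quaternion[OF y] .
  have com: "commutator SU2 (umat (pure_quaternion (?y i))) (umat (pure_quaternion (?y j))) \<in> pm_one" for i j
    using qmul_pure_quaternion[OF y[of i] y[of j]] signed_word_relations(2)[OF M c order_refl, of j i]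
    unfolding pm_one_iff commutator_SU2[OF 1 1] by blast
  obtain k l' where k: "k < n" "l' < n" "c k = e1" "c l' = e2" using word_axes[OF c] .
  \<comment> \<open>The entries carrying \<open>e1\<close> and \<open>e2\<close> witness
    noncommutation: the cross product of their images is the image of \<open>e3\<close>, which is
    nonzero.\<close>
  have "cross3 (?y k) (?y l') = RP3_rotation l *v e3"
    using cross_rotation_matrix[OF M, of e1 e2] k by (simp add: cross_basis)
  moreover have "RP3_rotation l *v e3 \<noteq> 0"
    using rotation_matrix_norm[OF M, of e3] by (metis norm_axis_1 norm_zero zero_neq_one)
  ultimately have "commutator SU2 (umat (pure_quaternion (?y k))) (umat (pure_quaternion (?y l'))) \<noteq> mat 1"
    unfolding commutator_SU2[OF 1 1] qmul_commute_iff by (simp add: pure_quaternion_def)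
  then have "\<not> commuting n (SU2_orbit_map n c l)"
    using k(1,2) unfolding commuting_def SU2_orbit_map_def by auto
  moreover have "SU2_orbit_map n c l \<in> topspace (B_space n SU2 pm_one)"
    using com 1 by (auto simp: topspace_B_space SU2_orbit_map_def carrier_SU2)
  ultimately show ?thesis
    by (auto simp: S1_set_def SU2_orbit_map_def pure_quaternion_neq_1)
qed

text \<open>The quotient \<open>?N\<close> of the two rotations carries one word to the other, so
  rigidity identifies the words. Since \<open>e1\<close> and \<open>e2\<close> occur in the word,
  the two rotations then agree on a frame: the action is free.\<close>

lemma SU2_orbit_map_inj:
  assumes "c \<in> words signed_letters n 2" "c' \<in> words signed_letters n 2"
    "l \<in> topspace RP3" "l' \<in> topspace RP3" "SU2_orbit_map n c l = SU2_orbit_map n c' l'"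
  shows "c = c' \<and> l = l'"
proof -
  note M = RP3_rotation_matrix[OF assms(3)] and M' = RP3_rotation_matrix[OF assms(4)]
  let ?N = "transpose (RP3_rotation l') ** RP3_rotation l"
  have eq: "RP3_rotation l *v c i = RP3_rotation l' *v c' i" if "i < n" for i
    using fun_cong[OF assms(5), of i] that by (simp add: SU2_orbit_map_def umat_eq_iff)
  have N: "rotation_matrix ?N" using M M' rotation_matrix_transpose_mult(2) rotation_matrix_mul by blast
  have "?N *v c i = c' i" if "i < n" for i
    using eq[OF that] rotation_matrix_transpose_mult(1)[OF M'] by (simp flip: matrix_vector_mul_assoc del: transpose_matrix_vector)
  then have "c = c'"
    using signed_words_rigid[OF N assms(1,2)] by simp
  moreover obtain j k where "j < n" "k < n" "c j = e1" "c k = e2" using word_axes[OF assms(1)] .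
  then have "RP3_rotation l = RP3_rotation l'"
    using eq[of j] eq[of k] \<open>c = c'\<close> M M' by (intro rotation_matrix_eqI) auto
  then have "l = l'" using RP3_rotation_bij assms(3,4) by (auto simp: bij_betw_def inj_on_def)
  ultimately show ?thesis by simp
qed

lemma SU2_orbit_map_surj:
  assumes "x \<in> topspace (B_space n SU2 pm_one) - S1_set n SU2 pm_one" "\<not> commuting n x"
  obtains c l where "c \<in> words signed_letters n 2" "l \<in> topspace RP3" "x = SU2_orbit_map n c l"
proof -
  have "\<exists>p. norm p = 1 \<and> x i = umat p" if "i < n" for i
  proof -
    have "x i \<in> carrier SU2" using assms(1) that by (auto simp: topspace_B_space)
    then show ?thesis unfolding carrier_SU2 by (metis (lifting) imageE mem_sphere_0)
  qed
  then obtain p where p: "\<And>i. i < n \<Longrightarrow> norm (p i) = 1" "\<And>i. i < n \<Longrightarrow> x i = umat (p i)"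
    by metis
  have ne: "p i \<noteq> (1, 0)" if "i < n" for i
    using assms(1) p(2)[OF that] that by (auto simp: S1_set_def)
  have com: "qmul (p i) (p j) = qmul (p j) (p i) \<or> qmul (p i) (p j) = - qmul (p j) (p i)" if "i < n" "j < n" for i j
  proof -
    have "commutator SU2 (x i) (x j) \<in> pm_one" using assms(1) that by (auto simp: topspace_B_space)
    then show ?thesis
      unfolding pm_one_iff p(2)[OF that(1)] p(2)[OF that(2)] commutator_SU2[OF p(1)[OF that(1)] p(1)[OF that(2)]] .
  qed
  obtain k l where k: "k < n" "l < n" "commutator SU2 (x k) (x l) \<noteq> mat 1"
    using assms(2) by (auto simp: commuting_def)
  then have nc: "qmul (p k) (p l) \<noteq> qmul (p l) (p k)"
    unfolding p(2)[OF k(1)] p(2)[OF k(2)] commutator_SU2(1)[OF p(1)[OF k(1)] p(1)[OF k(2)]] by blast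
  obtain M c where M: "rotation_matrix M" "c \<in> words signed_letters n 2"
      "\<And>i. i < n \<Longrightarrow> p i = pure_quaternion (M *v c i)"
    using noncommuting_quaternions[of n p k l, OF p(1) ne com k(1,2) nc] by blast
  have "M \<in> RP3_rotation ` topspace RP3"
    using RP3_rotation_bij M(1) by (simp add: bij_betw_def SO3_def)
  then obtain l where l: "l \<in> topspace RP3" "RP3_rotation l = M" by blast
  have "x = SU2_orbit_map n c l"
    using assms(1) p M(3) l(2)
    by (auto simp: SU2_orbit_map_def fun_eq_iff topspace_B_space PiE_def extensional_def)
  then show ?thesis using that M(2) l(1) by blast
qed

lemma covers_SU2_orbits:
  "\<exists>f. covers (bouquet (K_num n) (add_basepoint RP3) None) None
    (collapse (B_space n SU2 pm_one) (S1_set n SU2 pm_one)) None f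
    (Some ` {x \<in> topspace (B_space n SU2 pm_one) - S1_set n SU2 pm_one. \<not> commuting n x})"
proof -
  let ?X = "B_space n SU2 pm_one" and ?A = "S1_set n SU2 pm_one"
  let ?W = "words signed_letters n 2"
  have "finite ?W" "card ?W = K_num n" using card_signed_words(1)[of n 2] card_signed_words(4)[of n] by auto
  \<comment> \<open>An enumeration of the words turns the family of orbits into a bouquet with
    exactly \<open>K_num n\<close> summands.\<close>
  then obtain h where h: "bij_betw h {..<K_num n} ?W"
    using ex_bij_betw_nat_finite[of ?W] by (auto simp: atLeast0LessThan)
  have hW: "h i \<in> ?W" if "i < K_num n" for i using h that by (auto simp: bij_betw_def)
  let ?S = "\<lambda>i. Some ` SU2_orbit_map n (h i) ` topspace RP3"
  have cov: "covers (add_basepoint RP3) None (collapse ?X ?A) None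
      (case_option None (collapse_map ?A \<circ> SU2_orbit_map n (h i))) (?S i)" if i: "i < K_num n" for i
  proof (rule covers_collapse[OF compact_space_projective_space])
    have "continuous_map RP3 euclidean (\<lambda>l. umat (pure_quaternion (RP3_rotation l *v h i j)))" for j
      by (intro continuous_map_compose_continuous_on[where h = umat]
          continuous_map_compose_continuous_on[where h = pure_quaternion]
          continuous_map_compose_continuous_on[where h = "\<lambda>M. M *v h i j"]
          continuous_map_RP3_rotation continuous_on_umat continuous_on_pure_quaternion matrix_vector_continuous)
    then have "continuous_map RP3 ?X (SU2_orbit_map n (h i))"
      using SU2_orbit_map_in[OF hW[OF i]]
      by (intro continuous_map_into_B_space) (auto simp: SU2_orbit_map_def)
    then show "continuous_map RP3 (collapse ?X ?A) (collapse_map ?A \<circ> SU2_orbit_map n (h i))"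
      using continuous_map_compose continuous_map_collapse_map by blast
    have "bij_betw (SU2_orbit_map n (h i)) (topspace RP3) (SU2_orbit_map n (h i) ` topspace RP3)"
      using SU2_orbit_map_inj[OF hW[OF i] hW[OF i]] by (auto simp: bij_betw_def inj_on_def)
    moreover have "SU2_orbit_map n (h i) ` topspace RP3 \<inter> ?A = {}"
      using SU2_orbit_map_in[OF hW[OF i]] by auto
    ultimately show "bij_betw (collapse_map ?A \<circ> SU2_orbit_map n (h i)) (topspace RP3 - {}) (?S i)"
      using bij_betw_collapse_map by fastforce
  qed (auto simp: topspace_collapse)
  have disj: "?S i \<inter> ?S j = {}" if "i < K_num n" "j < K_num n" "i \<noteq> j" for i j
  proof -
    have "h i \<noteq> h j" using h that by (auto simp: bij_betw_def inj_on_def)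
    then show ?thesis using SU2_orbit_map_inj[OF hW[OF that(1)] hW[OF that(2)]] by fastforce
  qed
  have "(\<Union>i<K_num n. ?S i) = Some ` {x \<in> topspace ?X - ?A. \<not> commuting n x}"
  proof (intro equalityI subsetI)
    fix z assume "z \<in> (\<Union>i<K_num n. ?S i)"
    then obtain i l where il: "i < K_num n" "l \<in> topspace RP3" "z = Some (SU2_orbit_map n (h i) l)" by auto
    show "z \<in> Some ` {x \<in> topspace ?X - ?A. \<not> commuting n x}"
      using SU2_orbit_map_in[OF hW[OF il(1)] il(2)] il(3) by blast
  next
    fix z assume "z \<in> Some ` {x \<in> topspace ?X - ?A. \<not> commuting n x}"
    then obtain x where x: "z = Some x" "x \<in> topspace ?X - ?A" "\<not> commuting n x" by auto
    obtain c l where c: "c \<in> ?W" "l \<in> topspace RP3" "x = SU2_orbit_map n c l"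
      using SU2_orbit_map_surj[OF x(2,3)] .
    moreover obtain i where "i < K_num n" "c = h i" using h c(1) by (auto simp: bij_betw_def)
    ultimately show "z \<in> (\<Union>i<K_num n. ?S i)" using x(1) by blast
  qed
  moreover have "covers (bouquet (K_num n) (add_basepoint RP3) None) None (collapse ?X ?A) None
      (case_option None (\<lambda>(i, x). case_option None (collapse_map ?A \<circ> SU2_orbit_map n (h i)) x)) (\<Union>i<K_num n. ?S i)"
    by (rule covers_bouquet[OF cov disj]) (simp_all add: topspace_collapse)
  ultimately show ?thesis by auto
qed

section \<open>Tuples in SO(3) without a common axis\<close>

definition axes_to_signed_axes :: "real^3^3 \<Rightarrow> bool" where
  "axes_to_signed_axes M \<longleftrightarrow> (M *v e1 = e1 \<or> M *v e1 = - e1) \<and> (M *v e2 = e2 \<or> M *v e2 = - e2)"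

text \<open>The lifts of the rotations that preserve each coordinate axis. Such a rotation is
  determined by its signs on \<open>e1\<close> and \<open>e2\<close>, so it suffices to name these
  two.\<close>

definition Q8_quaternions :: "quaternion set" where
  "Q8_quaternions = {q. norm q = 1 \<and> axes_to_signed_axes (rotm q)}"

lemma rotm_imaginary_axis:
  "rotm (0, e1) *v e1 = e1" "rotm (0, e1) *v e2 = - e2"
  "rotm (0, e2) *v e1 = - e1" "rotm (0, e2) *v e2 = e2"
  "rotm (0, e3) *v e1 = - e1" "rotm (0, e3) *v e2 = - e2"
  by (simp_all add: rotm_vector_mult inner_axis_axis scaleR_2)

text \<open>The four sign patterns on \<open>e1\<close> and \<open>e2\<close> are realised by 1 and
  the three imaginary units, and each rotation has exactly two lifts.\<close>

lemma Q8_eq: "Q8 = umat ` Q8_quaternions"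
proof -
  let ?L = "{(1, 0), - (1, 0), (0, e1), - (0, e1), (0, e2), - (0, e2), (0, e3), - (0, e3)} :: quaternion set"
  have unit: "norm ((0, e1) :: quaternion) = 1" "norm ((0, e2) :: quaternion) = 1" "norm ((0, e3) :: quaternion) = 1"
    "norm ((1, 0) :: quaternion) = 1"
    by (simp_all add: norm_quaternion inner_axis_axis)
  have "umat (0, e1) = quat_i" "umat (0, e2) = quat_j" "umat (0, e3) = quat_k"
    by (simp_all add: umat_def quat_i_def quat_j_def quat_k_def mat2_eq_iff complex_eq_iff axis_def)
  then have "Q8 = umat ` ?L"
    unfolding Q8_def by (simp only: image_insert image_empty umat_minus umat_one)
  moreover have "?L = Q8_quaternions"
  proof
    show "?L \<subseteq> Q8_quaternions"
      unfolding Q8_quaternions_def axes_to_signed_axes_def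
      by (simp only: insert_subset empty_subsetI mem_Collect_eq rotm_minus norm_minus_cancel unit
          rotm_imaginary_axis rotm_one matrix_vector_mul_lid simp_thms)
    show "Q8_quaternions \<subseteq> ?L"
    proof
      fix q assume "q \<in> Q8_quaternions"
      then have q: "norm q = 1" "axes_to_signed_axes (rotm q)" by (auto simp: Q8_quaternions_def)
      have *: "q = p \<or> q = - p" if "norm p = 1" "rotm q *v e1 = rotm p *v e1" "rotm q *v e2 = rotm p *v e2" for p
      proof -
        have "rotm q = rotm p"
          using q that by (intro rotation_matrix_eqI rotation_matrix_rotm)
        then show ?thesis using rotm_eq_iff[OF q(1) that(1)] by simp
      qed
      show "q \<in> ?L"
        using q(2) *[OF unit(1)] *[OF unit(2)] *[OF unit(3)] *[OF unit(4)]
        unfolding axes_to_signed_axes_def rotm_imaginary_axis rotm_one matrix_vector_mul_lid by blast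
    qed
  qed
  ultimately show ?thesis by (simp only:)
qed

lemma Q8_quaternions_closed:
  assumes "q \<in> Q8_quaternions"
  shows "qconj q \<in> Q8_quaternions" "r \<in> Q8_quaternions \<Longrightarrow> qmul q r \<in> Q8_quaternions"
proof -
  have q: "norm q = 1" "axes_to_signed_axes (rotm q)" using assms by (auto simp: Q8_quaternions_def)
  have inv: "rotm (qconj q) *v (rotm q *v x) = x" for x
    using q(1) by (simp add: matrix_vector_mul_assoc qmul_qconj flip: rotm_qmul)
  have "rotm (qconj q) *v e = e \<or> rotm (qconj q) *v e = - e" if "rotm q *v e = e \<or> rotm q *v e = - e" for e
    using that inv[of e] by (metis rotation_matrix_minus_vector add.inverse_inverse)
  then show "qconj q \<in> Q8_quaternions"
    using q by (simp add: Q8_quaternions_def axes_to_signed_axes_def)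
  show "qmul q r \<in> Q8_quaternions" if "r \<in> Q8_quaternions"
    using that q
    by (auto simp: Q8_quaternions_def axes_to_signed_axes_def norm_qmul rotm_qmul rotation_matrix_minus_vector
        simp flip: matrix_vector_mul_assoc)
qed

lemma Q8_coset: "umat p <#\<^bsub>SU2\<^esub> Q8 = (\<lambda>q. umat (qmul p q)) ` Q8_quaternions"
  by (auto simp: l_coset_def Q8_eq SU2_def umat_qmul)

lemma Q8_coset_eqI:
  assumes "norm p' = 1" "norm p = 1" "qmul (qconj p') p \<in> Q8_quaternions"
  shows "umat p <#\<^bsub>SU2\<^esub> Q8 = umat p' <#\<^bsub>SU2\<^esub> Q8"
proof -
  let ?q = "qmul (qconj p') p"
  have p: "p = qmul p' ?q" using assms(1) by (simp add: qmul_qconj flip: qmul_assoc)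
  have p': "p' = qmul p (qconj ?q)"
    using assms by (simp add: qconj_qmul qmul_qconj qmul_assoc[symmetric]) (simp add: qconj_def)
  show ?thesis
    unfolding Q8_coset
  proof (intro equalityI image_subsetI)
    fix r assume r: "r \<in> Q8_quaternions"
    have "umat (qmul p r) = umat (qmul p' (qmul ?q r))" by (subst p) (simp only: qmul_assoc)
    then show "umat (qmul p r) \<in> (\<lambda>q. umat (qmul p' q)) ` Q8_quaternions"
      using Q8_quaternions_closed(2)[OF assms(3) r] by blast
    have "umat (qmul p' r) = umat (qmul p (qmul (qconj ?q) r))" by (subst p') (simp only: qmul_assoc)
    then show "umat (qmul p' r) \<in> (\<lambda>q. umat (qmul p q)) ` Q8_quaternions"
      using Q8_quaternions_closed(2)[OF Q8_quaternions_closed(1)[OF assms(3)] r] by blast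
  qed
qed

section \<open>Orbits of half-turn tuples in SO(3)\<close>

lemma words_unsigned_letters:
  "c \<in> words unsigned_letters n s \<Longrightarrow> s \<le> 2 \<Longrightarrow> i < n \<Longrightarrow> c i \<in> {e1, e2, e3}"
proof (induction n arbitrary: c s)
  case (Suc n)
  obtain d x t where d: "d \<in> words unsigned_letters n t" "c = d(n := x)"
    "t = s \<and> x \<in> unsigned_letters s \<or> s = Suc t \<and> x = frame s"
    using Suc.prems(1) by (rule words_SucE)
  have "x \<in> {e1, e2, e3}"
    using d(3) by (auto simp: unsigned_letters_def frame_def split: if_splits)
  moreover have "d i \<in> {e1, e2, e3}" if "i < n"
    using Suc.IH[OF d(1)] d(3) Suc.prems(2) that by auto
  ultimately show ?case using d(2) Suc.prems(3) by (auto simp: less_Suc_eq)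
qed simp

definition SO3_orbit_map :: "nat \<Rightarrow> (nat \<Rightarrow> real^3) \<Rightarrow> (complex^2^2) set \<Rightarrow> nat \<Rightarrow> real^3^3" where
  "SO3_orbit_map n c C = (\<lambda>i\<in>{..<n}. rotm (0, rotm (quaternion_of_mat (SOME g. g \<in> C)) *v c i))"

text \<open>Independence of the chosen representative: another one differs by an element of
  \<open>Q8\<close>, which moves each letter at most by a sign, and a half-turn does not change when
  its axis vector is negated.\<close>

lemma SO3_orbit_map_coset:
  assumes "c \<in> words unsigned_letters n 2"
  shows "SO3_orbit_map n c (umat p <#\<^bsub>SU2\<^esub> Q8) = (\<lambda>i\<in>{..<n}. rotm (0, rotm p *v c i))"
proof -
  have "(1, 0) \<in> Q8_quaternions"
    by (simp add: Q8_quaternions_def axes_to_signed_axes_def norm_quaternion)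
  then have "umat p \<in> umat p <#\<^bsub>SU2\<^esub> Q8"
    unfolding Q8_coset by (intro image_eqI[of _ _ "(1, 0)"]) simp_all
  then have "(SOME g. g \<in> umat p <#\<^bsub>SU2\<^esub> Q8) \<in> umat p <#\<^bsub>SU2\<^esub> Q8"
    by (rule someI)
  then obtain q where q: "q \<in> Q8_quaternions" "(SOME g. g \<in> umat p <#\<^bsub>SU2\<^esub> Q8) = umat (qmul p q)"
    unfolding Q8_coset by auto
  have R: "rotation_matrix (rotm q)" "axes_to_signed_axes (rotm q)"
    using q(1) by (auto simp: Q8_quaternions_def rotation_matrix_rotm)
  have e3: "rotm q *v e3 = e3 \<or> rotm q *v e3 = - e3"
    using R(2) rotation_matrix_axes[OF R(1), of 1 1] rotation_matrix_axes[OF R(1), of 1 "-1"]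
      rotation_matrix_axes[OF R(1), of "-1" 1] rotation_matrix_axes[OF R(1), of "-1" "-1"]
    by (auto simp: axes_to_signed_axes_def)
  have neg: "rotm (0, - y) = rotm (0, y)" for y using rotm_minus[of "(0, y)"] by simp
  have "rotm (0, rotm (qmul p q) *v c i) = rotm (0, rotm p *v c i)" if "i < n" for i
  proof -
    have "c i \<in> {e1, e2, e3}" using words_unsigned_letters[OF assms _ that] by simp
    then have "rotm q *v c i = c i \<or> rotm q *v c i = - c i"
      using R(2) e3 by (auto simp: axes_to_signed_axes_def)
    then show ?thesis
      by (auto simp: rotm_qmul rotation_matrix_minus_vector neg simp flip: matrix_vector_mul_assoc)
  qed
  then show ?thesis by (auto simp: SO3_orbit_map_def q(2))
qed

lemma topspace_S3_mod_Q8: "topspace S3_mod_Q8 = {umat p <#\<^bsub>SU2\<^esub> Q8 |p. norm p = 1}"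
  unfolding S3_mod_Q8_def
  by (subst topspace_identification_topology) (auto simp: carrier_SU2 simp del: split_paired_Ex)

lemma compact_space_S3_mod_Q8: "compact_space S3_mod_Q8"
proof -
  have "compact (carrier SU2)"
    unfolding carrier_SU2 by (intro compact_continuous_image continuous_on_umat compact_sphere)
  then have "compactin (top_of_set (carrier SU2)) (carrier SU2)"
    by (simp add: compactin_subtopology)
  moreover have "quotient_map (top_of_set (carrier SU2)) S3_mod_Q8 (\<lambda>g. g <#\<^bsub>SU2\<^esub> Q8)"
    unfolding S3_mod_Q8_def by (rule quotient_map_identification_topology) simp
  ultimately have "compactin S3_mod_Q8 ((\<lambda>g. g <#\<^bsub>SU2\<^esub> Q8) ` carrier SU2)"
    using image_compactin quotient_imp_continuous_map by blast
  moreover have "topspace S3_mod_Q8 = (\<lambda>g. g <#\<^bsub>SU2\<^esub> Q8) ` carrier SU2"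
    unfolding S3_mod_Q8_def by (subst topspace_identification_topology) auto
  ultimately show ?thesis by (simp add: compact_space_def)
qed

lemma SO3_orbit_map_in:
  assumes c: "c \<in> words unsigned_letters n 2" and C: "C \<in> topspace S3_mod_Q8"
  shows "SO3_orbit_map n c C \<in> {x \<in> topspace (Hom_space n SO3) - Hom_S1_set n SO3. \<not> coaxial n x}"
proof -
  obtain p where p: "norm p = 1" "C = umat p <#\<^bsub>SU2\<^esub> Q8" using C by (auto simp: topspace_S3_mod_Q8)
  let ?y = "\<lambda>i. rotm p *v c i"
  have x: "SO3_orbit_map n c C = (\<lambda>i\<in>{..<n}. rotm (0, ?y i))"
    using SO3_orbit_map_coset[OF c] p(2) by simp
  note M = rotation_matrix_rotm[OF p(1)]
  have letters: "c i \<in> {e1, e2, e3}" if "i < n" for i using words_unsigned_letters[OF c _ that] by simp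
  have y: "norm (?y i) = 1" if "i < n" for i
    using letters[OF that] by (auto simp: rotation_matrix_norm[OF M] norm_axis_1)
  then have 1: "norm ((0, ?y i) :: quaternion) = 1" if "i < n" for i
    using that by (simp add: norm_quaternion norm_eq_1)
  have "commutator SO3 (rotm (0, ?y i)) (rotm (0, ?y j)) = mat 1" if "i < n" "j < n" for i j
  proof -
    have "c i = c j \<or> c i \<bullet> c j = 0"
      using letters[OF that(1)] letters[OF that(2)] by (auto simp: inner_axis_axis)
    then show ?thesis
      unfolding commutator_SO3[OF 1[OF that(1)] 1[OF that(2)]] qmul_anticommute_iff[OF 1[OF that(1)] 1[OF that(2)]]
      by (auto simp: rotation_matrix_inner[OF M])
  qed
  then have "SO3_orbit_map n c C \<in> topspace (Hom_space n SO3)"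
    using 1 by (auto simp: x topspace_B_space carrier_SO3)
  moreover have "rotm (0, ?y i) \<noteq> mat 1" if "i < n" for i
    using rotm_eq_one[OF 1[OF that]] by auto
  moreover have "\<not> coaxial n (SO3_orbit_map n c C)"
  proof
    assume "coaxial n (SO3_orbit_map n c C)"
    then obtain u where u: "norm u = 1" "\<And>i. i < n \<Longrightarrow> rotm (0, ?y i) *v u = u"
      by (auto simp: coaxial_def x)
    \<comment> \<open>The axis vector of a half-turn is parallel to any unit vector it fixes. A
      common fixed vector would make the images of \<open>e1\<close> and \<open>e2\<close> parallel,
      although they are orthogonal.\<close>
    have yu: "?y i = (u \<bullet> ?y i) *\<^sub>R u" if "i < n" for i
      using rotm_fixed_vector[OF 1[OF that] u(2)[OF that] u(1)] by simp
    have nz: "u \<bullet> ?y i \<noteq> 0" if "i < n" for i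
      using yu[OF that] y[OF that] by force
    obtain k l where k: "k < n" "l < n" "c k = e1" "c l = e2" using word_axes[OF c] .
    have "?y k \<bullet> ?y l = 0" using k by (simp add: rotation_matrix_inner[OF M] inner_axis_axis)
    moreover have "?y k \<bullet> ?y l = (u \<bullet> ?y k) * (u \<bullet> ?y l)"
      by (subst yu[OF k(1)]) simp
    ultimately show False using nz[OF k(1)] nz[OF k(2)] by (metis mult_eq_0_iff)
  qed
  ultimately show ?thesis by (auto simp: S1_set_def x)
qed

lemma rotm_half_turn_eq:
  assumes "norm y = 1" "norm y' = 1" "rotm (0, y) = rotm (0, y')"
  shows "y = y' \<or> y = - y'"
proof -
  have "norm ((0, y) :: quaternion) = 1" "norm ((0, y') :: quaternion) = 1"
    using assms by (simp_all add: norm_quaternion norm_eq_1)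
  then show ?thesis using rotm_eq_iff assms(3) by fastforce
qed

text \<open>A half-turn determines its axis vector up to sign, so \<open>?q\<close> carries one word
  to the other up to signs. Rigidity then gives equal words and shows that \<open>?q\<close>
  preserves the axes, so \<open>?q\<close> lies in \<open>Q8\<close> and the cosets agree.\<close>

lemma SO3_orbit_map_inj:
  assumes c: "c \<in> words unsigned_letters n 2" and c': "c' \<in> words unsigned_letters n 2"
    and "C \<in> topspace S3_mod_Q8" "C' \<in> topspace S3_mod_Q8" "SO3_orbit_map n c C = SO3_orbit_map n c' C'"
  shows "c = c' \<and> C = C'"
proof -
  obtain p where p: "norm p = 1" "C = umat p <#\<^bsub>SU2\<^esub> Q8" using assms by (auto simp: topspace_S3_mod_Q8)
  obtain p' where p': "norm p' = 1" "C' = umat p' <#\<^bsub>SU2\<^esub> Q8" using assms by (auto simp: topspace_S3_mod_Q8)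
  let ?q = "qmul (qconj p') p"
  have q: "norm ?q = 1" using p p' by (simp add: norm_qmul)
  have unit: "norm (rotm p *v c i) = 1" "norm (rotm p' *v c' i) = 1" if "i < n" for i
    using words_unsigned_letters[OF c _ that] words_unsigned_letters[OF c' _ that]
    by (auto simp: rotation_matrix_norm[OF rotation_matrix_rotm] p p' norm_axis_1)
  have inv: "rotm (qconj p') *v (rotm p' *v x) = x" for x
    using p'(1) by (simp add: matrix_vector_mul_assoc qmul_qconj flip: rotm_qmul)
  have "rotm ?q *v c i = c' i \<or> rotm ?q *v c i = - c' i" if "i < n" for i
  proof -
    have "rotm (0, rotm p *v c i) = rotm (0, rotm p' *v c' i)"
      using fun_cong[OF assms(5), of i] that by (simp add: p p' SO3_orbit_map_coset c c')
    then have "rotm p *v c i = rotm p' *v c' i \<or> rotm p *v c i = - (rotm p' *v c' i)"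
      using unit that by (intro rotm_half_turn_eq)
    then show ?thesis
      using inv[of "c' i"] by (auto simp: rotm_qmul rotation_matrix_minus_vector simp flip: matrix_vector_mul_assoc)
  qed
  then have *: "c = c'" "\<And>r. 1 \<le> r \<Longrightarrow> r \<le> 2 \<Longrightarrow> rotm ?q *v frame r = frame r \<or> rotm ?q *v frame r = - frame r"
    using unsigned_words_rigid[OF rotation_matrix_rotm[OF q] c c'] by auto
  have "?q \<in> Q8_quaternions"
    using *(2)[of 1] *(2)[of 2] q by (simp add: Q8_quaternions_def axes_to_signed_axes_def frame_def)
  then show ?thesis using Q8_coset_eqI[OF p'(1) p(1)] p(2) p'(2) *(1) by simp
qed

text \<open>Used in contrapositive form: a tuple without a common axis has two lifts that do not
  commute, which is what \<open>noncommuting_quaternions\<close> starts from.\<close>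

lemma commuting_rotations_coaxial:
  fixes n :: nat
  assumes "\<And>i. i < n \<Longrightarrow> norm (p i) = 1" "\<And>i. i < n \<Longrightarrow> rotm (p i) \<noteq> mat 1"
    "\<And>i j. i < n \<Longrightarrow> j < n \<Longrightarrow> qmul (p i) (p j) = qmul (p j) (p i)"
  shows "\<exists>u. norm u = 1 \<and> (\<forall>i<n. rotm (p i) *v u = u)"
proof (cases "n = 0")
  case True
  then show ?thesis using norm_axis_1[of 1] by blast
next
  case False
  have "snd (p 0) \<noteq> 0"
  proof
    assume "snd (p 0) = 0"
    then have "p 0 = (1, 0) \<or> p 0 = - (1, 0)"
      using assms(1)[of 0] False by (auto simp: norm_quaternion prod_eq_iff power2_eq_1_iff)
    then show False using assms(2)[of 0] False rotm_one rotm_minus by (metis gr0I)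
  qed
  define u where "u = snd (p 0) /\<^sub>R norm (snd (p 0))"
  have u: "norm u = 1" using \<open>snd (p 0) \<noteq> 0\<close> by (simp add: u_def)
  have "rotm (p i) *v u = u" if "i < n" for i
  proof -
    have "cross3 (snd (p 0)) (snd (p i)) = 0"
      using assms(3)[of 0 i] that False by (simp add: qmul_commute_iff)
    then have "cross3 u (snd (p i)) = 0" by (simp add: u_def Cross3.cross_mult_left)
    then show ?thesis using rotm_fixes_axis[OF assms(1)[OF that]] cross3_unit_eq_0[OF u] by blast
  qed
  then show ?thesis using u by blast
qed

lemma SO3_orbit_map_surj:
  assumes "x \<in> topspace (Hom_space n SO3) - Hom_S1_set n SO3" "\<not> coaxial n x"
  obtains c C where "c \<in> words unsigned_letters n 2" "C \<in> topspace S3_mod_Q8" "x = SO3_orbit_map n c C"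
proof -
  have "\<exists>p. norm p = 1 \<and> x i = rotm p" if "i < n" for i
  proof -
    have "x i \<in> carrier SO3" using assms(1) that by (auto simp: topspace_B_space)
    then show ?thesis unfolding carrier_SO3 by (metis (lifting) imageE mem_sphere_0)
  qed
  then obtain p where p: "\<And>i. i < n \<Longrightarrow> norm (p i) = 1" "\<And>i. i < n \<Longrightarrow> x i = rotm (p i)"
    by metis
  have ne1: "rotm (p i) \<noteq> mat 1" if "i < n" for i
    using assms(1) p(2)[OF that] that by (auto simp: S1_set_def)
  have ne: "p i \<noteq> (1, 0)" "p i \<noteq> - (1, 0)" if "i < n" for i
    using ne1[OF that] rotm_one rotm_minus[of "(1, 0)"] by auto
  have com: "qmul (p i) (p j) = qmul (p j) (p i) \<or> qmul (p i) (p j) = - qmul (p j) (p i)" if "i < n" "j < n" for i j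
  proof -
    have "commutator SO3 (x i) (x j) = mat 1" using assms(1) that by (auto simp: topspace_B_space)
    then show ?thesis
      unfolding p(2)[OF that(1)] p(2)[OF that(2)] commutator_SO3[OF p(1)[OF that(1)] p(1)[OF that(2)]] .
  qed
  obtain k l where k: "k < n" "l < n" "qmul (p k) (p l) \<noteq> qmul (p l) (p k)"
  proof -
    have "\<not> (\<forall>i<n. \<forall>j<n. qmul (p i) (p j) = qmul (p j) (p i))"
    proof
      assume "\<forall>i<n. \<forall>j<n. qmul (p i) (p j) = qmul (p j) (p i)"
      then have "\<exists>u. norm u = 1 \<and> (\<forall>i<n. rotm (p i) *v u = u)"
        using p(1) ne1 by (intro commuting_rotations_coaxial) blast+
      then show False using assms(2) p(2) by (auto simp: coaxial_def)
    qed
    then show ?thesis using that by blast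
  qed
  obtain M c where M: "rotation_matrix M" "c \<in> words signed_letters n 2"
      "\<And>i. i < n \<Longrightarrow> p i = pure_quaternion (M *v c i)"
    using noncommuting_quaternions[of n p k l, OF p(1) ne(1) com k] by blast
  \<comment> \<open>The letter 0 stands for the lift \<open>-1\<close>, whose rotation is the
    excluded identity; this is why the word may be read in the unsigned alphabet.\<close>
  have c0: "c i \<noteq> 0" if "i < n" for i
    using M(3)[OF that] ne(2)[OF that] by (auto simp: pure_quaternion_def)
  then have d: "unsign \<circ> c \<in> words unsigned_letters n 2"
    using unsign_words[OF M(2)] by simp
  obtain q where q: "norm q = 1" "rotm q = M" using rotm_surj[OF M(1)] .
  have "x = SO3_orbit_map n (unsign \<circ> c) (umat q <#\<^bsub>SU2\<^esub> Q8)"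
  proof
    fix i
    show "x i = SO3_orbit_map n (unsign \<circ> c) (umat q <#\<^bsub>SU2\<^esub> Q8) i"
    proof (cases "i < n")
      case True
      have "norm (M *v c i) = 1"
        using signed_word_relations(1)[OF M(1,2), of i] c0[OF True] rotation_matrix_inj[OF M(1), of "c i" 0] by auto
      then have "x i = rotm (0, M *v c i)"
        using p(2)[OF True] M(3)[OF True] by (simp add: pure_quaternion_def norm_eq_1)
      moreover have "rotm (0, M *v unsign (c i)) = rotm (0, M *v c i)"
        using unsign_cases[of "c i"] rotm_minus[of "(0, M *v c i)"] by (auto simp: rotation_matrix_minus_vector)
      ultimately show ?thesis using True by (simp add: SO3_orbit_map_coset[OF d] q)
    next
      case False
      then show ?thesis using assms(1) by (auto simp: topspace_B_space PiE_def extensional_def SO3_orbit_map_def)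
    qed
  qed
  moreover have "umat q <#\<^bsub>SU2\<^esub> Q8 \<in> topspace S3_mod_Q8"
    using q by (auto simp: topspace_S3_mod_Q8 simp del: split_paired_Ex)
  ultimately show ?thesis using that d by blast
qed

lemma continuous_map_SO3_orbit_map:
  assumes "c \<in> words unsigned_letters n 2"
  shows "continuous_map S3_mod_Q8 (Hom_space n SO3) (SO3_orbit_map n c)"
  unfolding S3_mod_Q8_def
proof (rule continuous_map_identification_topology)
  have eq: "(SO3_orbit_map n c \<circ> (\<lambda>g. g <#\<^bsub>SU2\<^esub> Q8)) g
      = (\<lambda>i\<in>{..<n}. rotm (0, rotm (quaternion_of_mat g) *v c i))" if "g \<in> carrier SU2" for g
    using that SO3_orbit_map_coset[OF assms] by (auto simp: carrier_SU2)
  show "continuous_map (top_of_set (carrier SU2)) (Hom_space n SO3) (SO3_orbit_map n c \<circ> (\<lambda>g. g <#\<^bsub>SU2\<^esub> Q8))"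
  proof (rule continuous_map_into_B_space)
    fix i assume i: "i < n"
    have "continuous_map (top_of_set (carrier SU2)) euclidean quaternion_of_mat"
      by (simp add: continuous_on_quaternion_of_mat)
    then have "continuous_map (top_of_set (carrier SU2)) euclidean (\<lambda>g. rotm (0, rotm (quaternion_of_mat g) *v c i))"
      by (intro continuous_map_compose_continuous_on[where h = rotm]
          continuous_map_compose_continuous_on[where h = "\<lambda>y. (0, y)"]
          continuous_map_compose_continuous_on[where h = "\<lambda>M. M *v c i"]
          continuous_on_rotm matrix_vector_continuous continuous_intros)
    then show "continuous_map (top_of_set (carrier SU2)) euclidean (\<lambda>g. (SO3_orbit_map n c \<circ> (\<lambda>g. g <#\<^bsub>SU2\<^esub> Q8)) g i)"
      by (rule continuous_map_eq) (use eq i in simp)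
  next
    fix g assume "g \<in> topspace (top_of_set (carrier SU2))"
    then have "g <#\<^bsub>SU2\<^esub> Q8 \<in> topspace S3_mod_Q8"
      by (auto simp: topspace_S3_mod_Q8 carrier_SU2 simp del: split_paired_Ex)
    then show "(SO3_orbit_map n c \<circ> (\<lambda>g. g <#\<^bsub>SU2\<^esub> Q8)) g \<in> topspace (Hom_space n SO3)"
      using SO3_orbit_map_in[OF assms] by auto
  qed
qed simp

lemma covers_SO3_orbits:
  "\<exists>f. covers (bouquet (C_num n) (add_basepoint S3_mod_Q8) None) None
    (collapse (Hom_space n SO3) (Hom_S1_set n SO3)) None f
    (Some ` {x \<in> topspace (Hom_space n SO3) - Hom_S1_set n SO3. \<not> coaxial n x})"
proof -
  let ?X = "Hom_space n SO3" and ?A = "Hom_S1_set n SO3"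
  let ?W = "words unsigned_letters n 2"
  obtain h where h: "bij_betw h {..<C_num n} ?W"
    using ex_bij_betw_nat_finite[of ?W] card_unsigned_words[of n] by (auto simp: atLeast0LessThan)
  have hW: "h i \<in> ?W" if "i < C_num n" for i using h that by (auto simp: bij_betw_def)
  let ?S = "\<lambda>i. Some ` SO3_orbit_map n (h i) ` topspace S3_mod_Q8"
  have cov: "covers (add_basepoint S3_mod_Q8) None (collapse ?X ?A) None
      (case_option None (collapse_map ?A \<circ> SO3_orbit_map n (h i))) (?S i)" if i: "i < C_num n" for i
  proof (rule covers_collapse[OF compact_space_S3_mod_Q8])
    show "continuous_map S3_mod_Q8 (collapse ?X ?A) (collapse_map ?A \<circ> SO3_orbit_map n (h i))"
      using continuous_map_compose continuous_map_SO3_orbit_map[OF hW[OF i]] continuous_map_collapse_map by blast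
    have "bij_betw (SO3_orbit_map n (h i)) (topspace S3_mod_Q8) (SO3_orbit_map n (h i) ` topspace S3_mod_Q8)"
      using SO3_orbit_map_inj[OF hW[OF i] hW[OF i]] by (auto simp: bij_betw_def inj_on_def)
    moreover have "SO3_orbit_map n (h i) ` topspace S3_mod_Q8 \<inter> ?A = {}"
      using SO3_orbit_map_in[OF hW[OF i]] by auto
    ultimately show "bij_betw (collapse_map ?A \<circ> SO3_orbit_map n (h i)) (topspace S3_mod_Q8 - {}) (?S i)"
      using bij_betw_collapse_map by fastforce
  qed (auto simp: topspace_collapse)
  have disj: "?S i \<inter> ?S j = {}" if "i < C_num n" "j < C_num n" "i \<noteq> j" for i j
  proof -
    have "h i \<noteq> h j" using h that by (auto simp: bij_betw_def inj_on_def)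
    then show ?thesis using SO3_orbit_map_inj[OF hW[OF that(1)] hW[OF that(2)]] by fastforce
  qed
  have "(\<Union>i<C_num n. ?S i) = Some ` {x \<in> topspace ?X - ?A. \<not> coaxial n x}"
  proof (intro equalityI subsetI)
    fix z assume "z \<in> (\<Union>i<C_num n. ?S i)"
    then obtain i C where il: "i < C_num n" "C \<in> topspace S3_mod_Q8" "z = Some (SO3_orbit_map n (h i) C)" by auto
    show "z \<in> Some ` {x \<in> topspace ?X - ?A. \<not> coaxial n x}"
      using SO3_orbit_map_in[OF hW[OF il(1)] il(2)] il(3) by blast
  next
    fix z assume "z \<in> Some ` {x \<in> topspace ?X - ?A. \<not> coaxial n x}"
    then obtain x where x: "z = Some x" "x \<in> topspace ?X - ?A" "\<not> coaxial n x" by auto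
    obtain c C where c: "c \<in> ?W" "C \<in> topspace S3_mod_Q8" "x = SO3_orbit_map n c C"
      using SO3_orbit_map_surj[OF x(2,3)] .
    moreover obtain i where "i < C_num n" "c = h i" using h c(1) by (auto simp: bij_betw_def)
    ultimately show "z \<in> (\<Union>i<C_num n. ?S i)" using x(1) by blast
  qed
  moreover have "covers (bouquet (C_num n) (add_basepoint S3_mod_Q8) None) None (collapse ?X ?A) None
      (case_option None (\<lambda>(i, x). case_option None (collapse_map ?A \<circ> SO3_orbit_map n (h i)) x)) (\<Union>i<C_num n. ?S i)"
    by (rule covers_bouquet[OF cov disj]) (simp_all add: topspace_collapse)
  ultimately show ?thesis by auto
qed

section \<open>Assembling the homeomorphisms\<close>

text \<open>A 1-tuple satisfies every commutator condition, so the tuple space is the group itself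
  and the collapsed set is the single point given by the identity.\<close>

lemma covers_single:
  fixes G :: "'a::metric_space monoid"
  assumes "group G" "\<one>\<^bsub>G\<^esub> \<in> K" "compact_space Y" "continuous_map Y euclidean r"
    "bij_betw r (topspace Y) (carrier G)" "y0 \<in> topspace Y" "r y0 = \<one>\<^bsub>G\<^esub>"
  shows "\<exists>f. covers Y y0 (collapse (B_space 1 G K) (S1_set 1 G K)) None f
    (topspace (collapse (B_space 1 G K) (S1_set 1 G K)) - {None})"
proof -
  interpret group G by fact
  note One_nat_def [simp del]
  let ?X = "B_space 1 G K" and ?A = "S1_set 1 G K"
  define f where "f y = (\<lambda>i\<in>{..<1::nat}. r y)" for y
  have com: "commutator G x x = \<one>\<^bsub>G\<^esub>" if "x \<in> carrier G" for x
    unfolding commutator_eq_iff[OF that that one_closed] using that by (simp only: l_one m_closed)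
  have comK: "commutator G (x i) (x j) \<in> K" if "x \<in> PiE {..<1} (\<lambda>_. carrier G)" "i < 1" "j < 1" for x and i j :: nat
  proof -
    have "i = 0" "j = 0" using that(2,3) by simp_all
    moreover have "x 0 \<in> carrier G" using that(1) by (rule PiE_mem) simp
    ultimately show ?thesis using com[of "x 0"] assms(2) by simp
  qed
  have X: "topspace ?X = PiE {..<1} (\<lambda>_. carrier G)"
    unfolding topspace_B_space
  proof (intro equalityI subsetI CollectI conjI allI impI)
    show "x \<in> PiE {..<1} (\<lambda>_. carrier G)"
      if "x \<in> {x \<in> PiE {..<1} (\<lambda>_. carrier G). \<forall>i<1. \<forall>j<1. commutator G (x i) (x j) \<in> K}" for x
      using that unfolding mem_Collect_eq by (rule conjunct1)
  qed (assumption | rule comK)+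
  have rG: "r y \<in> carrier G" if "y \<in> topspace Y" for y using assms(5) that by (auto simp: bij_betw_def)
  have A: "x \<in> ?A \<longleftrightarrow> x \<in> topspace ?X \<and> x 0 = \<one>\<^bsub>G\<^esub>" for x by (auto simp: S1_set_def)
  have cont: "continuous_map Y ?X f"
    using assms(4) rG by (intro continuous_map_into_B_space) (auto simp: f_def X)
  have inj: "r y = r y' \<Longrightarrow> y = y'" if "y \<in> topspace Y" "y' \<in> topspace Y" for y y'
    using assms(5) that by (auto simp: bij_betw_def inj_on_def)
  have "bij_betw f (topspace Y - {y0}) (topspace ?X - ?A)"
    unfolding bij_betw_def
  proof
    show "inj_on f (topspace Y - {y0})"
    proof (rule inj_onI)
      fix y y' assume y: "y \<in> topspace Y - {y0}" "y' \<in> topspace Y - {y0}" "f y = f y'"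
      have "f y 0 = f y' 0" by (simp only: y(3))
      then have "r y = r y'" by (simp add: f_def)
      then show "y = y'" using y inj by blast
    qed
    show "f ` (topspace Y - {y0}) = topspace ?X - ?A"
    proof (intro equalityI subsetI)
      fix x assume "x \<in> f ` (topspace Y - {y0})"
      then obtain y where y: "y \<in> topspace Y" "y \<noteq> y0" "x = f y" by auto
      then have "r y \<noteq> \<one>\<^bsub>G\<^esub>" using inj[OF y(1) assms(6)] assms(7) by auto
      then show "x \<in> topspace ?X - ?A" using y rG by (auto simp: A X f_def)
    next
      fix x assume x: "x \<in> topspace ?X - ?A"
      then have "x 0 \<in> carrier G" by (auto simp: X)
      then obtain y where y: "y \<in> topspace Y" "r y = x 0" using assms(5) by (force simp: bij_betw_def)
      have "y \<noteq> y0" using x y assms(7) by (auto simp: A)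
      moreover have "x = f y" using x y by (auto simp: X f_def PiE_def extensional_def fun_eq_iff)
      ultimately show "x \<in> f ` (topspace Y - {y0})" using y by blast
    qed
  qed
  then have "bij_betw (collapse_map ?A \<circ> f) (topspace Y - {y0}) (Some ` (topspace ?X - ?A))"
    by (rule bij_betw_collapse_map) auto
  moreover have "topspace (collapse ?X ?A) - {None} = Some ` (topspace ?X - ?A)"
    by (auto simp: topspace_collapse)
  moreover have "(collapse_map ?A \<circ> f) y0 = None"
    using assms(6,7) by (auto simp: collapse_map_def A X f_def)
  moreover have "continuous_map Y (collapse ?X ?A) (collapse_map ?A \<circ> f)"
    using continuous_map_compose cont continuous_map_collapse_map by blast
  ultimately have "covers Y y0 (collapse ?X ?A) None (collapse_map ?A \<circ> f) (topspace (collapse ?X ?A) - {None})"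
    using assms(3,6) by (simp add: covers_def)
  then show ?thesis by blast
qed

lemma single_SU2:
  assumes "mat 1 \<in> K"
  shows "collapse (B_space 1 SU2 K) (S1_set 1 SU2 K) homeomorphic_space S3"
proof -
  have "bij_betw (\<lambda>p. umat (quaternion_of_vec p)) (topspace S3) (carrier SU2)"
  proof -
    have "umat q \<in> (\<lambda>p. umat (quaternion_of_vec p)) ` sphere 0 1" if "norm q = 1" for q
      using that by (intro image_eqI[of _ _ "vec_of_quaternion q"]) auto
    then show ?thesis
      by (auto simp: bij_betw_def inj_on_def umat_eq_iff S3_def carrier_SU2)
  qed
  moreover have "continuous_map S3 euclidean (\<lambda>p. umat (quaternion_of_vec p))"
    unfolding S3_def
    by (intro continuous_map_compose_continuous_on[where h = umat] continuous_on_umat)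
      (simp add: continuous_on_quaternion_of_vec)
  moreover have "compact_space S3" by (simp add: S3_def compact_space_subtopology)
  moreover have "vec_of_quaternion (1, 0) \<in> topspace S3" by (simp add: S3_def norm_quaternion)
  ultimately obtain f where f: "covers S3 (vec_of_quaternion (1, 0)) (collapse (B_space 1 SU2 K) (S1_set 1 SU2 K)) None f
      (topspace (collapse (B_space 1 SU2 K) (S1_set 1 SU2 K)) - {None})"
    using covers_single[OF group_SU2, of K S3 "\<lambda>p. umat (quaternion_of_vec p)" "vec_of_quaternion (1, 0)"] assms
    by (auto simp: umat_one)
  show ?thesis
    by (rule covers_imp_homeomorphic_space[OF f Hausdorff_space_B_quotient])
qed

lemma single_SO3: "collapse (Hom_space 1 SO3) (Hom_S1_set 1 SO3) homeomorphic_space RP3"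
proof -
  let ?p = "vec_of_quaternion (1, 0)"
  have "{?p, - ?p} \<in> topspace RP3" by (auto simp: topspace_projective_space norm_quaternion)
  moreover have "RP3_rotation {?p, - ?p} = mat 1" by (simp add: RP3_rotation_pair)
  ultimately obtain f where f: "covers RP3 {?p, - ?p} (collapse (Hom_space 1 SO3) (Hom_S1_set 1 SO3)) None f
      (topspace (collapse (Hom_space 1 SO3) (Hom_S1_set 1 SO3)) - {None})"
    using covers_single[OF group_SO3, of "{mat 1}" RP3 RP3_rotation "{?p, - ?p}"]
      compact_space_projective_space continuous_map_RP3_rotation RP3_rotation_bij
    by auto
  show ?thesis
    by (rule covers_imp_homeomorphic_space[OF f Hausdorff_space_B_quotient])
qed

lemma topspace_collapse_diff: "topspace (collapse X A) - {None} = Some ` (topspace X - A)"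
  by (auto simp: topspace_collapse)

text \<open>The predicate \<open>P\<close> splits the points off the basepoint into two parts, one
  per summand. Both orders are given because the theorem lists the disk summand first for SO(3) and
  last for almost commuting tuples in SU(2).\<close>

lemma homeomorphic_space_wedge:
  assumes "\<exists>f. covers Y y0 (collapse X A) None f (Some ` {x \<in> topspace X - A. P x})"
    "\<exists>g. covers Y' y0' (collapse X A) None g (Some ` {x \<in> topspace X - A. \<not> P x})"
    "Hausdorff_space (collapse X A)"
  shows "collapse X A homeomorphic_space wedge Y y0 Y' y0'" "collapse X A homeomorphic_space wedge Y' y0' Y y0"
proof -
  obtain f g where f: "covers Y y0 (collapse X A) None f (Some ` {x \<in> topspace X - A. P x})"
    and g: "covers Y' y0' (collapse X A) None g (Some ` {x \<in> topspace X - A. \<not> P x})"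
    using assms(1,2) by blast
  have disj: "Some ` {x \<in> topspace X - A. P x} \<inter> Some ` {x \<in> topspace X - A. \<not> P x} = {}"
    "Some ` {x \<in> topspace X - A. \<not> P x} \<inter> Some ` {x \<in> topspace X - A. P x} = {}"
    by auto
  have un: "Some ` {x \<in> topspace X - A. P x} \<union> Some ` {x \<in> topspace X - A. \<not> P x} = topspace (collapse X A) - {None}"
    "Some ` {x \<in> topspace X - A. \<not> P x} \<union> Some ` {x \<in> topspace X - A. P x} = topspace (collapse X A) - {None}"
    unfolding topspace_collapse_diff by auto
  show "collapse X A homeomorphic_space wedge Y y0 Y' y0'"
    by (rule covers_imp_homeomorphic_space[OF covers_wedge[OF f g disj(1), unfolded un] assms(3)])
  show "collapse X A homeomorphic_space wedge Y' y0' Y y0"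
    by (rule covers_imp_homeomorphic_space[OF covers_wedge[OF g f disj(2), unfolded un] assms(3)])
qed

theorem mainTheorem7:
  fixes n :: nat
  assumes "n \<ge> 1"
  shows
    "(n = 1 \<longrightarrow> collapse (Hom_space n SO3) (Hom_S1_set n SO3) homeomorphic_space RP3)
   \<and> (n \<ge> 2 \<longrightarrow> collapse (Hom_space n SO3) (Hom_S1_set n SO3) homeomorphic_space
        wedge (Thom_n_lambda2 n) None
          (bouquet (C_num n) (add_basepoint S3_mod_Q8) None) None)
   \<and> (n = 1 \<longrightarrow> collapse (Hom_space n SU2) (Hom_S1_set n SU2) homeomorphic_space S3)
   \<and> (n \<ge> 2 \<longrightarrow> collapse (Hom_space n SU2) (Hom_S1_set n SU2) homeomorphic_space Thom_mod_zero n)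
   \<and> (n = 1 \<longrightarrow> collapse (B_space n SU2 pm_one) (S1_set n SU2 pm_one) homeomorphic_space S3)
   \<and> (n \<ge> 2 \<longrightarrow> collapse (B_space n SU2 pm_one) (S1_set n SU2 pm_one) homeomorphic_space
        wedge (bouquet (K_num n) (add_basepoint RP3) None) None
          (Thom_mod_zero n) (Some None))"
proof (intro conjI impI)
  show "collapse (Hom_space n SO3) (Hom_S1_set n SO3) homeomorphic_space RP3" if "n = 1"
    using single_SO3 that by simp
  show "collapse (Hom_space n SU2) (Hom_S1_set n SU2) homeomorphic_space S3" if "n = 1"
    using single_SU2[of "{mat 1}"] that by simp
  show "collapse (B_space n SU2 pm_one) (S1_set n SU2 pm_one) homeomorphic_space S3" if "n = 1"
    using single_SU2[of pm_one] that by (simp add: pm_one_def)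
  show "collapse (Hom_space n SO3) (Hom_S1_set n SO3) homeomorphic_space
      wedge (Thom_n_lambda2 n) None (bouquet (C_num n) (add_basepoint S3_mod_Q8) None) None"
    by (rule homeomorphic_space_wedge[OF covers_SO3_disk[OF assms] covers_SO3_orbits Hausdorff_space_B_quotient])
  show "collapse (B_space n SU2 pm_one) (S1_set n SU2 pm_one) homeomorphic_space
      wedge (bouquet (K_num n) (add_basepoint RP3) None) None (Thom_mod_zero n) (Some None)"
    by (rule homeomorphic_space_wedge(2)[OF covers_SU2_disk[OF _ assms] covers_SU2_orbits Hausdorff_space_B_quotient])
      (simp add: pm_one_def)
  \<comment> \<open>With trivial commutators all tuples commute, so the disk part already covers
    everything and no orbit summand remains.\<close>
  have "{x \<in> topspace (Hom_space n SU2) - Hom_S1_set n SU2. commuting n x} = topspace (Hom_space n SU2) - Hom_S1_set n SU2"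
    by (auto simp: topspace_B_space commuting_def)
  then obtain f where f: "covers (Thom_mod_zero n) (Some None) (collapse (Hom_space n SU2) (Hom_S1_set n SU2)) None f
      (topspace (collapse (Hom_space n SU2) (Hom_S1_set n SU2)) - {None})"
    using covers_SU2_disk[of "{mat 1}", OF _ assms] by (auto simp: topspace_collapse_diff)
  show "collapse (Hom_space n SU2) (Hom_S1_set n SU2) homeomorphic_space Thom_mod_zero n"
    by (rule covers_imp_homeomorphic_space[OF f Hausdorff_space_B_quotient])
qed

end
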